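(* Let $f=(f_1,\ldots,f_n)$ be an $n$-tuple of formal power series with the model property and let $(M_{Z_1},\ldots,M_{Z_n})$ be the universal model associated with the noncommutative domain $\mathbb B_f$. If $H^\infty(\mathcal V_{f,J_c})$ is the WOT-closed algebra generated by the operators $$L_i:=P_{\mathbb H_s^2(f)}M_{Z_i}|_{\mathbb H_s^2(f)},\qquad i=1,\ldots,n,$$ and the identity, then the following statements hold. (i) $H^\infty(\mathcal V_{f,J_c})$ can be identified with the algebra of all multipliers of the Hilbert space $H^2(\mathbb B_f^<(\mathbb C))$. (ii) The algebra $H^\infty(\mathcal V_{f,J_c})$ is reflexive.
   Context: Notation. $\mathbb F_n^+$ is the free semigroup on $g_1,\ldots,g_n$ with identity $g_0$ and length $|\cdot|$. For an $n$-tuple $X$ of elements of a unital algebra, $X_\alpha=X_{i_1}\cdots X_{i_k}$ if $\alpha=g_{i_1}\cdots g_{i_k}$, $X_{g_0}=I$; $[f(X)]_\alpha$ is the corresponding product of $f_1(X),\ldots,f_n(X)$, and $[\overline{f(\lambda)}]_\alpha$ that of the complex conjugates $\overline{f_i(\lambda)}$. A tuple $X\in B(\mathcal H)^n$ is viewed as a row operator, so $\|X\|=\|\sum X_iX_i^*\|^{1/2}$; $[B(\mathcal H)^n]_\gamma=\{X:\|X\|<\gamma\}$. A free holomorphic function on $[B(\mathcal H)^n]_\gamma$ is a formal power series $\sum a_\alpha Z_\alpha$ in noncommuting indeterminates (complex coefficients) with radius of convergence $r$, $r^{-1}=\limsup_k(\sum_{|\alpha|=k}|a_\alpha|^2)^{1/2k}$,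 at least $\gamma$, identified with the map $X\mapsto\sum_k\sum_{|\alpha|=k}a_\alpha X_\alpha$ (norm convergence; $\mathcal H$ separable infinite-dimensional). $H^2_{\bf ball}$ is the Hilbert space of series with $\sum|a_\alpha|^2<\infty$ (the $Z_\alpha$ being orthonormal). Convergence sets. For an $n$-tuple $f$ of formal power series $f_j=\sum c^{(j)}_\alpha Z_\alpha$ and a Hilbert space $\mathcal H$: $\mathcal C_f^{SOT}(\mathcal H)$ is the set of $X\in B(\mathcal H)^n$ such that each series $f_j(X):=\sum_k\sum_{|\alpha|=k}c^{(j)}_\alpha X_\alpha$ is SOT-convergent; $\mathcal C_f^{rad}(\mathcal H)$ is the set of $X$ such that for some $\delta\in(0,1)$ these series converge in norm at $rX$ for all $r\in(\delta,1)$ and $f_j(X):=\text{SOT-}\lim_{r\to1}f_j(rX)$ exists for each $j$. Model property. $f=(f_1,\ldots,f_n)$ has the model property if one of the following holds. (A) $f$ is an $n$-tuple of noncommutative polynomials for which there is an $n$-tuple $g$ of noncommutative polynomials with $f\circ g=g\circ f=\mathrm{id}$. Then $\{f_\alpha\}$ is a linear basis of $\mathbb C[Z_1,\ldots,Z_n]$ and $\mathbb H^2(f)$ is the completion of $\mathbb C[Z_1,\ldots,Z_n]$ for the inner product $\langle f_\alpha,f_\beta\rangle=\delta_{\alpha\beta}$. (S) $f$ is an $n$-tuple of formal power series with $f(0)=0$, nonzero radius of convergence and $\det J_f(0)\neq0$ ($J_f(0)_{ij}$ is the coefficient of $Z_j$ in $f_i$); $\mathbb H^2(f)$ is the Hilbert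 space of formal power series $\sum a_\alpha f_\alpha$, $\sum|a_\alpha|^2<\infty$, with $\{f_\alpha\}$ orthonormal; $Z_1,\ldots,Z_n\in\mathbb H^2(f)$; left multiplication $M_{Z_i}$ by $Z_i$ is bounded on $\mathbb H^2(f)$; and $M_Z=(M_{Z_1},\ldots,M_{Z_n})$ belongs to $\mathcal C_f^{SOT}(\mathbb H^2(f))$ or $\mathcal C_f^{rad}(\mathbb H^2(f))$ with $f_j(M_Z)=M_{f_j}$ (left multiplication by $f_j$), $j=1,\ldots,n$. (F) $f$ is an $n$-tuple of free holomorphic functions on some $[B(\mathcal H)^n]_\gamma$, $\gamma>0$, with range in $[B(\mathcal H)^n]_1$, such that $G\circ f\not\equiv0$ for every nonzero free holomorphic $G$ on $[B(\mathcal H)^n]_1$; $\mathbb H^2(f)=\{G\circ f:G\in H^2_{\bf ball}\}$ with $\langle F\circ f,G\circ f\rangle=\langle F,G\rangle$; the coordinate functions $Z_1,\ldots,Z_n$ lie in $\mathbb H^2(f)$, left multiplications $M_{Z_i}$ by them are bounded on $\mathbb H^2(f)$, and $M_Z$ is in $\mathcal C_f^{SOT}(\mathbb H^2(f))$ or $\mathcal C_f^{rad}(\mathbb H^2(f))$ with $f_j(M_Z)=M_{f_j}$ for all $j$. In all cases $\{f_\alpha\}_{\alpha\in\mathbb F_n^+}$ is an orthonormal basis of $\mathbb H^2(f)$, and $M_Z$ is called the universal model. Writing $Z_i=\sum_\alpha a^{(i)}_\alpha f_\alpha$ in $\mathbb H^2(f)$, one has $M_{Z_i}f_\beta=\sum_\alpha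 a^{(i)}_\alpha f_{\alpha\beta}$, and $g_i:=\sum_\alpha a^{(i)}_\alpha Z_\alpha$ defines the inverse $g=(g_1,\ldots,g_n)$ of $f$ with respect to composition. Domain. $X\in B(\mathcal H)^n$ satisfies $g(f(X))=X$ if $X\in\mathcal C_f^{SOT}(\mathcal H)\cup\mathcal C_f^{rad}(\mathcal H)$ and either (for all $i$) $X_i=\sum_k\sum_{|\alpha|=k}a^{(i)}_\alpha[f(X)]_\alpha$ in the SOT, or (for all $i$) $X_i=\text{SOT-}\lim_{r\to1}\sum_k\sum_{|\alpha|=k}a^{(i)}_\alpha r^{|\alpha|}[f(X)]_\alpha$ (automatic in case (A)). Then $\mathbb B_f^<(\mathcal H):=\{X\in B(\mathcal H)^n:\ g(f(X))=X,\ \|f(X)\|<1\}$; $\mathbb B_f^<(\mathbb C)\subset\mathbb C^n$ is the case $\mathcal H=\mathbb C$. Symmetric Hardy space. $\mathbb N_0=\{0,1,\ldots\}$; for $\mathbf k\in\mathbb N_0^n$, $\lambda^{\mathbf k}=\lambda_1^{k_1}\cdots\lambda_n^{k_n}$, $f(\lambda)^{\mathbf k}=f_1(\lambda)^{k_1}\cdots f_n(\lambda)^{k_n}$; $\Lambda_{\mathbf k}:=\{\alpha\in\mathbb F_n^+:\lambda_\alpha=\lambda^{\mathbf k}\ \forall\lambda\in\mathbb C^n\}$, $\gamma_{\mathbf k}:=\operatorname{card}\Lambda_{\mathbf k}$, $\omega^{(\mathbf k)}:=\frac1{\gamma_{\mathbf k}}\sum_{\alpha\in\Lambda_{\mathbf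 k}}f_\alpha$. $\mathbb H_s^2(f)$ is the closed linear span of the (mutually orthogonal) $\omega^{(\mathbf k)}$ in $\mathbb H^2(f)$, and $P_{\mathbb H_s^2(f)}$ the orthogonal projection onto it. (Here $J_c$ refers to the WOT-closed commutator ideal of the WOT-closed algebra generated by the $M_{Z_i}$ and $I$, and $\mathbb H_s^2(f)=\mathbb H^2(f)\ominus\overline{J_c(1)}$.) $\mathbb H_s^2(f)$ is identified with the Hilbert space $H^2(\mathbb B_f^<(\mathbb C))$ of holomorphic functions on $\mathbb B_f^<(\mathbb C)$ with reproducing kernel $\Lambda_f(\mu,\lambda)=\big(1-\sum_{i=1}^nf_i(\mu)\overline{f_i(\lambda)}\big)^{-1}$, by sending $\psi\in\mathbb H_s^2(f)$ to $\psi(\lambda):=\langle\psi,\Omega_\lambda\rangle$, where $\Omega_\lambda=\sum_{\alpha\in\mathbb F_n^+}[\overline{f(\lambda)}]_\alpha f_\alpha$; thus $\sum c_{\mathbf k}\omega^{(\mathbf k)}$ goes to $\lambda\mapsto\sum c_{\mathbf k}f(\lambda)^{\mathbf k}$. A multiplier of $H^2(\mathbb B_f^<(\mathbb C))$ is a function $\varphi$ on $\mathbb B_f^<(\mathbb C)$ with $\varphi\psi\in H^2(\mathbb B_f^<(\mathbb C))$ for all $\psi$ in the space, viewed as the operator $M_\varphi\psi=\varphi\psi$. The identification in (i) is the one induced by $\mathbb H_s^2(f)\cong H^2(\mathbb B_f^<(\mathbb C))$: the operators in $H^\infty(\mathcal V_{f,J_c})$ correspond exactly to the operators $M_\varphi$,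 $\varphi$ a multiplier. An algebra $\mathcal U\subset B(\mathcal H)$ is reflexive if $\mathcal U=\operatorname{Alg}\operatorname{Lat}\mathcal U$, i.e. $\mathcal U$ consists of all bounded operators leaving invariant every (closed) subspace that is invariant under all elements of $\mathcal U$. *)

theory Defs
  imports "HOL-Analysis.Analysis"
begin

class chilbert_space = real_inner + banach +
  fixes scaleC :: "complex \<Rightarrow> 'a \<Rightarrow> 'a"  (infixr \<open>*\<^sub>C\<close> 75)
    and cinner :: "'a \<Rightarrow> 'a \<Rightarrow> complex"
  assumes scaleC_add_right: "c *\<^sub>C (x + y) = c *\<^sub>C x + c *\<^sub>C y"
    and scaleC_add_left: "(c + d) *\<^sub>C x = c *\<^sub>C x + d *\<^sub>C x"
    and scaleC_scaleC: "c *\<^sub>C d *\<^sub>C x = (c * d) *\<^sub>C x"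
    and scaleC_of_real: "complex_of_real r *\<^sub>C x = r *\<^sub>R x"
    and cinner_add_left: "cinner (x + y) z = cinner x z + cinner y z"
    and cinner_scaleC_left: "cinner (c *\<^sub>C x) y = c * cinner x y"
    and cinner_commute: "cinner x y = cnj (cinner y x)"
    and inner_eq_Re_cinner: "inner x y = Re (cinner x y)"

instantiation complex :: chilbert_space
begin

definition scaleC_complex :: "complex \<Rightarrow> complex \<Rightarrow> complex"
  where "scaleC_complex c z = c * z"

definition cinner_complex :: "complex \<Rightarrow> complex \<Rightarrow> complex"
  where "cinner_complex z w = z * cnj w"

instance
  by standard
    (simp_all add: scaleC_complex_def cinner_complex_def algebra_simps scaleR_conv_of_real
      inner_complex_def)

end

typedef 'i ell2 = "{x :: 'i \<Rightarrow> complex. (\<lambda>i. (cmod (x i))\<^sup>2) summable_on UNIV}"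
  morphisms ell2_nth Abs_ell2
  by (rule exI[of _ "\<lambda>_. 0"]) simp

setup_lifting type_definition_ell2

lemma ell2_nth_summable: "(\<lambda>i. (cmod (ell2_nth x i))\<^sup>2) summable_on UNIV"
  using ell2_nth[of x] by simp

lemma ell2_add_aux:
  fixes x y :: "'i \<Rightarrow> complex"
  assumes "(\<lambda>i. (cmod (x i))\<^sup>2) summable_on UNIV" "(\<lambda>i. (cmod (y i))\<^sup>2) summable_on UNIV"
  shows "(\<lambda>i. (cmod (x i + y i))\<^sup>2) summable_on UNIV"
proof (rule summable_on_comparison_test)
  show "(\<lambda>i. 2 * (cmod (x i))\<^sup>2 + 2 * (cmod (y i))\<^sup>2) summable_on UNIV"
    by (intro summable_on_add summable_on_cmult_right assms)
  fix i
  have "(cmod (x i + y i))\<^sup>2 \<le> (cmod (x i) + cmod (y i))\<^sup>2"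
    by (intro power_mono norm_triangle_ineq) simp
  also have "\<dots> \<le> 2 * (cmod (x i))\<^sup>2 + 2 * (cmod (y i))\<^sup>2"
    using sum_squares_bound[of "cmod (x i)" "cmod (y i)"] by (simp add: power2_sum)
  finally show "(cmod (x i + y i))\<^sup>2 \<le> 2 * (cmod (x i))\<^sup>2 + 2 * (cmod (y i))\<^sup>2" .
qed simp

lemma ell2_prod_summable:
  "(\<lambda>i. ell2_nth x i * cnj (ell2_nth y i)) summable_on UNIV"
proof (rule abs_summable_summable, rule summable_on_comparison_test)
  show "(\<lambda>i. (cmod (ell2_nth x i))\<^sup>2 + (cmod (ell2_nth y i))\<^sup>2) summable_on UNIV"
    by (intro summable_on_add ell2_nth_summable)
  fix i
  show "norm (ell2_nth x i * cnj (ell2_nth y i))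
      \<le> (cmod (ell2_nth x i))\<^sup>2 + (cmod (ell2_nth y i))\<^sup>2"
    using sum_squares_bound[of "cmod (ell2_nth x i)" "cmod (ell2_nth y i)"]
      mult_nonneg_nonneg[OF norm_ge_zero[of "ell2_nth x i"] norm_ge_zero[of "ell2_nth y i"]]
    by (simp add: norm_mult del: mult_nonneg_nonneg)
qed simp

instantiation ell2 :: (type) real_vector
begin
lift_definition zero_ell2 :: "'a ell2" is "\<lambda>_. 0" by simp
lift_definition plus_ell2 :: "'a ell2 \<Rightarrow> 'a ell2 \<Rightarrow> 'a ell2" is "\<lambda>x y i. x i + y i"
  by (rule ell2_add_aux)
lift_definition uminus_ell2 :: "'a ell2 \<Rightarrow> 'a ell2" is "\<lambda>x i. - x i" by simp
lift_definition minus_ell2 :: "'a ell2 \<Rightarrow> 'a ell2 \<Rightarrow> 'a ell2" is "\<lambda>x y i. x i - y i"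
  using ell2_add_aux[of _ "\<lambda>i. - _ i"] by simp
lift_definition scaleR_ell2 :: "real \<Rightarrow> 'a ell2 \<Rightarrow> 'a ell2" is "\<lambda>r x i. r *\<^sub>R x i"
  by (simp add: power_mult_distrib summable_on_cmult_right)
instance
  by standard (transfer, simp add: algebra_simps)+
end

instantiation ell2 :: (type) real_inner
begin
definition inner_ell2 :: "'a ell2 \<Rightarrow> 'a ell2 \<Rightarrow> real"
  where "inner_ell2 x y = Re (\<Sum>\<^sub>\<infinity>i. ell2_nth x i * cnj (ell2_nth y i))"
definition norm_ell2 :: "'a ell2 \<Rightarrow> real" where "norm_ell2 x = sqrt (inner x x)"
definition sgn_ell2 :: "'a ell2 \<Rightarrow> 'a ell2" where "sgn_ell2 x = x /\<^sub>R norm x"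
definition dist_ell2 :: "'a ell2 \<Rightarrow> 'a ell2 \<Rightarrow> real" where "dist_ell2 x y = norm (x - y)"
definition uniformity_ell2 :: "('a ell2 \<times> 'a ell2) filter"
  where "uniformity_ell2 = (INF e\<in>{0<..}. principal {(x, y). dist x y < e})"
definition open_ell2 :: "'a ell2 set \<Rightarrow> bool"
  where "open_ell2 U \<longleftrightarrow> (\<forall>x\<in>U. eventually (\<lambda>(x', y). x' = x \<longrightarrow> y \<in> U) uniformity)"

lemma inner_ell2_self: "inner x x = (\<Sum>\<^sub>\<infinity>i. (cmod (ell2_nth x i))\<^sup>2)"
proof -
  have "(\<Sum>\<^sub>\<infinity>i. ell2_nth x i * cnj (ell2_nth x i))
      = (\<Sum>\<^sub>\<infinity>i. complex_of_real ((cmod (ell2_nth x i))\<^sup>2))"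
    by (simp only: complex_norm_square)
  also have "\<dots> = complex_of_real (\<Sum>\<^sub>\<infinity>i. (cmod (ell2_nth x i))\<^sup>2)"
    by (intro infsumI has_sum_of_real has_sum_infsum ell2_nth_summable)
  finally show ?thesis by (simp add: inner_ell2_def)
qed

instance
proof
  fix x y z :: "'a ell2" and r :: real
  show "inner x y = inner y x"
  proof -
    have "(\<Sum>\<^sub>\<infinity>i. ell2_nth x i * cnj (ell2_nth y i))
        = cnj (\<Sum>\<^sub>\<infinity>i. ell2_nth y i * cnj (ell2_nth x i))"
      by (subst infsum_cnj[symmetric]) (simp add: mult.commute)
    then show ?thesis by (simp add: inner_ell2_def)
  qed
  show "inner (x + y) z = inner x z + inner y z"
    by (simp add: inner_ell2_def plus_ell2.rep_eq ring_distribs infsum_add ell2_prod_summable)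
  show "inner (r *\<^sub>R x) y = r * inner x y"
    by (simp add: inner_ell2_def scaleR_ell2.rep_eq scaleR_conv_of_real mult.assoc
        infsum_cmult_right')
  show "0 \<le> inner x x" by (simp add: inner_ell2_self infsum_nonneg)
  show "inner x x = 0 \<longleftrightarrow> x = 0"
  proof
    assume "inner x x = 0"
    then have 0: "(\<Sum>\<^sub>\<infinity>i. (cmod (ell2_nth x i))\<^sup>2) = 0" by (simp add: inner_ell2_self)
    have "(cmod (ell2_nth x i))\<^sup>2 = 0" for i
      by (rule nonneg_infsum_le_0D[of "\<lambda>i. (cmod (ell2_nth x i))\<^sup>2" UNIV])
        (use 0 ell2_nth_summable in auto)
    then show "x = 0" by (simp add: ell2_nth_inject[symmetric] zero_ell2.rep_eq fun_eq_iff)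
  qed (simp add: inner_ell2_self zero_ell2.rep_eq)
qed (simp_all add: norm_ell2_def sgn_ell2_def dist_ell2_def uniformity_ell2_def open_ell2_def)
end

lemma norm_ell2_square: "(norm x)\<^sup>2 = (\<Sum>\<^sub>\<infinity>i. (cmod (ell2_nth x i))\<^sup>2)"
  by (simp add: power2_norm_eq_inner inner_ell2_self)

lemma sum_le_norm_ell2: "finite F \<Longrightarrow> (\<Sum>i\<in>F. (cmod (ell2_nth x i))\<^sup>2) \<le> (norm x)\<^sup>2"
  unfolding norm_ell2_square
  by (rule finite_sum_le_infsum[OF ell2_nth_summable]) auto

lemma cmod_ell2_nth_le: "cmod (ell2_nth x i) \<le> norm x"
  using sum_le_norm_ell2[of "{i}" x] by (simp add: abs_le_square_iff[symmetric])

instance ell2 :: (type) banach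
proof
  fix X :: "nat \<Rightarrow> 'a ell2"
  assume C: "Cauchy X"
  have "Cauchy (\<lambda>n. ell2_nth (X n) i)" for i
  proof (rule metric_CauchyI)
    fix e :: real assume "e > 0"
    with C obtain N where N: "\<And>m n. m \<ge> N \<Longrightarrow> n \<ge> N \<Longrightarrow> dist (X m) (X n) < e"
      by (meson metric_CauchyD)
    have "dist (ell2_nth (X m) i) (ell2_nth (X n) i) < e" if "m \<ge> N" "n \<ge> N" for m n
      using cmod_ell2_nth_le[of "X m - X n" i] N[OF that]
      by (simp add: dist_norm minus_ell2.rep_eq)
    then show "\<exists>M. \<forall>m\<ge>M. \<forall>n\<ge>M. dist (ell2_nth (X m) i) (ell2_nth (X n) i) < e" by blast
  qed
  then have "\<forall>i. \<exists>l. (\<lambda>n. ell2_nth (X n) i) \<longlonglongrightarrow> l"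
    by (simp add: Cauchy_convergent_iff convergent_def)
  then obtain x where x: "\<And>i. (\<lambda>n. ell2_nth (X n) i) \<longlonglongrightarrow> x i" by metis
  have fin: "(\<Sum>i\<in>F. (cmod (ell2_nth (X n) i - x i))\<^sup>2) \<le> e\<^sup>2"
    if "finite F" "n \<ge> N" and N: "\<And>m n. m \<ge> N \<Longrightarrow> n \<ge> N \<Longrightarrow> dist (X m) (X n) < e" for F n N e
  proof (rule tendsto_upperbound)
    show "(\<lambda>m. \<Sum>i\<in>F. (cmod (ell2_nth (X n) i - ell2_nth (X m) i))\<^sup>2)
        \<longlonglongrightarrow> (\<Sum>i\<in>F. (cmod (ell2_nth (X n) i - x i))\<^sup>2)"
      by (intro tendsto_intros x)
    show "\<forall>\<^sub>F m in sequentially. (\<Sum>i\<in>F. (cmod (ell2_nth (X n) i - ell2_nth (X m) i))\<^sup>2) \<le> e\<^sup>2"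
    proof (rule eventually_sequentiallyI)
      fix m assume "m \<ge> N"
      have "(\<Sum>i\<in>F. (cmod (ell2_nth (X n) i - ell2_nth (X m) i))\<^sup>2) \<le> (norm (X n - X m))\<^sup>2"
        using sum_le_norm_ell2[OF \<open>finite F\<close>, of "X n - X m"] by (simp add: minus_ell2.rep_eq)
      also have "\<dots> \<le> e\<^sup>2"
        using N[OF \<open>n \<ge> N\<close> \<open>m \<ge> N\<close>] by (intro power_mono) (auto simp: dist_norm)
      finally show "(\<Sum>i\<in>F. (cmod (ell2_nth (X n) i - ell2_nth (X m) i))\<^sup>2) \<le> e\<^sup>2" .
    qed
  qed simp
  have summ: "(\<lambda>i. (cmod (ell2_nth (X n) i - x i))\<^sup>2) summable_on UNIV"
    if "n \<ge> N" and N: "\<And>m n. m \<ge> N \<Longrightarrow> n \<ge> N \<Longrightarrow> dist (X m) (X n) < e" for n N e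
    by (rule nonneg_bdd_above_summable_on) (auto intro!: bdd_aboveI2 fin[OF _ that])
  obtain N0 where N0: "\<And>m n. m \<ge> N0 \<Longrightarrow> n \<ge> N0 \<Longrightarrow> dist (X m) (X n) < 1"
    using C by (meson metric_CauchyD zero_less_one)
  have "(\<lambda>i. (cmod (ell2_nth (X N0) i + - (ell2_nth (X N0) i - x i)))\<^sup>2) summable_on UNIV"
    by (rule ell2_add_aux[OF ell2_nth_summable])
      (use summ[OF order_refl N0] in \<open>simp add: norm_minus_commute\<close>)
  then have nth: "ell2_nth (Abs_ell2 x) = x" by (simp add: Abs_ell2_inverse)
  have "X \<longlonglongrightarrow> Abs_ell2 x"
  proof (rule metric_LIMSEQ_I)
    fix e :: real assume e: "e > 0"
    then obtain N where N: "\<And>m n. m \<ge> N \<Longrightarrow> n \<ge> N \<Longrightarrow> dist (X m) (X n) < e / 2"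
      using C by (meson metric_CauchyD half_gt_zero)
    have "dist (X n) (Abs_ell2 x) < e" if "n \<ge> N" for n
    proof -
      have "(norm (X n - Abs_ell2 x))\<^sup>2 \<le> (e / 2)\<^sup>2"
        unfolding norm_ell2_square minus_ell2.rep_eq nth
        by (rule infsum_le_finite_sums[OF summ[OF that N]]) (use fin[OF _ that N] in auto)
      then have "norm (X n - Abs_ell2 x) \<le> e / 2"
        using e by (simp add: power2_le_iff_abs_le)
      then show ?thesis using e by (simp add: dist_norm)
    qed
    then show "\<exists>N. \<forall>n\<ge>N. dist (X n) (Abs_ell2 x) < e" by blast
  qed
  then show "convergent X" by (auto simp: convergent_def)
qed

instantiation ell2 :: (type) chilbert_space
begin
lift_definition scaleC_ell2 :: "complex \<Rightarrow> 'a ell2 \<Rightarrow> 'a ell2" is "\<lambda>c x i. c * x i"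
  by (simp add: norm_mult power_mult_distrib summable_on_cmult_right)
definition cinner_ell2 :: "'a ell2 \<Rightarrow> 'a ell2 \<Rightarrow> complex"
  where "cinner_ell2 x y = (\<Sum>\<^sub>\<infinity>i. ell2_nth x i * cnj (ell2_nth y i))"
instance
proof
  fix x y z :: "'a ell2" and c d :: complex and r :: real
  show "c *\<^sub>C (x + y) = c *\<^sub>C x + c *\<^sub>C y" by transfer (simp add: algebra_simps)
  show "(c + d) *\<^sub>C x = c *\<^sub>C x + d *\<^sub>C x" by transfer (simp add: algebra_simps)
  show "c *\<^sub>C d *\<^sub>C x = (c * d) *\<^sub>C x" by transfer (simp add: algebra_simps)
  show "complex_of_real r *\<^sub>C x = r *\<^sub>R x" by transfer (simp add: scaleR_conv_of_real)
  show "cinner (x + y) z = cinner x z + cinner y z"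
    by (simp add: cinner_ell2_def plus_ell2.rep_eq ring_distribs infsum_add ell2_prod_summable)
  show "cinner (c *\<^sub>C x) y = c * cinner x y"
    by (simp add: cinner_ell2_def scaleC_ell2.rep_eq mult.assoc infsum_cmult_right')
  show "cinner x y = cnj (cinner y x)"
    by (simp add: cinner_ell2_def flip: infsum_cnj) (simp add: mult.commute)
  show "inner x y = Re (cinner x y)" by (simp add: inner_ell2_def cinner_ell2_def)
qed
end


definition csubspace :: "'h::chilbert_space set \<Rightarrow> bool"
  where "csubspace K \<longleftrightarrow>
    0 \<in> K \<and> (\<forall>x\<in>K. \<forall>y\<in>K. x + y \<in> K) \<and> (\<forall>c. \<forall>x\<in>K. c *\<^sub>C x \<in> K)"

definition closed_cspan :: "'h::chilbert_space set \<Rightarrow> 'h set"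
  where "closed_cspan S = (\<lambda>K. csubspace K \<and> closed K) hull S"

definition orth_proj :: "'h::chilbert_space set \<Rightarrow> 'h \<Rightarrow> 'h"
  where "orth_proj K x = (THE y. y \<in> K \<and> (\<forall>k\<in>K. cinner (x - y) k = 0))"

text \<open>
  \<open>bops K\<close> is the algebra of bounded (complex-linear) operators on the closed subspace \<open>K\<close>
  of the ambient Hilbert space.  To make equality of operators on \<open>K\<close> coincide with equality
  of functions, operators are extensional, i.e. undefined off \<open>K\<close>; for \<open>K = UNIV\<close> this is
  no condition.
\<close>

definition bops :: "'h::chilbert_space set \<Rightarrow> ('h \<Rightarrow> 'h) set"
  where "bops K = {T \<in> K \<rightarrow>\<^sub>E K.
    (\<forall>x\<in>K. \<forall>y\<in>K. T (x + y) = T x + T y) \<and> (\<forall>c. \<forall>x\<in>K. T (c *\<^sub>C x) = c *\<^sub>C T x) \<and>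
    (\<exists>B. \<forall>x\<in>K. norm (T x) \<le> B * norm x)}"

definition unital_subalgebra :: "'h::chilbert_space set \<Rightarrow> ('h \<Rightarrow> 'h) set \<Rightarrow> bool"
  where "unital_subalgebra K A \<longleftrightarrow> A \<subseteq> bops K \<and> (\<lambda>x\<in>K. x) \<in> A \<and>
    (\<forall>S\<in>A. \<forall>T\<in>A. (\<lambda>x\<in>K. S x + T x) \<in> A) \<and> (\<forall>c. \<forall>T\<in>A. (\<lambda>x\<in>K. c *\<^sub>C T x) \<in> A) \<and>
    (\<forall>S\<in>A. \<forall>T\<in>A. compose K S T \<in> A)"

definition wot :: "'h::chilbert_space set \<Rightarrow> ('h \<Rightarrow> 'h) topology"
  where "wot K = topology_generated_by
    {{T \<in> bops K. cinner (T x) y \<in> U} | x y U. x \<in> K \<and> y \<in> K \<and> open U}"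

definition wot_algebra :: "'h::chilbert_space set \<Rightarrow> ('h \<Rightarrow> 'h) set \<Rightarrow> ('h \<Rightarrow> 'h) set"
  where "wot_algebra K S = (\<lambda>A. unital_subalgebra K A \<and> closedin (wot K) A) hull S"

definition Lat :: "'h::chilbert_space set \<Rightarrow> ('h \<Rightarrow> 'h) set \<Rightarrow> 'h set set"
  where "Lat K A = {N. N \<subseteq> K \<and> csubspace N \<and> closed N \<and> (\<forall>T\<in>A. T ` N \<subseteq> N)}"

definition Alg :: "'h::chilbert_space set \<Rightarrow> 'h set set \<Rightarrow> ('h \<Rightarrow> 'h) set"
  where "Alg K \<N> = {T \<in> bops K. \<forall>N\<in>\<N>. T ` N \<subseteq> N}"

definition reflexive_algebra :: "'h::chilbert_space set \<Rightarrow> ('h \<Rightarrow> 'h) set \<Rightarrow> bool"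
  where "reflexive_algebra K A \<longleftrightarrow> A = Alg K (Lat K A)"

text \<open>
  The free semigroup on the generators indexed by the finite type \<open>'n\<close> is \<open>'n list\<close> with
  concatenation; a formal power series in noncommuting indeterminates is its family of
  coefficients.
\<close>

type_synonym 'n ncfps = "'n list \<Rightarrow> complex"

definition nc_one :: "'n ncfps"
  where "nc_one w = (if w = [] then 1 else 0)"

definition nc_var :: "'n \<Rightarrow> 'n ncfps"
  where "nc_var i w = (if w = [i] then 1 else 0)"

definition nc_mult :: "'n ncfps \<Rightarrow> 'n ncfps \<Rightarrow> 'n ncfps"
  where "nc_mult p q w = (\<Sum>k\<le>length w. p (take k w) * q (drop k w))"

primrec nc_word :: "('n \<Rightarrow> 'n ncfps) \<Rightarrow> 'n list \<Rightarrow> 'n ncfps"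
  where
    "nc_word f [] = nc_one"
  | "nc_word f (i # \<alpha>) = nc_mult (f i) (nc_word f \<alpha>)"

definition nc_polynomial :: "'n ncfps \<Rightarrow> bool"
  where "nc_polynomial p \<longleftrightarrow> finite {w. p w \<noteq> 0}"

text \<open>
  \<open>nc_comp c f\<close> is the formal series \<open>\<Sum>\<^sub>\<alpha> c\<^sub>\<alpha> f\<^sub>\<alpha>\<close>.  It is only used when \<open>c\<close> is a polynomial or
  \<open>f(0) = 0\<close>; then each coefficient is a finite sum.
\<close>

definition nc_comp :: "'n ncfps \<Rightarrow> ('n \<Rightarrow> 'n ncfps) \<Rightarrow> 'n ncfps"
  where "nc_comp c f w =
    (\<Sum>\<alpha> | c \<alpha> * nc_word f \<alpha> w \<noteq> 0. c \<alpha> * nc_word f \<alpha> w)"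

definition nc_radius :: "'n::finite ncfps \<Rightarrow> ereal"
  where "nc_radius a =
    inverse (limsup (\<lambda>k. ereal (root (2 * k) (\<Sum>w | length w = k. (cmod (a w))\<^sup>2))))"

text \<open>
  Tuples of operators on \<open>'h\<close> and evaluation of series at them.  The norm of a tuple is that of
  the row operator \<open>'h\<^sup>n \<rightarrow> 'h\<close>; \<open>'h ^ 'n\<close> carries the Euclidean (direct sum) norm.
\<close>

type_synonym ('n, 'h) optuple = "'n \<Rightarrow> 'h \<Rightarrow> 'h"

definition optuples :: "('n, 'h::chilbert_space) optuple set"
  where "optuples = {X. \<forall>i. X i \<in> bops UNIV}"

definition row_norm :: "('n::finite, 'h::chilbert_space) optuple \<Rightarrow> real"
  where "row_norm X = onorm (\<lambda>h :: 'h ^ 'n. \<Sum>i\<in>UNIV. X i (h $ i))"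

definition op_ball :: "real \<Rightarrow> ('n::finite, 'h::chilbert_space) optuple set"
  where "op_ball r = {X \<in> optuples. row_norm X < r}"

primrec word_op :: "('n, 'h) optuple \<Rightarrow> 'n list \<Rightarrow> 'h \<Rightarrow> 'h"
  where
    "word_op X [] = id"
  | "word_op X (i # \<alpha>) = X i \<circ> word_op X \<alpha>"

definition partial_sum :: "'n ncfps \<Rightarrow> ('n::finite, 'h::chilbert_space) optuple \<Rightarrow> nat \<Rightarrow> 'h \<Rightarrow> 'h"
  where "partial_sum p X N h = (\<Sum>k<N. \<Sum>\<alpha> | length \<alpha> = k. p \<alpha> *\<^sub>C word_op X \<alpha> h)"

definition norm_sums :: "'n ncfps \<Rightarrow> ('n::finite, 'h::chilbert_space) optuple \<Rightarrow> ('h \<Rightarrow> 'h) \<Rightarrow> bool"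
  where "norm_sums p X Y \<longleftrightarrow> Y \<in> bops UNIV \<and>
    (\<lambda>N. onorm (\<lambda>h. partial_sum p X N h - Y h)) \<longlonglongrightarrow> 0"

definition sot_sums :: "'n ncfps \<Rightarrow> ('n::finite, 'h::chilbert_space) optuple \<Rightarrow> ('h \<Rightarrow> 'h) \<Rightarrow> bool"
  where "sot_sums p X Y \<longleftrightarrow> Y \<in> bops UNIV \<and> (\<forall>h. (\<lambda>N. partial_sum p X N h) \<longlonglongrightarrow> Y h)"

definition nc_eval :: "'n ncfps \<Rightarrow> ('n::finite, 'h::chilbert_space) optuple \<Rightarrow> 'h \<Rightarrow> 'h"
  where "nc_eval p X = (THE Y. norm_sums p X Y)"

text \<open>
  \<open>sot_value f X Y\<close>: \<open>X\<close> lies in the SOT convergence set of \<open>f\<close>, with \<open>f(X) = Y\<close>;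
  \<open>rad_value f X Y\<close>: \<open>X\<close> lies in the radial convergence set of \<open>f\<close>, with \<open>f(X) = Y\<close>.
  By Abel's theorem both values agree if \<open>X\<close> lies in both sets.
\<close>

definition sot_value ::
    "('n::finite \<Rightarrow> 'n ncfps) \<Rightarrow> ('n, 'h::chilbert_space) optuple \<Rightarrow> ('n, 'h) optuple \<Rightarrow> bool"
  where "sot_value f X Y \<longleftrightarrow> X \<in> optuples \<and> (\<forall>j. sot_sums (f j) X (Y j))"

definition rad_value ::
    "('n::finite \<Rightarrow> 'n ncfps) \<Rightarrow> ('n, 'h::chilbert_space) optuple \<Rightarrow> ('n, 'h) optuple \<Rightarrow> bool"
  where "rad_value f X Y \<longleftrightarrow> X \<in> optuples \<and> Y \<in> optuples \<and>
    (\<exists>\<delta>\<in>{0<..<1}. \<forall>r\<in>{\<delta><..<1}. \<forall>j. \<exists>W. norm_sums (f j) (\<lambda>i h. r *\<^sub>R X i h) W) \<and>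
    (\<forall>j h. ((\<lambda>r. nc_eval (f j) (\<lambda>i h. r *\<^sub>R X i h) h) \<longlongrightarrow> Y j h) (at_left 1))"

definition conv_sot :: "('n::finite \<Rightarrow> 'n ncfps) \<Rightarrow> ('n, 'h::chilbert_space) optuple set"
  where "conv_sot f = {X. \<exists>Y. sot_value f X Y}"

definition conv_rad :: "('n::finite \<Rightarrow> 'n ncfps) \<Rightarrow> ('n, 'h::chilbert_space) optuple set"
  where "conv_rad f = {X. \<exists>Y. rad_value f X Y}"

definition conv_value ::
    "('n::finite \<Rightarrow> 'n ncfps) \<Rightarrow> ('n, 'h::chilbert_space) optuple \<Rightarrow> ('n, 'h) optuple \<Rightarrow> bool"
  where "conv_value f X Y \<longleftrightarrow> sot_value f X Y \<or> rad_value f X Y"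

definition f_at ::
    "('n::finite \<Rightarrow> 'n ncfps) \<Rightarrow> ('n, 'h::chilbert_space) optuple \<Rightarrow> ('n, 'h) optuple"
  where "f_at f X = (if X \<in> conv_sot f then THE Y. sot_value f X Y else THE Y. rad_value f X Y)"

text \<open>
  Since \<open>{f\<^sub>\<alpha>}\<close> is an orthonormal basis of \<open>\<H>\<^sup>2(f)\<close>, this space is represented by
  \<open>'n list ell2\<close>: the vector \<open>c\<close> stands for \<open>\<Sum>\<^sub>\<alpha> c\<^sub>\<alpha> f\<^sub>\<alpha>\<close>, and the actual element (a formal power
  series, a function on an operator ball) is recovered by the map \<open>\<rho>\<close> below.
  \<open>Z i\<close> is the vector that represents the coordinate \<open>Z\<^sub>i\<close>, so that \<open>ell2_nth (Z i) \<alpha>\<close> is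
  \<open>a\<^sup>(\<^sup>i\<^sup>)\<^sub>\<alpha>\<close>, and \<open>M i\<close> is the operator \<open>M\<^bsub>Z\<^sub>i\<^esub>\<close>.  The data \<open>Z\<close>, \<open>M\<close> are determined by \<open>f\<close>, and \<open>f\<close> has
  the model property iff they exist.

  In \<open>model_conditions\<close>, \<open>mul\<close> is the multiplication of actual elements, \<open>\<zeta> i\<close> and \<open>\<phi> j\<close> are
  \<open>Z\<^sub>i\<close> and \<open>f\<^sub>j\<close> as actual elements, and \<open>Y j\<close> is \<open>f\<^sub>j(M\<^sub>Z)\<close>, required to be left
  multiplication by \<open>f\<^sub>j\<close>.
\<close>

definition model_conditions ::
    "('n::finite list ell2 \<Rightarrow> 'b) \<Rightarrow> ('b \<Rightarrow> 'b \<Rightarrow> 'b) \<Rightarrow> ('n \<Rightarrow> 'b) \<Rightarrow> ('n \<Rightarrow> 'b) \<Rightarrow>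
     ('n \<Rightarrow> 'n ncfps) \<Rightarrow> ('n \<Rightarrow> 'n list ell2) \<Rightarrow> ('n, 'n list ell2) optuple \<Rightarrow> bool"
  where "model_conditions \<rho> mul \<zeta> \<phi> f Z M \<longleftrightarrow>
    (\<forall>i. \<rho> (Z i) = \<zeta> i) \<and>
    (\<forall>i. M i \<in> bops UNIV \<and> (\<forall>c. \<rho> (M i c) = mul (\<zeta> i) (\<rho> c))) \<and>
    (\<exists>Y. conv_value f M Y \<and> (\<forall>j c. \<rho> (Y j c) = mul (\<phi> j) (\<rho> c)))"

text \<open>
  Polynomial case.  As \<open>\<H>\<^sup>2(f)\<close> is a completion of the polynomials, only the finitely supported
  vectors stand for actual elements, and \<open>M i\<close> is the continuous extension of left
  multiplication by \<open>Z\<^sub>i\<close> on polynomials.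
\<close>

definition model_A ::
    "('n::finite \<Rightarrow> 'n ncfps) \<Rightarrow> ('n \<Rightarrow> 'n list ell2) \<Rightarrow> ('n, 'n list ell2) optuple \<Rightarrow> bool"
  where "model_A f Z M \<longleftrightarrow>
    (\<forall>j. nc_polynomial (f j)) \<and>
    (\<exists>g. (\<forall>j. nc_polynomial (g j)) \<and>
      (\<forall>i. nc_comp (f i) g = nc_var i \<and> nc_comp (g i) f = nc_var i)) \<and>
    (\<forall>i. nc_polynomial (ell2_nth (Z i)) \<and> nc_comp (ell2_nth (Z i)) f = nc_var i) \<and>
    (\<forall>i. M i \<in> bops UNIV \<and>
      (\<forall>c. nc_polynomial (ell2_nth c) \<longrightarrow> nc_polynomial (ell2_nth (M i c)) \<and>
        nc_comp (ell2_nth (M i c)) f = nc_mult (nc_var i) (nc_comp (ell2_nth c) f)))"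

definition model_S ::
    "('n::finite \<Rightarrow> 'n ncfps) \<Rightarrow> ('n \<Rightarrow> 'n list ell2) \<Rightarrow> ('n, 'n list ell2) optuple \<Rightarrow> bool"
  where "model_S f Z M \<longleftrightarrow>
    (\<forall>j. f j [] = 0 \<and> 0 < nc_radius (f j)) \<and>
    det (\<chi> i j. f i [j]) \<noteq> 0 \<and>
    model_conditions (\<lambda>c. nc_comp (ell2_nth c) f) nc_mult nc_var f f Z M"

text \<open>
  Free holomorphic case; the separable infinite-dimensional Hilbert space is \<open>nat ell2\<close>.
\<close>

definition nc_fun :: "real \<Rightarrow> (('n::finite, nat ell2) optuple \<Rightarrow> nat ell2 \<Rightarrow> nat ell2) \<Rightarrow>
    ('n, nat ell2) optuple \<Rightarrow> nat ell2 \<Rightarrow> nat ell2"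
  where "nc_fun \<gamma> F = restrict F (op_ball \<gamma>)"

definition model_F ::
    "('n::finite \<Rightarrow> 'n ncfps) \<Rightarrow> ('n \<Rightarrow> 'n list ell2) \<Rightarrow> ('n, 'n list ell2) optuple \<Rightarrow> bool"
  where "model_F f Z M \<longleftrightarrow> (\<exists>\<gamma>>0.
    (\<forall>j. ereal \<gamma> \<le> nc_radius (f j)) \<and>
    (\<forall>X\<in>op_ball \<gamma>. (\<lambda>j. nc_eval (f j) X) \<in> (op_ball 1 :: ('n, nat ell2) optuple set)) \<and>
    (\<forall>G. 1 \<le> nc_radius G \<and> G \<noteq> (\<lambda>_. 0) \<longrightarrow>
      (\<exists>X \<in> (op_ball \<gamma> :: ('n, nat ell2) optuple set).
        nc_eval G (\<lambda>j. nc_eval (f j) X) \<noteq> (\<lambda>_. 0))) \<and>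
    model_conditions
      (\<lambda>c. nc_fun \<gamma> (\<lambda>X. nc_eval (ell2_nth c) (\<lambda>j. nc_eval (f j) X)))
      (\<lambda>F G. nc_fun \<gamma> (\<lambda>X. F X \<circ> G X))
      (\<lambda>i. nc_fun \<gamma> (\<lambda>X. X i))
      (\<lambda>j. nc_fun \<gamma> (\<lambda>X. nc_eval (f j) X))
      f Z M)"

definition model_property ::
    "('n::finite \<Rightarrow> 'n ncfps) \<Rightarrow> ('n \<Rightarrow> 'n list ell2) \<Rightarrow> ('n, 'n list ell2) optuple \<Rightarrow> bool"
  where "model_property f Z M \<longleftrightarrow> model_A f Z M \<or> model_S f Z M \<or> model_F f Z M"

text \<open>
  The condition \<open>g(f(X)) = X\<close> says that \<open>X\<close> is the value at \<open>f(X)\<close> of the tuple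
  \<open>g\<close> of inverse series, summed in the SOT or radially; note
  \<open>[r f(X)]\<^sub>\<alpha> = r\<^bsup>|\<alpha>|\<^esup> [f(X)]\<^sub>\<alpha>\<close>.
\<close>

definition nc_domain ::
    "('n::finite \<Rightarrow> 'n ncfps) \<Rightarrow> ('n \<Rightarrow> 'n list ell2) \<Rightarrow> ('n, 'h::chilbert_space) optuple set"
  where "nc_domain f Z = {X \<in> conv_sot f \<union> conv_rad f.
    conv_value (\<lambda>i. ell2_nth (Z i)) (f_at f X) X \<and> row_norm (f_at f X) < 1}"

definition scalar_ops :: "('n \<Rightarrow> complex) \<Rightarrow> ('n, complex) optuple"
  where "scalar_ops l = (\<lambda>i z. l i * z)"

definition scalar_domain ::
    "('n::finite \<Rightarrow> 'n ncfps) \<Rightarrow> ('n \<Rightarrow> 'n list ell2) \<Rightarrow> ('n \<Rightarrow> complex) set"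
  where "scalar_domain f Z = {l. scalar_ops l \<in> nc_domain f Z}"

definition f_scalar :: "('n::finite \<Rightarrow> 'n ncfps) \<Rightarrow> ('n \<Rightarrow> complex) \<Rightarrow> 'n \<Rightarrow> complex"
  where "f_scalar f l j = f_at f (scalar_ops l) j 1"

definition ell2_unit :: "'i \<Rightarrow> 'i ell2"
  where "ell2_unit i = Abs_ell2 (\<lambda>j. if j = i then 1 else 0)"

definition comm_words :: "('n::finite \<Rightarrow> nat) \<Rightarrow> 'n list set"
  where "comm_words k =
    {\<alpha>. \<forall>l :: 'n \<Rightarrow> complex. prod_list (map l \<alpha>) = (\<Prod>i\<in>UNIV. l i ^ k i)}"

definition omega :: "('n::finite \<Rightarrow> nat) \<Rightarrow> 'n list ell2"
  where "omega k = (1 / of_nat (card (comm_words k))) *\<^sub>C (\<Sum>\<alpha>\<in>comm_words k. ell2_unit \<alpha>)"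

definition symm_space :: "'n::finite list ell2 set"
  where "symm_space = closed_cspan (range omega)"

definition compression :: "'h::chilbert_space set \<Rightarrow> ('h \<Rightarrow> 'h) \<Rightarrow> 'h \<Rightarrow> 'h"
  where "compression K T = (\<lambda>x\<in>K. orth_proj K (T x))"

definition Hinf_symm :: "('n::finite, 'n list ell2) optuple \<Rightarrow> ('n list ell2 \<Rightarrow> 'n list ell2) set"
  where "Hinf_symm M = wot_algebra symm_space (range (\<lambda>i. compression symm_space (M i)))"

definition Omega :: "('n::finite \<Rightarrow> 'n ncfps) \<Rightarrow> ('n \<Rightarrow> complex) \<Rightarrow> 'n list ell2"
  where "Omega f l = Abs_ell2 (\<lambda>\<alpha>. prod_list (map (\<lambda>i. cnj (f_scalar f l i)) \<alpha>))"

definition hardy_kernel :: "('n::finite \<Rightarrow> 'n ncfps) \<Rightarrow> ('n \<Rightarrow> complex) \<Rightarrow> ('n \<Rightarrow> complex) \<Rightarrow> complex"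
  where "hardy_kernel f m l = inverse (1 - (\<Sum>i\<in>UNIV. f_scalar f m i * cnj (f_scalar f l i)))"

text \<open>
  \<open>to_fun\<close> identifies the symmetric space with the function space \<open>H\<^sup>2\<close> of the scalar domain
  (\<open>hardy\<close>, whose inner product is the transported one).  Functions on the domain are extensional.
\<close>

definition to_fun :: "('n::finite \<Rightarrow> 'n ncfps) \<Rightarrow> ('n \<Rightarrow> 'n list ell2) \<Rightarrow>
    'n list ell2 \<Rightarrow> ('n \<Rightarrow> complex) \<Rightarrow> complex"
  where "to_fun f Z \<psi> = (\<lambda>l\<in>scalar_domain f Z. cinner \<psi> (Omega f l))"

definition hardy :: "('n::finite \<Rightarrow> 'n ncfps) \<Rightarrow> ('n \<Rightarrow> 'n list ell2) \<Rightarrow> (('n \<Rightarrow> complex) \<Rightarrow> complex) set"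
  where "hardy f Z = to_fun f Z ` symm_space"

definition multipliers ::
    "('n::finite \<Rightarrow> 'n ncfps) \<Rightarrow> ('n \<Rightarrow> 'n list ell2) \<Rightarrow> (('n \<Rightarrow> complex) \<Rightarrow> complex) set"
  where "multipliers f Z = {\<phi> \<in> extensional (scalar_domain f Z).
    \<forall>h\<in>hardy f Z. (\<lambda>l\<in>scalar_domain f Z. \<phi> l * h l) \<in> hardy f Z}"


text \<open>
  The rest of the theory checks that \<open>hardy f Z\<close> has reproducing kernel \<open>hardy_kernel f\<close>: the
  vectors \<open>Omega f l\<close> lie in the symmetric space, \<open>to_fun\<close> maps them to the kernel functions, and
  evaluation at \<open>l\<close> is by definition of \<open>to_fun\<close> the inner product with \<open>Omega f l\<close>.
\<close>

lemma finite_words_length [simp]: "finite {w :: 'n::finite list. length w = k}"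
  using finite_lists_length_eq[of "UNIV :: 'n set" k] by simp

lemma finite_words_length_less [simp]: "finite {w :: 'n::finite list. length w < N}"
proof -
  have "{w :: 'n list. length w < N} = (\<Union>k<N. {w. length w = k})" by auto
  then show ?thesis by simp
qed

lemma sum_words_length_less:
  fixes F :: "'n::finite list \<Rightarrow> 'b::comm_monoid_add"
  shows "(\<Sum>w | length w < N. F w) = (\<Sum>k<N. \<Sum>w | length w = k. F w)"
proof -
  have eq: "{w :: 'n list. length w < N} = (\<Union>k\<in>{..<N}. {w. length w = k})" by auto
  show ?thesis unfolding eq by (rule sum.UNION_disjoint) auto
qed

lemma sum_words_length_prod:
  fixes x :: "'n::finite \<Rightarrow> 'b::comm_semiring_1"
  shows "(\<Sum>w | length w = k. prod_list (map x w)) = (\<Sum>i\<in>UNIV. x i) ^ k"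
proof (induction k)
  case (Suc k)
  have "{w :: 'n list. length w = Suc k} = (\<lambda>(i, w). i # w) ` (UNIV \<times> {w. length w = k})"
    by (auto simp: length_Suc_conv image_iff)
  moreover have "inj_on (\<lambda>(i, w). i # w) (UNIV \<times> {w :: 'n list. length w = k})"
    by (auto simp: inj_on_def)
  ultimately have "(\<Sum>w | length w = Suc k. prod_list (map x w))
      = (\<Sum>(i, w)\<in>UNIV \<times> {w. length w = k}. x i * prod_list (map x w))"
    by (simp add: sum.reindex case_prod_unfold)
  also have "\<dots> = (\<Sum>i\<in>UNIV. x i) * (\<Sum>w | length w = k. prod_list (map x w))"
    by (simp add: sum_product sum.cartesian_product)
  finally show ?case by (simp add: Suc.IH)
qed simp

lemma prod_list_map_mult:
  fixes x y :: "'n \<Rightarrow> 'b::comm_monoid_mult"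
  shows "prod_list (map x w) * prod_list (map y w) = prod_list (map (\<lambda>i. x i * y i) w)"
  by (induction w) (simp_all add: mult_ac)

lemma cmod_prod_list_map: "cmod (prod_list (map x w)) = prod_list (map (\<lambda>i. cmod (x i)) w)"
  by (induction w) (simp_all add: norm_mult)

lemma cnj_prod_list_map: "cnj (prod_list (map x w)) = prod_list (map (\<lambda>i. cnj (x i)) w)"
  by (induction w) simp_all

lemma words_less_filterlim:
  "filterlim (\<lambda>N. {w :: 'n::finite list. length w < N}) (finite_subsets_at_top UNIV) sequentially"
  unfolding filterlim_finite_subsets_at_top
proof safe
  fix X :: "'n list set" assume "finite X"
  then have "finite (length ` X)" by simp
  then obtain m where "\<forall>k\<in>length ` X. k \<le> m" by (meson finite_nat_set_iff_bounded_le)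
  then have "X \<subseteq> {w. length w < N}" if "N > m" for N using that by fastforce
  then show "\<forall>\<^sub>F N in sequentially.
      finite {w :: 'n list. length w < N} \<and> X \<subseteq> {w. length w < N} \<and> {w. length w < N} \<subseteq> UNIV"
    by (auto simp: eventually_at_top_dense)
qed

lemma infsum_words_limit:
  fixes F :: "'n::finite list \<Rightarrow> 'b::{topological_comm_monoid_add, t2_space}"
  assumes "F summable_on UNIV"
  shows "(\<lambda>N. \<Sum>w | length w < N. F w) \<longlonglongrightarrow> infsum F UNIV"
  using filterlim_compose[OF has_sum_infsum[OF assms, unfolded has_sum_def] words_less_filterlim]
  by simp

lemma words_product_summable:
  fixes x :: "'n::finite \<Rightarrow> complex"
  assumes "(\<Sum>i\<in>UNIV. (cmod (x i))\<^sup>2) < 1"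
  shows "(\<lambda>w. (cmod (prod_list (map x w)))\<^sup>2) summable_on UNIV"
proof (rule nonneg_bdd_above_summable_on)
  let ?s = "\<Sum>i\<in>UNIV. (cmod (x i))\<^sup>2"
  have s0: "0 \<le> ?s" by (simp add: sum_nonneg)
  have eq: "(cmod (prod_list (map x w)))\<^sup>2 = prod_list (map (\<lambda>i. (cmod (x i))\<^sup>2) w)" for w
    by (simp add: cmod_prod_list_map power2_eq_square prod_list_map_mult)
  show "bdd_above (sum (\<lambda>w. (cmod (prod_list (map x w)))\<^sup>2) ` {F. F \<subseteq> UNIV \<and> finite F})"
  proof (rule bdd_aboveI2)
    fix F :: "'n list set" assume "F \<in> {F. F \<subseteq> UNIV \<and> finite F}"
    then have "finite (length ` F)" by simp
    then obtain m where m: "\<forall>k\<in>length ` F. k \<le> m" by (meson finite_nat_set_iff_bounded_le)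
    have "(\<Sum>w\<in>F. (cmod (prod_list (map x w)))\<^sup>2)
        \<le> (\<Sum>w | length w < Suc m. (cmod (prod_list (map x w)))\<^sup>2)"
      by (rule sum_mono2) (use m in auto)
    also have "\<dots> = (\<Sum>k<Suc m. ?s ^ k)"
      by (simp only: sum_words_length_less eq sum_words_length_prod)
    also have "\<dots> \<le> (\<Sum>k. ?s ^ k)"
      by (rule sum_le_suminf) (use s0 assms in auto)
    finally show "(\<Sum>w\<in>F. (cmod (prod_list (map x w)))\<^sup>2) \<le> (\<Sum>k. ?s ^ k)" .
  qed
qed simp

lemma sot_value_unique: "sot_value f X Y \<Longrightarrow> sot_value f X Y' \<Longrightarrow> Y = Y'"
  unfolding sot_value_def sot_sums_def by (intro ext) (meson LIMSEQ_unique)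

lemma rad_value_unique: "rad_value f X Y \<Longrightarrow> rad_value f X Y' \<Longrightarrow> Y = Y'"
  unfolding rad_value_def
  by (intro ext) (meson tendsto_unique trivial_limit_at_left_real)

lemma f_at_optuples:
  assumes "X \<in> conv_sot f \<union> conv_rad f"
  shows "f_at f X \<in> optuples"
proof (cases "X \<in> conv_sot f")
  case True
  then obtain Y where Y: "sot_value f X Y" by (auto simp: conv_sot_def)
  then have "f_at f X = Y"
    using True by (auto simp: f_at_def intro: the_equality sot_value_unique)
  then show ?thesis using Y by (auto simp: sot_value_def sot_sums_def optuples_def)
next
  case False
  then obtain Y where Y: "rad_value f X Y" using assms by (auto simp: conv_rad_def)
  then have "f_at f X = Y"
    using False by (auto simp: f_at_def intro: the_equality rad_value_unique)
  then show ?thesis using Y by (auto simp: rad_value_def)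
qed

lemma f_scalar_norm:
  assumes "l \<in> scalar_domain f Z"
  shows "(\<Sum>i\<in>UNIV. (cmod (f_scalar f l i))\<^sup>2) < 1"
proof -
  define Y where "Y = f_at f (scalar_ops l)"
  define y where "y = (\<chi> i. cnj (f_scalar f l i))"
  have "Y \<in> optuples" and less: "row_norm Y < 1"
    using assms f_at_optuples[of "scalar_ops l" f]
    by (auto simp: Y_def scalar_domain_def nc_domain_def)
  have Y1: "Y i (z * 1) = z * Y i 1" for i z
  proof -
    have "Y i \<in> bops UNIV" using \<open>Y \<in> optuples\<close> by (simp add: optuples_def)
    then have "Y i (z *\<^sub>C 1) = z *\<^sub>C Y i 1" by (simp add: bops_def)
    then show ?thesis by (simp add: scaleC_complex_def)
  qed
  have Yi: "Y i z = f_scalar f l i * z" for i z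
    using Y1[of i z] unfolding mult_1_right Y_def f_scalar_def by (simp only: mult.commute)
  let ?T = "\<lambda>h :: complex ^ 'a. \<Sum>i\<in>UNIV. Y i (h $ i)"
  have bl: "bounded_linear ?T"
    unfolding Yi
    by (intro bounded_linear_sum bounded_linear_compose[OF bounded_linear_mult_right]
        bounded_linear_vec_nth)
  have sq: "(norm y)\<^sup>2 = (\<Sum>i\<in>UNIV. (cmod (f_scalar f l i))\<^sup>2)"
    by (simp add: norm_vec_def L2_set_def y_def sum_nonneg)
  have "?T y = complex_of_real ((norm y)\<^sup>2)"
    unfolding sq Yi by (simp add: y_def complex_norm_square flip: of_real_power)
  then have "(norm y)\<^sup>2 = norm (?T y)" by (simp add: norm_power)
  also have "\<dots> \<le> row_norm Y * norm y"
    unfolding row_norm_def by (rule onorm[OF bl])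
  finally have le: "norm y * norm y \<le> row_norm Y * norm y" by (simp add: power2_eq_square)
  have "norm y < 1"
  proof (cases "norm y = 0")
    case False
    then show ?thesis using le less by simp
  qed simp
  then show ?thesis using power_strict_mono[of "norm y" 1 2] by (simp add: sq[symmetric])
qed

lemma ell2_nth_Omega:
  assumes "l \<in> scalar_domain f Z"
  shows "ell2_nth (Omega f l) = (\<lambda>\<alpha>. prod_list (map (\<lambda>i. cnj (f_scalar f l i)) \<alpha>))"
  unfolding Omega_def
  by (rule Abs_ell2_inverse) (simp add: words_product_summable f_scalar_norm[OF assms])

lemma cinner_Omega:
  assumes "l \<in> scalar_domain f Z" "m \<in> scalar_domain f Z"
  shows "cinner (Omega f l) (Omega f m) = hardy_kernel f m l"
proof -
  let ?t = "\<Sum>i\<in>UNIV. f_scalar f m i * cnj (f_scalar f l i)"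
  let ?F = "\<lambda>\<alpha>. prod_list (map (\<lambda>i. f_scalar f m i * cnj (f_scalar f l i)) \<alpha>)"
  have eq: "ell2_nth (Omega f l) \<alpha> * cnj (ell2_nth (Omega f m) \<alpha>) = ?F \<alpha>" for \<alpha>
    unfolding ell2_nth_Omega[OF assms(1)] ell2_nth_Omega[OF assms(2)] cnj_prod_list_map
      prod_list_map_mult by (simp add: mult.commute)
  have "?F summable_on UNIV"
    using ell2_prod_summable[of "Omega f l" "Omega f m"] by (simp only: eq)
  from infsum_words_limit[OF this]
  have 1: "(\<lambda>N. \<Sum>k<N. ?t ^ k) \<longlonglongrightarrow> cinner (Omega f l) (Omega f m)"
    by (simp only: sum_words_length_less sum_words_length_prod cinner_ell2_def eq)
  have "cmod ?t \<le> (\<Sum>i\<in>UNIV. cmod (f_scalar f m i) * cmod (f_scalar f l i))"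
    by (rule order_trans[OF norm_sum]) (simp add: norm_mult)
  also have "\<dots> \<le> (\<Sum>i\<in>UNIV. ((cmod (f_scalar f m i))\<^sup>2 + (cmod (f_scalar f l i))\<^sup>2) / 2)"
  proof (rule sum_mono)
    fix i
    show "cmod (f_scalar f m i) * cmod (f_scalar f l i)
        \<le> ((cmod (f_scalar f m i))\<^sup>2 + (cmod (f_scalar f l i))\<^sup>2) / 2"
      using sum_squares_bound[of "cmod (f_scalar f m i)" "cmod (f_scalar f l i)"] by simp
  qed
  also have "\<dots> < 1"
    using f_scalar_norm[OF assms(1)] f_scalar_norm[OF assms(2)]
    by (simp add: sum_divide_distrib[symmetric] sum.distrib)
  finally have "(\<lambda>k. ?t ^ k) sums (1 / (1 - ?t))" by (rule geometric_sums)
  then have "(\<lambda>N. \<Sum>k<N. ?t ^ k) \<longlonglongrightarrow> 1 / (1 - ?t)" by (simp only: sums_def)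
  from LIMSEQ_unique[OF 1 this] show ?thesis
    by (simp only: hardy_kernel_def inverse_eq_divide)
qed

lemma ell2_nth_unit: "ell2_nth (ell2_unit i) = (\<lambda>j. if j = i then 1 else 0)"
  unfolding ell2_unit_def
proof (rule Abs_ell2_inverse)
  have "(\<lambda>j. (cmod (if j = i then 1 else 0))\<^sup>2) summable_on UNIV \<longleftrightarrow>
      (\<lambda>j. (cmod (if j = i then 1 else 0))\<^sup>2) summable_on {i}"
    by (rule summable_on_cong_neutral) auto
  then show "(\<lambda>j. if j = i then 1 else 0) \<in> {x. (\<lambda>i. (cmod (x i))\<^sup>2) summable_on UNIV}"
    by simp
qed

lemma ell2_nth_sum: "ell2_nth (sum g A) i = (\<Sum>a\<in>A. ell2_nth (g a) i)"
  by (induction A rule: infinite_finite_induct) (simp_all add: zero_ell2.rep_eq plus_ell2.rep_eq)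

lemma prod_list_map_count:
  fixes l :: "'n::finite \<Rightarrow> 'b::comm_monoid_mult"
  shows "prod_list (map l \<alpha>) = (\<Prod>i\<in>UNIV. l i ^ count_list \<alpha> i)"
proof (induction \<alpha>)
  case (Cons a \<alpha>)
  have "(\<Prod>i\<in>UNIV. l i ^ count_list (a # \<alpha>) i)
      = (\<Prod>i\<in>UNIV. (if i = a then l i else 1) * l i ^ count_list \<alpha> i)"
    by (intro prod.cong) auto
  also have "\<dots> = l a * (\<Prod>i\<in>UNIV. l i ^ count_list \<alpha> i)"
    by (simp add: prod.distrib)
  finally show ?case by (simp add: Cons.IH)
qed simp

lemma comm_words_eq: "comm_words k = {\<alpha>. count_list \<alpha> = k}"
proof -
  have "count_list \<alpha> i = k i"
    if eq: "\<forall>l :: 'a \<Rightarrow> complex. (\<Prod>i\<in>UNIV. l i ^ count_list \<alpha> i) = (\<Prod>i\<in>UNIV. l i ^ k i)"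
    for \<alpha> i
  proof -
    let ?l = "\<lambda>j. if j = i then 2 else (1 :: complex)"
    have *: "(\<Prod>j\<in>UNIV. ?l j ^ e j) = 2 ^ e i" for e :: "'a \<Rightarrow> nat"
    proof -
      have "(\<Prod>j\<in>UNIV. ?l j ^ e j) = (\<Prod>j\<in>UNIV. if j = i then 2 ^ e j else 1)"
        by (intro prod.cong) auto
      then show ?thesis by simp
    qed
    have "(2 :: complex) ^ count_list \<alpha> i = 2 ^ k i"
      using eq[rule_format, of ?l] by (simp only: *)
    then have "norm ((2 :: complex) ^ count_list \<alpha> i) = norm ((2 :: complex) ^ k i)" by simp
    then show ?thesis by (simp add: norm_power)
  qed
  then show ?thesis unfolding comm_words_def prod_list_map_count by (auto intro!: ext)
qed

lemma length_eq_sum_count: "length (\<alpha> :: 'n::finite list) = (\<Sum>i\<in>UNIV. count_list \<alpha> i)"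
proof (induction \<alpha>)
  case (Cons a \<alpha>)
  have "(\<Sum>i\<in>UNIV. count_list (a # \<alpha>) i) = (\<Sum>i\<in>UNIV. (if i = a then 1 else 0) + count_list \<alpha> i)"
    by (intro sum.cong) auto
  then show ?case by (simp add: sum.distrib Cons.IH)
qed simp

lemma finite_comm_words: "finite (comm_words k)"
proof (rule finite_subset)
  show "comm_words k \<subseteq> {w. length w = (\<Sum>i\<in>UNIV. k i)}"
    by (auto simp: comm_words_eq length_eq_sum_count)
qed simp

lemma csubspace_sum: "csubspace K \<Longrightarrow> (\<And>a. a \<in> A \<Longrightarrow> g a \<in> K) \<Longrightarrow> sum g A \<in> K"
  by (induction A rule: infinite_finite_induct) (auto simp: csubspace_def)

lemma scaleC_sum_right: "c *\<^sub>C sum g A = (\<Sum>a\<in>A. c *\<^sub>C (g a :: 'h::chilbert_space))"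
proof -
  have "c *\<^sub>C (0 :: 'h) = 0" using scaleC_add_right[of c "0 :: 'h" 0] by simp
  then show ?thesis
    by (induction A rule: infinite_finite_induct) (simp_all add: scaleC_add_right)
qed

lemma Omega_in_symm_space:
  assumes l: "l \<in> scalar_domain f Z"
  shows "Omega f l \<in> symm_space"
  unfolding symm_space_def closed_cspan_def hull_def
proof safe
  fix K :: "'a list ell2 set"
  assume om: "range omega \<subseteq> K" and K: "csubspace K" and cl: "closed K"
  define x where "x = (\<lambda>i. cnj (f_scalar f l i))"
  define S where "S N = (\<Sum>\<alpha> | length \<alpha> < N. prod_list (map x \<alpha>) *\<^sub>C ell2_unit \<alpha>)" for N
  have S_in: "S N \<in> K" for N
  proof -
    let ?A = "{\<alpha> :: 'a list. length \<alpha> < N}"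
    have "S N = (\<Sum>k\<in>count_list ` ?A. \<Sum>\<alpha> | \<alpha> \<in> ?A \<and> count_list \<alpha> = k.
        prod_list (map x \<alpha>) *\<^sub>C ell2_unit \<alpha>)"
      unfolding S_def by (rule sum.image_gen) simp
    also have "\<dots> \<in> K"
    proof (rule csubspace_sum[OF K])
      fix k assume "k \<in> count_list ` ?A"
      then obtain \<beta> :: "'a list" where \<beta>: "length \<beta> < N" "count_list \<beta> = k" by auto
      have set_eq: "{\<alpha>. \<alpha> \<in> ?A \<and> count_list \<alpha> = k} = comm_words k"
        using \<beta> by (auto simp: comm_words_eq length_eq_sum_count)
      have "\<beta> \<in> comm_words k" using \<beta> by (simp add: comm_words_eq)
      then have card: "card (comm_words k) \<noteq> 0" using finite_comm_words[of k] by auto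
      let ?c = "(\<Prod>i\<in>UNIV. x i ^ k i)"
      have "(\<Sum>\<alpha>\<in>comm_words k. prod_list (map x \<alpha>) *\<^sub>C ell2_unit \<alpha>)
          = (\<Sum>\<alpha>\<in>comm_words k. ?c *\<^sub>C ell2_unit \<alpha>)"
        by (intro sum.cong refl) (simp add: comm_words_def)
      also have "\<dots> = (?c * of_nat (card (comm_words k))) *\<^sub>C omega k"
        using card by (simp add: omega_def scaleC_scaleC scaleC_sum_right)
      also have "\<dots> \<in> K" using om K unfolding csubspace_def by blast
      finally show "(\<Sum>\<alpha> | \<alpha> \<in> ?A \<and> count_list \<alpha> = k.
          prod_list (map x \<alpha>) *\<^sub>C ell2_unit \<alpha>) \<in> K"
        unfolding set_eq .
    qed
    finally show ?thesis .
  qed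
  let ?q = "\<lambda>\<alpha>. (cmod (prod_list (map x \<alpha>)))\<^sup>2"
  have summ: "?q summable_on UNIV"
    using ell2_nth_summable[of "Omega f l"] by (simp add: ell2_nth_Omega[OF l] x_def)
  have nth_S: "ell2_nth (S N) \<alpha> = (if length \<alpha> < N then prod_list (map x \<alpha>) else 0)" for N \<alpha>
  proof -
    have "ell2_nth (S N) \<alpha>
        = (\<Sum>\<beta> | length \<beta> < N. if \<alpha> = \<beta> then prod_list (map x \<beta>) else 0)"
      unfolding S_def ell2_nth_sum scaleC_ell2.rep_eq ell2_nth_unit by (intro sum.cong) auto
    then show ?thesis by simp
  qed
  have nrm: "(norm (S N - Omega f l))\<^sup>2 = infsum ?q UNIV - (\<Sum>\<alpha> | length \<alpha> < N. ?q \<alpha>)" for N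
  proof -
    have "(norm (S N - Omega f l))\<^sup>2 = infsum ?q (UNIV - {\<alpha>. length \<alpha> < N})"
      unfolding norm_ell2_square minus_ell2.rep_eq nth_S
      by (rule infsum_cong_neutral) (auto simp: ell2_nth_Omega[OF l] x_def)
    also have "\<dots> = infsum ?q UNIV - infsum ?q {\<alpha>. length \<alpha> < N}"
      by (rule infsum_Diff[OF summ]) auto
    finally show ?thesis by simp
  qed
  have "(\<lambda>N. infsum ?q UNIV - (\<Sum>\<alpha> | length \<alpha> < N. ?q \<alpha>)) \<longlonglongrightarrow> infsum ?q UNIV - infsum ?q UNIV"
    by (intro tendsto_intros infsum_words_limit summ)
  then have "(\<lambda>N. (norm (S N - Omega f l))\<^sup>2) \<longlonglongrightarrow> 0" by (simp add: nrm)
  then have "(\<lambda>N. sqrt ((norm (S N - Omega f l))\<^sup>2)) \<longlonglongrightarrow> sqrt 0"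
    by (rule tendsto_real_sqrt)
  then have "S \<longlonglongrightarrow> Omega f l" by (simp add: LIM_zero_iff tendsto_norm_zero_iff)
  then show "Omega f l \<in> K" using closed_sequentially[OF cl] S_in by blast
qed

theorem hardy_reproducing_kernel:
  assumes "l \<in> scalar_domain f Z"
  shows "Omega f l \<in> symm_space"
    and "to_fun f Z (Omega f l) = (\<lambda>m\<in>scalar_domain f Z. hardy_kernel f m l)"
    and "to_fun f Z \<psi> l = cinner \<psi> (Omega f l)"
proof -
  show "Omega f l \<in> symm_space" by (rule Omega_in_symm_space[OF assms])
  show "to_fun f Z (Omega f l) = (\<lambda>m\<in>scalar_domain f Z. hardy_kernel f m l)"
    unfolding to_fun_def by (rule restrict_ext) (rule cinner_Omega[OF assms])
  show "to_fun f Z \<psi> l = cinner \<psi> (Omega f l)" using assms by (simp add: to_fun_def)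
qed

end

theory Submission
  imports Defs
begin

text \<open>
  The adjoints of the operators \<open>M i\<close> have the kernel vectors \<open>\<Sum>\<^sub>\<alpha> cnj z\<^sub>\<alpha> f\<^sub>\<alpha>\<close>, \<open>z\<close> in the unit ball,
  as joint eigenvectors, with eigenvalues \<open>cnj (g\<^sub>i(z))\<close>.  Pairing the identity \<open>f(M) e = (f\<^sub>j)\<^sub>j\<close> with
  them shows that \<open>f\<close> maps the scalar domain onto the ball and has the right inverse \<open>g\<close> (Abel's
  theorem reconciles the two notions of convergence).  On the symmetric space the kernel vectors are
  total, so the compressions of the \<open>M i\<close> are multiplication operators, and so are all elements of the
  WOT-closed algebra.  Conversely this algebra contains multiplication by \<open>z\<^sub>j\<close>, the compression of
  \<open>f\<^sub>j(M)\<close>, and an arbitrary multiplier is the WOT-limit of its Fejer means, which are polynomials in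
  the \<open>z\<^sub>j\<close> and whose norms do not exceed that of the multiplier.  Finally an operator is a
  multiplier iff it preserves the orthogonal complement of each kernel vector, and these
  complements are invariant subspaces, hence reflexivity.
\<close>

subsection \<open>Complex Hilbert spaces\<close>

text \<open>The generators have the symbols g_i, whereas approximation of a multiplier needs the
  coordinates z_j; these have to be recovered inside the algebra from f_j(M). For this, compression
  must be multiplicative although the symmetric space is not known to be invariant under the
  \<open>M i\<close>; what helps is that the joint eigenvectors of the adjoints lie in that space
  and separate its points. Truncating the expansion of a multiplier gives no control of operator
  norms. Fejer means do, and writing them as averages over windows of degrees yields the bound
  without integrating over rotations. Multiplication operators are encoded by preservation of zeros
  (\<open>mult_ops\<close>) and not by a symbol: each constraint then concerns one matrix
  coefficient and one invariant subspace, from which WOT-closedness and reflexivity come directly.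
  The three forms of the model property enter through two identities, for \<open>M i\<close> applied
  to f_\<beta> and for f_j(M) applied to 1. In each form they are checked on actual elements and
  pulled back by injectivity of the map from coefficient vectors to elements (on finitely supported
  vectors in case (A)).\<close>

lemma scaleC_zero_left [simp]: "0 *\<^sub>C (x :: 'h::chilbert_space) = 0"
  using scaleC_of_real[of 0 x] by simp

lemma scaleC_one [simp]: "1 *\<^sub>C (x :: 'h::chilbert_space) = x"
  using scaleC_of_real[of 1 x] by simp

lemma scaleC_zero_right [simp]: "c *\<^sub>C (0 :: 'h::chilbert_space) = 0"
  using scaleC_add_right[of c "0 :: 'h" 0] by simp

lemma scaleC_minus1: "(-1) *\<^sub>C (x :: 'h::chilbert_space) = - x"
  using scaleC_of_real[of "-1" x] by simp

lemma scaleC_minus_left: "(- c) *\<^sub>C (x :: 'h::chilbert_space) = - (c *\<^sub>C x)"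
  using scaleC_scaleC[of "-1" c x] by (simp add: scaleC_minus1)

lemma scaleC_scaleR: "c *\<^sub>C r *\<^sub>R (x :: 'h::chilbert_space) = r *\<^sub>R c *\<^sub>C x"
  by (simp add: scaleC_scaleC mult.commute flip: scaleC_of_real)

lemma cinner_zero_left [simp]: "cinner 0 (y :: 'h::chilbert_space) = 0"
  using cinner_add_left[of 0 0 y] by simp

lemma cinner_zero_right [simp]: "cinner (x :: 'h::chilbert_space) 0 = 0"
  using cinner_commute[of x 0] by simp

lemma cinner_add_right: "cinner (x :: 'h::chilbert_space) (y + z) = cinner x y + cinner x z"
  by (metis cinner_add_left cinner_commute complex_cnj_add)

lemma cinner_scaleC_right: "cinner (x :: 'h::chilbert_space) (c *\<^sub>C y) = cnj c * cinner x y"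
  by (metis cinner_scaleC_left cinner_commute complex_cnj_mult)

lemma cinner_scaleR_left: "cinner (r *\<^sub>R x :: 'h::chilbert_space) y = r * cinner x y"
  using cinner_scaleC_left[of "complex_of_real r" x y] by (simp add: scaleC_of_real)

lemma cinner_minus_left: "cinner (- x :: 'h::chilbert_space) y = - cinner x y"
  using cinner_scaleC_left[of "-1" x y] by (simp add: scaleC_minus1)

lemma cinner_minus_right: "cinner (x :: 'h::chilbert_space) (- y) = - cinner x y"
  using cinner_scaleC_right[of x "-1" y] by (simp add: scaleC_minus1)

lemma cinner_diff_left: "cinner (x - y :: 'h::chilbert_space) z = cinner x z - cinner y z"
  using cinner_add_left[of x "- y" z] by (simp add: cinner_minus_left)

lemma cinner_diff_right: "cinner (x :: 'h::chilbert_space) (y - z) = cinner x y - cinner x z"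
  using cinner_add_right[of x y "- z"] by (simp add: cinner_minus_right)

lemma cinner_sum_left: "cinner (sum g A) (y :: 'h::chilbert_space) = (\<Sum>a\<in>A. cinner (g a) y)"
  by (induction A rule: infinite_finite_induct) (simp_all add: cinner_add_left)

lemma cinner_self: "cinner x x = complex_of_real ((norm (x :: 'h::chilbert_space))\<^sup>2)"
proof -
  have "Im (cinner x x) = 0" using arg_cong[OF cinner_commute[of x x], of Im] by simp
  then show ?thesis by (simp add: complex_eq_iff power2_norm_eq_inner inner_eq_Re_cinner)
qed

lemma cinner_self_eq_0 [simp]: "cinner x x = 0 \<longleftrightarrow> (x :: 'h::chilbert_space) = 0"
  by (simp add: cinner_self)

lemma norm_scaleC [simp]: "norm (c *\<^sub>C (x :: 'h::chilbert_space)) = cmod c * norm x"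
proof -
  have "complex_of_real ((norm (c *\<^sub>C x))\<^sup>2) = complex_of_real ((cmod c * norm x)\<^sup>2)"
    unfolding cinner_self[symmetric] cinner_scaleC_left cinner_scaleC_right
    by (simp add: cinner_self power_mult_distrib complex_norm_square flip: of_real_power)
  then have "(norm (c *\<^sub>C x))\<^sup>2 = (cmod c * norm x)\<^sup>2" by (simp only: of_real_eq_iff)
  then show ?thesis by (simp add: power2_eq_iff_nonneg)
qed

text \<open>The real inner product is the real part of \<open>cinner\<close>, so multiplying
  \<open>x\<close> by a unimodular \<open>u\<close> that makes the pairing real and nonnegative
  reduces the claim to the real inequality.\<close>

lemma cinner_Cauchy_Schwarz: "cmod (cinner x y) \<le> norm (x :: 'h::chilbert_space) * norm y"
proof -
  obtain u where u: "cmod u = 1" "u * cinner x y = complex_of_real (cmod (cinner x y))"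
  proof (cases "cinner x y = 0")
    case False
    have "cnj (sgn (cinner x y)) * cinner x y = complex_of_real (cmod (cinner x y))"
    proof -
      have "cnj (sgn (cinner x y)) * cinner x y = (cinner x y * cnj (cinner x y)) / cmod (cinner x y)"
        by (simp add: sgn_div_norm scaleR_conv_of_real divide_inverse mult_ac)
      also have "\<dots> = complex_of_real (cmod (cinner x y))"
        using False by (simp add: complex_norm_square[symmetric] power2_eq_square)
      finally show ?thesis .
    qed
    moreover have "cmod (cnj (sgn (cinner x y))) = 1" using False by (simp add: norm_sgn)
    ultimately show ?thesis using that by blast
  qed (use that[of 1] in simp)
  have "cmod (cinner x y) = inner (u *\<^sub>C x) y"
    by (simp add: inner_eq_Re_cinner cinner_scaleC_left u)
  also have "\<dots> \<le> norm (u *\<^sub>C x) * norm y" by (rule norm_cauchy_schwarz)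
  finally show ?thesis by (simp add: u)
qed

lemma bounded_linear_cinner_left: "bounded_linear (\<lambda>x :: 'h::chilbert_space. cinner x y)"
  by (rule bounded_linear_intro[of _ "norm y"])
    (simp_all add: cinner_add_left cinner_scaleR_left cinner_Cauchy_Schwarz scaleR_conv_of_real)

lemma bounded_linear_cinner_right: "bounded_linear (\<lambda>y :: 'h::chilbert_space. cinner x y)"
proof (rule bounded_linear_intro[of _ "norm x"])
  show "cinner x (r *\<^sub>R y) = r *\<^sub>R cinner x y" for r y
    using cinner_scaleC_right[of x "complex_of_real r" y]
    by (simp add: scaleC_of_real scaleR_conv_of_real)
  show "cmod (cinner x y) \<le> norm y * norm x" for y
    using cinner_Cauchy_Schwarz[of x y] by (simp add: mult.commute)
qed (simp add: cinner_add_right)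

lemma bounded_linear_scaleC: "bounded_linear (\<lambda>x :: 'h::chilbert_space. c *\<^sub>C x)"
  by (rule bounded_linear_intro[of _ "cmod c"]) (simp_all add: scaleC_add_right scaleC_scaleR)

lemmas tendsto_cinner_left [tendsto_intros] = bounded_linear.tendsto[OF bounded_linear_cinner_left]

lemma csubspaceD:
  assumes "csubspace K"
  shows "0 \<in> K" "x \<in> K \<Longrightarrow> y \<in> K \<Longrightarrow> x + y \<in> K" "x \<in> K \<Longrightarrow> c *\<^sub>C x \<in> K"
    "x \<in> K \<Longrightarrow> y \<in> K \<Longrightarrow> x - y \<in> K" "x \<in> K \<Longrightarrow> r *\<^sub>R x \<in> K"
proof -
  show *: "0 \<in> K" "x \<in> K \<Longrightarrow> y \<in> K \<Longrightarrow> x + y \<in> K" "x \<in> K \<Longrightarrow> c *\<^sub>C x \<in> K" for x y c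
    using assms by (auto simp: csubspace_def)
  show "x \<in> K \<Longrightarrow> y \<in> K \<Longrightarrow> x - y \<in> K"
    using *(2)[of x "- y"] *(3)[of y "-1"] by (simp add: scaleC_minus1)
  show "x \<in> K \<Longrightarrow> r *\<^sub>R x \<in> K"
    using *(3)[of x "complex_of_real r"] by (simp add: scaleC_of_real)
qed

lemma csubspace_UNIV [simp]: "csubspace UNIV"
  by (simp add: csubspace_def)

section \<open>Orthogonal projection onto a closed subspace\<close>

lemma norm_square_diff_scaleC:
  "complex_of_real ((norm (u - c *\<^sub>C w :: 'h::chilbert_space))\<^sup>2) =
    complex_of_real ((norm u)\<^sup>2) - cnj c * cinner u w - c * cnj (cinner u w)
    + c * cnj c * complex_of_real ((norm w)\<^sup>2)"
  unfolding cinner_self[symmetric] cinner_commute[of u w, symmetric] cinner_diff_left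
    cinner_diff_right cinner_scaleC_left cinner_scaleC_right
  by (simp add: algebra_simps flip: cinner_commute[of w u])

text \<open>A minimizing sequence in \<open>K\<close> is Cauchy by the parallelogram law, and at its
  limit the difference is orthogonal to \<open>K\<close>, since otherwise a move along some
  \<open>w\<close> in \<open>K\<close> would shorten the distance.\<close>

lemma exists_orth_proj:
  fixes K :: "'h::chilbert_space set"
  assumes K: "csubspace K" "closed K"
  obtains y where "y \<in> K" "\<And>k. k \<in> K \<Longrightarrow> cinner (x - y) k = 0"
proof -
  define d where "d = infdist x K"
  have ne: "K \<noteq> {}" using csubspaceD(1)[OF K(1)] by auto
  have d_le: "d \<le> norm (x - k)" if "k \<in> K" for k
    unfolding d_def using infdist_le[OF that, of x] by (simp add: dist_norm)
  have d0: "0 \<le> d" by (simp add: d_def infdist_nonneg)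
  have "\<exists>k\<in>K. norm (x - k) < d + 1 / Suc n" for n
  proof (rule ccontr)
    assume "\<not> ?thesis"
    then have "\<And>k. k \<in> K \<Longrightarrow> d + 1 / Suc n \<le> dist x k" by (auto simp: dist_norm)
    then have "d + 1 / Suc n \<le> infdist x K" using ne by (simp add: infdist_def cINF_greatest)
    then show False by (simp add: d_def)
  qed
  then obtain k where k: "\<And>n. k n \<in> K" "\<And>n. norm (x - k n) < d + 1 / Suc n" by metis
  \<comment> \<open>The midpoint of \<open>k m\<close> and \<open>k n\<close> lies in
    \<open>K\<close>, at distance at least \<open>d\<close> from \<open>x\<close>. The parallelogram
    law then leaves four times the excess (d + eps)^2 - d^2, which is at most (2 d + 1) eps because
    eps = 1 / (N + 1) <= 1.\<close>
  have par: "(norm (k m - k n))\<^sup>2 \<le> 4 * (2 * d + 1) * (1 / Suc N)" if "N \<le> m" "N \<le> n" for m n N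
  proof -
    have e: "(norm (x - k j))\<^sup>2 \<le> d\<^sup>2 + (2 * d + 1) * (1 / Suc N)" if "N \<le> j" for j
    proof -
      have j: "1 / Suc j \<le> 1 / Suc N" using that by (simp add: frac_le)
      have N1: "1 / real (Suc N) \<le> 1" by simp
      have "norm (x - k j) \<le> d + 1 / Suc N" using k(2)[of j] j by simp
      then have "(norm (x - k j))\<^sup>2 \<le> (d + 1 / Suc N)\<^sup>2" by (intro power_mono) auto
      also have "\<dots> = d\<^sup>2 + (2 * d) * (1 / Suc N) + (1 / Suc N) * (1 / Suc N)"
        by (simp add: power2_eq_square algebra_simps)
      also have "(1 / Suc N) * (1 / Suc N) \<le> 1 * (1 / real (Suc N))"
        by (intro mult_right_mono N1) simp
      finally show ?thesis by (simp add: algebra_simps)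
    qed
    have aux: "2 * a + 2 * b - c \<le> 4 * (D + q) - 4 * D"
      if "a \<le> D + q" "b \<le> D + q" "4 * D \<le> c" for a b c D q :: real
      using that by argo
    have mid: "(1/2) *\<^sub>R (k m + k n) \<in> K" by (intro csubspaceD[OF K(1)] k)
    have "d\<^sup>2 \<le> (norm (x - (1/2) *\<^sub>R (k m + k n)))\<^sup>2" using d_le[OF mid] d0 by (intro power_mono)
    also have "x - (1/2) *\<^sub>R (k m + k n) = (1/2) *\<^sub>R ((x - k m) + (x - k n))"
      by (simp add: algebra_simps flip: scaleR_add_left)
    finally have d4: "4 * d\<^sup>2 \<le> (norm ((x - k m) + (x - k n)))\<^sup>2"
      by (simp add: power_mult_distrib power2_eq_square)
    have "(norm (k m - k n))\<^sup>2 = (norm ((x - k n) - (x - k m)))\<^sup>2" by simp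
    also have "\<dots> = 2 * (norm (x - k m))\<^sup>2 + 2 * (norm (x - k n))\<^sup>2 - (norm ((x - k m) + (x - k n)))\<^sup>2"
      unfolding power2_norm_eq_inner by (simp add: inner_diff inner_add inner_commute)
    also have "\<dots> \<le> 4 * (d\<^sup>2 + (2 * d + 1) * (1 / Suc N)) - 4 * d\<^sup>2"
      by (rule aux[OF e[OF that(1)] e[OF that(2)] d4])
    finally show ?thesis by (simp add: algebra_simps)
  qed
  have "Cauchy k"
  proof (rule CauchyI')
    fix e :: real assume "e > 0"
    obtain N where N: "4 * (2 * d + 1) / e\<^sup>2 < real N" using reals_Archimedean2 by blast
    have "e\<^sup>2 > 0" using \<open>e > 0\<close> by simp
    then have "4 * (2 * d + 1) < real N * e\<^sup>2" using N by (simp only: pos_divide_less_eq)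
    also have "\<dots> \<le> e\<^sup>2 * Suc N" by (simp add: algebra_simps)
    finally have N': "4 * (2 * d + 1) < e\<^sup>2 * Suc N" .
    have "dist (k m) (k n) < e" if "N \<le> m" "N \<le> n" for m n
    proof -
      have "4 * (2 * d + 1) * (1 / Suc N) < e\<^sup>2" using N' by (simp add: field_simps)
      then have "(norm (k m - k n))\<^sup>2 < e\<^sup>2" using par[OF that] by linarith
      then show ?thesis using \<open>e > 0\<close> by (simp add: dist_norm power2_less_imp_less)
    qed
    then show "\<exists>M. \<forall>m\<ge>M. \<forall>n>m. dist (k m) (k n) < e" by (meson less_imp_le order_trans)
  qed
  then obtain y where y: "k \<longlonglongrightarrow> y" by (auto simp: Cauchy_convergent_iff convergent_def)
  have "y \<in> K" using closed_sequentially[OF K(2) _ y] k(1) by blast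
  have "norm (x - y) \<le> d"
  proof (rule LIMSEQ_le)
    show "(\<lambda>n. norm (x - k n)) \<longlonglongrightarrow> norm (x - y)" by (intro tendsto_intros y)
    show "(\<lambda>n. d + 1 / Suc n) \<longlonglongrightarrow> d"
      using tendsto_add[OF tendsto_const[of d] LIMSEQ_inverse_real_of_nat] by (simp add: inverse_eq_divide)
    show "\<exists>N. \<forall>n\<ge>N. norm (x - k n) \<le> d + 1 / real (Suc n)" using k(2) less_imp_le by blast
  qed
  then have nd: "norm (x - y) = d" using d_le[OF \<open>y \<in> K\<close>] by simp
  have "cinner (x - y) w = 0" if "w \<in> K" for w
  proof (cases "w = 0")
    case False
    \<comment> \<open>The coefficient of the projection of x - y onto \<open>w\<close>; subtracting
      c w lowers the squared distance by |<x - y, w>|^2 / |w|^2.\<close>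
    define c where "c = cinner (x - y) w / complex_of_real ((norm w)\<^sup>2)"
    have "y + c *\<^sub>C w \<in> K" by (intro csubspaceD[OF K(1)] \<open>y \<in> K\<close> that)
    from d_le[OF this] have le: "(norm (x - y))\<^sup>2 \<le> (norm ((x - y) - c *\<^sub>C w))\<^sup>2"
      using nd d0 by (intro power_mono) (auto simp: algebra_simps)
    have "complex_of_real ((norm ((x - y) - c *\<^sub>C w))\<^sup>2) =
        complex_of_real ((norm (x - y))\<^sup>2) - cnj c * cinner (x - y) w - c * cnj (cinner (x - y) w)
        + c * cnj c * complex_of_real ((norm w)\<^sup>2)"
      by (rule norm_square_diff_scaleC)
    also have "\<dots> = complex_of_real ((norm (x - y))\<^sup>2 - (cmod (cinner (x - y) w))\<^sup>2 / (norm w)\<^sup>2)"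
      using False by (simp add: c_def complex_norm_square field_simps flip: of_real_power)
    finally have "(norm ((x - y) - c *\<^sub>C w))\<^sup>2 = (norm (x - y))\<^sup>2 - (cmod (cinner (x - y) w))\<^sup>2 / (norm w)\<^sup>2"
      by (simp only: of_real_eq_iff)
    with le have "(cmod (cinner (x - y) w))\<^sup>2 / (norm w)\<^sup>2 \<le> 0" by simp
    then have "(cmod (cinner (x - y) w))\<^sup>2 \<le> 0" using False by (simp add: divide_le_0_iff)
    then show ?thesis by simp
  qed simp
  with \<open>y \<in> K\<close> show ?thesis using that by blast
qed

lemma orth_proj:
  fixes K :: "'h::chilbert_space set"
  assumes K: "csubspace K" "closed K"
  shows "orth_proj K x \<in> K" "k \<in> K \<Longrightarrow> cinner (orth_proj K x) k = cinner x k"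
proof -
  obtain y where y: "y \<in> K" "\<And>k. k \<in> K \<Longrightarrow> cinner (x - y) k = 0"
    using exists_orth_proj[OF K, of x] by metis
  have "orth_proj K x \<in> K \<and> (\<forall>k\<in>K. cinner (x - orth_proj K x) k = 0)"
    unfolding orth_proj_def
  proof (rule theI[where a = y])
    show "y \<in> K \<and> (\<forall>k\<in>K. cinner (x - y) k = 0)" using y by simp
    fix y' assume y': "y' \<in> K \<and> (\<forall>k\<in>K. cinner (x - y') k = 0)"
    have d: "y - y' \<in> K" by (intro csubspaceD(4)[OF K(1)] y(1) conjunct1[OF y'])
    have "cinner (x - y') (y - y') - cinner (x - y) (y - y') = 0"
      using y' d by (simp add: y(2)[OF d])
    then have "cinner (y - y') (y - y') = 0" by (simp add: cinner_diff_left)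
    then show "y' = y" by simp
  qed
  then show "orth_proj K x \<in> K" "k \<in> K \<Longrightarrow> cinner (orth_proj K x) k = cinner x k"
    by (simp_all add: cinner_diff_left)
qed

lemma orth_proj_eqI:
  fixes K :: "'h::chilbert_space set"
  assumes K: "csubspace K" "closed K" and y: "y \<in> K" "\<And>k. k \<in> K \<Longrightarrow> cinner y k = cinner x k"
  shows "orth_proj K x = y"
proof -
  have "orth_proj K x - y \<in> K" by (intro csubspaceD(4)[OF K(1)] orth_proj(1)[OF K] y(1))
  then have "cinner (orth_proj K x - y) (orth_proj K x - y) = 0"
    by (simp add: cinner_diff_left orth_proj[OF K] y)
  then show ?thesis by simp
qed

lemma norm_orth_proj_le:
  fixes K :: "'h::chilbert_space set"
  assumes K: "csubspace K" "closed K"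
  shows "norm (orth_proj K x) \<le> norm x"
proof -
  have "complex_of_real ((norm (orth_proj K x))\<^sup>2) = cinner x (orth_proj K x)"
    unfolding cinner_self[symmetric] by (rule orth_proj(2)[OF K orth_proj(1)[OF K]])
  from arg_cong[OF this, of cmod]
  have "cmod (cinner x (orth_proj K x)) = (norm (orth_proj K x))\<^sup>2"
    by (simp only: norm_of_real abs_power2)
  then have "(norm (orth_proj K x))\<^sup>2 \<le> norm x * norm (orth_proj K x)"
    using cinner_Cauchy_Schwarz[of x "orth_proj K x"] by argo
  then show ?thesis by (cases "norm (orth_proj K x) = 0") (auto simp: power2_eq_square)
qed

lemma orth_proj_linear:
  fixes K :: "'h::chilbert_space set"
  assumes K: "csubspace K" "closed K"
  shows "orth_proj K (x + y) = orth_proj K x + orth_proj K y"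
    "orth_proj K (c *\<^sub>C x) = c *\<^sub>C orth_proj K x"
proof -
  show "orth_proj K (x + y) = orth_proj K x + orth_proj K y"
    by (intro orth_proj_eqI[OF K] csubspaceD(2)[OF K(1)] orth_proj(1)[OF K])
      (simp add: cinner_add_left orth_proj(2)[OF K])
  show "orth_proj K (c *\<^sub>C x) = c *\<^sub>C orth_proj K x"
    by (intro orth_proj_eqI[OF K] csubspaceD(3)[OF K(1)] orth_proj(1)[OF K])
      (simp add: cinner_scaleC_left orth_proj(2)[OF K])
qed

text \<open>The difference of \<open>x\<close> and its projection onto \<open>C\<close> stays in
  \<open>K\<close>, because \<open>C\<close> lies in \<open>K\<close>, and is orthogonal to
  \<open>G\<close>, hence zero. This is the density principle by which closed linear conditions are
  verified on a total set only.\<close>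

lemma total_subset_closed_csubspace:
  fixes K C :: "'h::chilbert_space set"
  assumes K: "csubspace K"
    and tot: "\<And>x. x \<in> K \<Longrightarrow> (\<And>g. g \<in> G \<Longrightarrow> cinner x g = 0) \<Longrightarrow> x = 0"
    and C: "csubspace C" "closed C" "G \<subseteq> C" "C \<subseteq> K"
  shows "K \<subseteq> C"
proof
  fix x assume x: "x \<in> K"
  have "x - orth_proj C x = 0"
  proof (rule tot)
    show "x - orth_proj C x \<in> K" 
      by (intro csubspaceD(4)[OF K] x subsetD[OF C(4)] orth_proj(1)[OF C(1,2)])
    show "cinner (x - orth_proj C x) g = 0" if "g \<in> G" for g
      using that C(3) orth_proj(2)[OF C(1,2), of g x] by (auto simp: cinner_diff_left)
  qed
  then show "x \<in> C" using orth_proj(1)[OF C(1,2), of x] by simp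
qed

text \<open>Replacing \<open>y\<close> by a nearby vector costs at most (c + |w'|) times the
  distance, uniformly in the index; without a uniform bound closedness may fail. The summand 1 in
  \<open>c'\<close> only secures positivity.\<close>

lemma closed_csubspace_tendsto_cinner:
  fixes w :: "'b \<Rightarrow> 'h::chilbert_space"
  assumes bdd: "\<And>i. norm (w i) \<le> c"
  shows "csubspace {y. ((\<lambda>i. cinner (w i) y) \<longlongrightarrow> cinner w' y) F}" (is "csubspace ?C")
    and "closed {y. ((\<lambda>i. cinner (w i) y) \<longlongrightarrow> cinner w' y) F}"
proof -
  show "csubspace ?C"
    by (auto simp: csubspace_def cinner_add_right cinner_scaleC_right intro!: tendsto_intros)
  have c0: "0 \<le> c" using bdd[of undefined] norm_ge_zero order_trans by blast
  define c' where "c' = c + norm w' + 1"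
  have c': "c' > 0" using c0 by (simp add: c'_def add_nonneg_pos)
  show "closed ?C"
    unfolding closed_sequential_limits
  proof safe
    fix y l assume y: "\<forall>n. y n \<in> ?C" and l: "y \<longlonglongrightarrow> l"
    show "((\<lambda>i. cinner (w i) l) \<longlongrightarrow> cinner w' l) F"
    proof (rule tendstoI)
      fix e :: real assume e: "e > 0"
      then have "e / (2 * c') > 0" using c' by simp
      from metric_LIMSEQ_D[OF l this] obtain n where n: "dist (y n) l < e / (2 * c')" by blast
      have "((\<lambda>i. cinner (w i) (y n)) \<longlongrightarrow> cinner w' (y n)) F" using y by blast
      then have "\<forall>\<^sub>F i in F. dist (cinner (w i) (y n)) (cinner w' (y n)) < e / 2"
        using e by (intro tendstoD) auto
      then show "\<forall>\<^sub>F i in F. dist (cinner (w i) l) (cinner w' l) < e"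
      proof eventually_elim
        case (elim i)
        have "cinner (w i) l - cinner w' l
            = cinner (w i - w') (l - y n) + (cinner (w i) (y n) - cinner w' (y n))"
          by (simp add: cinner_diff_left cinner_diff_right)
        also have "cmod \<dots> \<le> norm (w i - w') * norm (l - y n) + dist (cinner (w i) (y n)) (cinner w' (y n))"
          unfolding dist_norm by (intro norm_triangle_mono cinner_Cauchy_Schwarz order_refl)
        also have "norm (w i - w') * norm (l - y n) \<le> c' * (e / (2 * c'))"
          using norm_triangle_ineq4[of "w i" w'] bdd[of i] n c'
          by (intro mult_mono) (auto simp: c'_def dist_norm norm_minus_commute)
        also have "c' * (e / (2 * c')) = e / 2" using c' by simp
        finally show ?case using elim by (simp add: dist_norm)
      qed
    qed
  qed
qed

text \<open>The bound makes the set of good test vectors a closed subspace, which contains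
  \<open>K\<close> once it contains a total set. The total sets used later are the kernel vectors
  and their homogeneous parts.\<close>

lemma weakly_tendstoI:
  fixes w :: "'b \<Rightarrow> 'h::chilbert_space"
  assumes K: "csubspace K" "closed K" "G \<subseteq> K"
    and tot: "\<And>x. x \<in> K \<Longrightarrow> (\<And>g. g \<in> G \<Longrightarrow> cinner x g = 0) \<Longrightarrow> x = 0"
    and bdd: "\<And>i. norm (w i) \<le> c"
    and lim: "\<And>g. g \<in> G \<Longrightarrow> ((\<lambda>i. cinner (w i) g) \<longlongrightarrow> cinner w' g) F"
    and y: "y \<in> K"
  shows "((\<lambda>i. cinner (w i) y) \<longlongrightarrow> cinner w' y) F"
proof -
  let ?C = "{y. ((\<lambda>i. cinner (w i) y) \<longlongrightarrow> cinner w' y) F}"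
  note C = closed_csubspace_tendsto_cinner[where w = w and w' = w' and F = F, OF bdd]
  have "K \<subseteq> K \<inter> ?C"
  proof (rule total_subset_closed_csubspace[OF K(1) tot])
    show "csubspace (K \<inter> ?C)" using K(1) C(1) by (simp add: csubspace_def)
    show "closed (K \<inter> ?C)" using K(2) C(2) by (rule closed_Int)
  qed (use K(3) lim in auto)
  then show ?thesis using y by blast
qed

text \<open>Pairing with the limit \<open>w'\<close> itself gives |w'|^2 <= c |w'|, so convergence
  of this single pairing suffices.\<close>

lemma norm_weak_limit_le:
  fixes w :: "'b \<Rightarrow> 'h::chilbert_space"
  assumes "\<And>i. norm (w i) \<le> c" "((\<lambda>i. cinner (w i) w') \<longlongrightarrow> cinner w' w') F" "F \<noteq> bot"
  shows "norm w' \<le> c"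
proof -
  have c0: "0 \<le> c" using assms(1)[of undefined] norm_ge_zero order_trans by blast
  have "cmod (cinner w' w') \<le> c * norm w'"
  proof (rule tendsto_upperbound[OF tendsto_norm[OF assms(2)] _ assms(3)])
    show "\<forall>\<^sub>F i in F. cmod (cinner (w i) w') \<le> c * norm w'"
      using assms(1) by (intro always_eventually allI order_trans[OF cinner_Cauchy_Schwarz]
          mult_right_mono) auto
  qed
  then have "norm w' * norm w' \<le> c * norm w'"
    by (simp add: cinner_self norm_power power2_eq_square norm_mult)
  then show ?thesis using c0 by (cases "norm w' = 0") (auto simp: mult_le_cancel_right)
qed

subsection \<open>Bounded operators and the weak operator topology\<close>

lemma bopsI:
  assumes "csubspace K" "T \<in> extensional K" "\<And>x. x \<in> K \<Longrightarrow> T x \<in> K"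
    "\<And>x y. x \<in> K \<Longrightarrow> y \<in> K \<Longrightarrow> T (x + y) = T x + T y"
    "\<And>c x. x \<in> K \<Longrightarrow> T (c *\<^sub>C x) = c *\<^sub>C T x"
    "\<And>x. x \<in> K \<Longrightarrow> norm (T x) \<le> B * norm x"
  shows "T \<in> bops K"
  using assms unfolding bops_def PiE_def by (auto intro!: exI[of _ B])

lemma bops_restrictI:
  assumes "csubspace K" "\<And>x. x \<in> K \<Longrightarrow> T x \<in> K"
    "\<And>x y. x \<in> K \<Longrightarrow> y \<in> K \<Longrightarrow> T (x + y) = T x + T y"
    "\<And>c x. x \<in> K \<Longrightarrow> T (c *\<^sub>C x) = c *\<^sub>C T x"
    "\<And>x. x \<in> K \<Longrightarrow> norm (T x) \<le> B * norm x"
  shows "(\<lambda>x\<in>K. T x) \<in> bops K"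
  using assms(2-) csubspaceD[OF assms(1)]
  by (intro bopsI[OF assms(1), where B = B]) auto

lemma bopsD:
  assumes "T \<in> bops K"
  shows "x \<in> K \<Longrightarrow> T x \<in> K" "x \<in> K \<Longrightarrow> y \<in> K \<Longrightarrow> T (x + y) = T x + T y"
    "x \<in> K \<Longrightarrow> T (c *\<^sub>C x) = c *\<^sub>C T x" "T \<in> extensional K"
  using assms by (auto simp: bops_def PiE_def)

lemma bops_diff:
  assumes "T \<in> bops K" "csubspace K" "x \<in> K" "y \<in> K"
  shows "T (x - y) = T x - T y"
  using bopsD(2)[OF assms(1,3), of "(-1) *\<^sub>C y"] bopsD(3)[OF assms(1,4), of "-1"]
    csubspaceD(3)[OF assms(2,4), of "-1"] by (simp add: scaleC_minus1)

lemma bops_bound: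
  assumes "T \<in> bops K"
  obtains B where "B \<ge> 0" "\<And>x. x \<in> K \<Longrightarrow> norm (T x) \<le> B * norm x"
proof -
  obtain B where B: "\<forall>x\<in>K. norm (T x) \<le> B * norm x" using assms by (auto simp: bops_def)
  have "norm (T x) \<le> max 0 B * norm x" if "x \<in> K" for x
    using B that by (meson max.cobounded2 mult_right_mono norm_ge_zero order_trans)
  then show ?thesis using that[of "max 0 B"] by auto
qed

lemma bops_UNIV_bounded_linear:
  assumes "T \<in> bops (UNIV :: 'h::chilbert_space set)"
  shows "bounded_linear T"
proof -
  obtain B where B: "\<And>x. norm (T x) \<le> B * norm x" using bops_bound[OF assms] by auto
  show ?thesis
  proof (rule bounded_linear_intro[where K = B])
    show "T (r *\<^sub>R x) = r *\<^sub>R T x" for r x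
      using bopsD(3)[OF assms, of x "complex_of_real r"] by (simp add: scaleC_of_real)
  qed (use bopsD(2)[OF assms] B in \<open>auto simp: mult.commute\<close>)
qed

lemma bops_UNIV_I:
  assumes "bounded_linear T" "\<And>c x. T (c *\<^sub>C x) = c *\<^sub>C T x"
  shows "T \<in> bops (UNIV :: 'h::chilbert_space set)"
proof -
  obtain B where B: "\<And>x. norm (T x) \<le> norm x * B"
    using bounded_linear.bounded[OF assms(1)] by blast
  show ?thesis
    by (rule bopsI[where B = B])
      (auto simp: assms bounded_linear.linear linear_add mult.commute[of B] intro: B)
qed

lemma topspace_wot: "csubspace K \<Longrightarrow> topspace (wot K) = bops K"
proof
  assume "csubspace K"
  then have "{T \<in> bops K. cinner (T 0) 0 \<in> UNIV} \<in>
      {{T \<in> bops K. cinner (T x) y \<in> U} | x y U. x \<in> K \<and> y \<in> K \<and> open U}"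
    using csubspaceD(1) open_UNIV by blast
  then show "bops K \<subseteq> topspace (wot K)" unfolding wot_def topology_generated_by_topspace by blast
qed (auto simp: wot_def)

lemma openin_wot_basic:
  "x \<in> K \<Longrightarrow> y \<in> K \<Longrightarrow> open U \<Longrightarrow> openin (wot K) {T \<in> bops K. cinner (T x) y \<in> U}"
  unfolding wot_def by (rule topology_generated_by_Basis) blast

text \<open>A filter takes the place of a sequence so that the radial limit r -> 1 and limits of
  partial sums are treated alike.\<close>

lemma wot_closed_limit:
  assumes K: "csubspace K" and A: "closedin (wot K) A" and T: "T \<in> bops K"
    and F: "F \<noteq> bot" and ev: "\<forall>\<^sub>F i in F. S i \<in> A"
    and lim: "\<And>x y. x \<in> K \<Longrightarrow> y \<in> K \<Longrightarrow> ((\<lambda>i. cinner (S i x) y) \<longlongrightarrow> cinner (T x) y) F"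
  shows "T \<in> A"
proof (rule ccontr)
  assume "T \<notin> A"
  have AS: "A \<subseteq> bops K" using closedin_subset[OF A] topspace_wot[OF K] by simp
  \<comment> \<open>The topology is given by a subbasis; eventual membership passes through finite
    intersections and unions by induction on how the open set is generated.\<close>
  have main: "T \<in> U \<Longrightarrow> \<forall>\<^sub>F i in F. S i \<in> U"
    if "generate_topology_on
      {{T \<in> bops K. cinner (T x) y \<in> U} | x y U. x \<in> K \<and> y \<in> K \<and> open U} U" for U
    using that
  proof induction
    case (Basis s)
    then obtain x y V where s: "s = {T \<in> bops K. cinner (T x) y \<in> V}" "x \<in> K" "y \<in> K" "open V" by blast
    have "\<forall>\<^sub>F i in F. cinner (S i x) y \<in> V"
      using topological_tendstoD[OF lim[OF s(2,3)] s(4)] Basis s(1) by blast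
    with ev show ?case
    proof eventually_elim
      case (elim i) then show ?case using AS s(1) by auto
    qed
  next
    case (UN \<U>)
    then obtain U where U: "U \<in> \<U>" "T \<in> U" by blast
    then have "\<forall>\<^sub>F i in F. S i \<in> U" using UN by blast
    then show ?case by (rule eventually_mono) (use U in blast)
  qed (auto intro: eventually_conj)
  have "openin (wot K) (bops K - A)" using A topspace_wot[OF K] by (simp add: closedin_def)
  then have "generate_topology_on
      {{T \<in> bops K. cinner (T x) y \<in> U} | x y U. x \<in> K \<and> y \<in> K \<and> open U} (bops K - A)"
    unfolding wot_def by (rule openin_topology_generated_by)
  from main[OF this] T \<open>T \<notin> A\<close> have "\<forall>\<^sub>F i in F. S i \<in> bops K - A" by blast
  with ev have "\<forall>\<^sub>F i in F. False" by eventually_elim blast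
  then show False using F by (simp add: trivial_limit_def)
qed

lemma subalgebraD:
  assumes "unital_subalgebra K A"
  shows "A \<subseteq> bops K" "(\<lambda>x\<in>K. x) \<in> A" "S \<in> A \<Longrightarrow> T \<in> A \<Longrightarrow> (\<lambda>x\<in>K. S x + T x) \<in> A"
    "T \<in> A \<Longrightarrow> (\<lambda>x\<in>K. c *\<^sub>C T x) \<in> A" "S \<in> A \<Longrightarrow> T \<in> A \<Longrightarrow> compose K S T \<in> A"
  using assms by (auto simp: unital_subalgebra_def)

subsection \<open>The symmetric Fock space\<close>

lemma closed_cspan:
  shows "csubspace (closed_cspan S)" "closed (closed_cspan S)" "S \<subseteq> closed_cspan S"
    "csubspace K \<Longrightarrow> closed K \<Longrightarrow> S \<subseteq> K \<Longrightarrow> closed_cspan S \<subseteq> K"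
proof -
  have "(\<lambda>K. csubspace K \<and> closed K) (closed_cspan S)"
    unfolding closed_cspan_def
    by (rule hull_in) (auto simp: csubspace_def intro!: closed_Inter)
  then show "csubspace (closed_cspan S)" "closed (closed_cspan S)" by auto
  show "S \<subseteq> closed_cspan S" unfolding closed_cspan_def by (rule hull_subset)
  show "csubspace K \<Longrightarrow> closed K \<Longrightarrow> S \<subseteq> K \<Longrightarrow> closed_cspan S \<subseteq> K"
    unfolding closed_cspan_def by (rule hull_minimal) auto
qed

lemma cinner_ell2_unit: "cinner x (ell2_unit i) = ell2_nth x i"
proof -
  have "cinner x (ell2_unit i) = infsum (\<lambda>j. ell2_nth x j * cnj (ell2_nth (ell2_unit i) j)) {i}"
    unfolding cinner_ell2_def by (rule infsum_cong_neutral) (auto simp: ell2_nth_unit)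
  then show ?thesis by (simp add: ell2_nth_unit)
qed

lemma ell2_eqI: "(\<And>i. ell2_nth x i = ell2_nth y i) \<Longrightarrow> x = y"
  by (simp add: ell2_nth_inject[symmetric] fun_eq_iff)

lemma ell2_bounded_linear_eqI:
  fixes S T :: "'i ell2 \<Rightarrow> 'h::chilbert_space"
  assumes S: "bounded_linear S" "\<And>c x. S (c *\<^sub>C x) = c *\<^sub>C S x"
    and T: "bounded_linear T" "\<And>c x. T (c *\<^sub>C x) = c *\<^sub>C T x"
    and eq: "\<And>i. S (ell2_unit i) = T (ell2_unit i)"
  shows "S x = T x"
proof -
  have "UNIV \<subseteq> {x. S x = T x}"
  proof (rule total_subset_closed_csubspace[where G = "range ell2_unit"])
    show "x = 0" if "\<And>g. g \<in> range ell2_unit \<Longrightarrow> cinner x g = 0" for x :: "'i ell2"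
      using that by (intro ell2_eqI) (simp add: cinner_ell2_unit[symmetric] zero_ell2.rep_eq)
    show "csubspace {x. S x = T x}"
      by (simp add: csubspace_def S(2) T(2) linear_0 linear_add bounded_linear.linear[OF S(1)]
          bounded_linear.linear[OF T(1)])
    show "closed {x. S x = T x}"
      by (intro closed_Collect_eq linear_continuous_on S T)
  qed (use eq in auto)
  then show ?thesis by auto
qed

text \<open>The orthogonal projection onto the span of the basis words with length in
  \<open>S\<close>. The set is arbitrary because the Fejer argument uses intervals of degrees
  besides single degrees and initial segments.\<close>

lift_definition deg_part :: "nat set \<Rightarrow> 'n list ell2 \<Rightarrow> 'n list ell2"
  is "\<lambda>S x \<alpha>. if length \<alpha> \<in> S then x \<alpha> else 0"
  by (rule summable_on_comparison_test) auto

lemma deg_part_deg_part: "deg_part S (deg_part S' x) = deg_part (S \<inter> S') x"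
  by transfer auto

lemma cinner_deg_part: "cinner (deg_part S x) y = cinner x (deg_part S y)"
  unfolding cinner_ell2_def by (rule infsum_cong) (simp add: deg_part.rep_eq)

lemma has_sum_finite_sum:
  fixes f :: "'b \<Rightarrow> 'c \<Rightarrow> 'd::topological_comm_monoid_add"
  assumes "\<And>a. a \<in> A \<Longrightarrow> (f a has_sum s a) X"
  shows "((\<lambda>x. \<Sum>a\<in>A. f a x) has_sum (\<Sum>a\<in>A. s a)) X"
  using assms by (induction A rule: infinite_finite_induct) (simp_all add: has_sum_0 has_sum_add)

text \<open>Each basis word is counted once for every \<open>S s\<close> that contains its length,
  hence at most \<open>N\<close> times. For the overlapping Fejer windows this plays the part of
  orthogonality.\<close>

lemma sum_norm_deg_part_le:
  assumes "\<And>n. card {s \<in> A. n \<in> S s} \<le> N" "finite A"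
  shows "(\<Sum>s\<in>A. (norm (deg_part (S s) x))\<^sup>2) \<le> real N * (norm x)\<^sup>2"
proof -
  let ?q = "\<lambda>\<alpha>. (cmod (ell2_nth x \<alpha>))\<^sup>2"
  have hs: "((\<lambda>\<alpha>. \<Sum>s\<in>A. (cmod (ell2_nth (deg_part (S s) x) \<alpha>))\<^sup>2) has_sum
      (\<Sum>s\<in>A. (norm (deg_part (S s) x))\<^sup>2)) UNIV"
    unfolding norm_ell2_square by (intro has_sum_finite_sum has_sum_infsum ell2_nth_summable)
  have "(\<Sum>s\<in>A. (norm (deg_part (S s) x))\<^sup>2)
      = (\<Sum>\<^sub>\<infinity>\<alpha>. \<Sum>s\<in>A. (cmod (ell2_nth (deg_part (S s) x) \<alpha>))\<^sup>2)"
    using infsumI[OF hs] by simp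
  also have "\<dots> \<le> (\<Sum>\<^sub>\<infinity>\<alpha>. real N * ?q \<alpha>)"
  proof (rule infsum_mono)
    show "(\<lambda>\<alpha>. \<Sum>s\<in>A. (cmod (ell2_nth (deg_part (S s) x) \<alpha>))\<^sup>2) summable_on UNIV"
      using hs by (rule has_sum_imp_summable)
    show "(\<lambda>\<alpha>. real N * ?q \<alpha>) summable_on UNIV"
      by (intro summable_on_cmult_right ell2_nth_summable)
    fix \<alpha>
    have "(\<Sum>s\<in>A. (cmod (ell2_nth (deg_part (S s) x) \<alpha>))\<^sup>2)
        = (\<Sum>s\<in>A. if length \<alpha> \<in> S s then ?q \<alpha> else 0)"
      by (intro sum.cong) (auto simp: deg_part.rep_eq)
    also have "\<dots> = real (card {s \<in> A. length \<alpha> \<in> S s}) * ?q \<alpha>"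
      using assms(2) by (simp add: sum.If_cases Int_def)
    also have "\<dots> \<le> real N * ?q \<alpha>"
      by (intro mult_right_mono) (use assms(1) in auto)
    finally show "(\<Sum>s\<in>A. (cmod (ell2_nth (deg_part (S s) x) \<alpha>))\<^sup>2) \<le> real N * ?q \<alpha>" .
  qed
  also have "\<dots> = real N * (norm x)\<^sup>2"
    unfolding norm_ell2_square by (rule infsum_cmult_right')
  finally show ?thesis .
qed

text \<open>The partial sums of the squared norm, taken by word length, are bounded by those of the
  truncations. A norm bound may thus be proved below a fixed degree, where only finitely many
  windows matter.\<close>

lemma norm_le_deg_partI:
  assumes "\<And>D. norm (deg_part {..<D} x) \<le> c"
  shows "norm (x :: 'n::finite list ell2) \<le> c"
proof -
  have c0: "0 \<le> c" using assms[of 0] norm_ge_zero order_trans by blast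
  have "(norm x)\<^sup>2 \<le> c\<^sup>2"
    unfolding norm_ell2_square
  proof (rule LIMSEQ_le_const2[OF infsum_words_limit[OF ell2_nth_summable]], intro exI allI impI)
    fix N
    have "(\<Sum>w | length w < N. (cmod (ell2_nth x w))\<^sup>2)
        = (\<Sum>w | length w < N. (cmod (ell2_nth (deg_part {..<N} x) w))\<^sup>2)"
      by (intro sum.cong) (auto simp: deg_part.rep_eq)
    also have "\<dots> \<le> (norm (deg_part {..<N} x))\<^sup>2" by (rule sum_le_norm_ell2) simp
    also have "\<dots> \<le> c\<^sup>2" by (intro power_mono assms) simp
    finally show "(\<Sum>w | length w < N. (cmod (ell2_nth x w))\<^sup>2) \<le> c\<^sup>2" .
  qed
  then show ?thesis using c0 by (rule power2_le_imp_le)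
qed

section \<open>The symmetric space in terms of coefficients\<close>

lemma csubspace_symm_space: "csubspace symm_space" and closed_symm_space: "closed symm_space"
  unfolding symm_space_def by (rule closed_cspan)+

lemma omega_in_symm_space: "omega k \<in> symm_space"
  unfolding symm_space_def by (rule subsetD[OF closed_cspan(3) rangeI])

lemma ell2_nth_omega:
  "ell2_nth (omega k) \<alpha> = (if count_list \<alpha> = k then 1 / of_nat (card (comm_words k)) else 0)"
proof -
  have "ell2_nth (omega k) \<alpha>
      = 1 / of_nat (card (comm_words k)) * (\<Sum>\<beta>\<in>comm_words k. if \<alpha> = \<beta> then 1 else 0)"
    unfolding omega_def scaleC_ell2.rep_eq ell2_nth_sum ell2_nth_unit by simp
  also have "(\<Sum>\<beta>\<in>comm_words k. if \<alpha> = \<beta> then 1 else (0::complex)) = (if \<alpha> \<in> comm_words k then 1 else 0)"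
    by (simp add: finite_comm_words)
  finally show ?thesis by (simp add: comm_words_eq)
qed

lemma cinner_omega:
  "cinner x (omega k) = (\<Sum>\<alpha>\<in>comm_words k. ell2_nth x \<alpha>) / of_nat (card (comm_words k))"
proof -
  have "cinner x (\<Sum>\<alpha>\<in>comm_words k. ell2_unit \<alpha>) = (\<Sum>\<alpha>\<in>comm_words k. ell2_nth x \<alpha>)"
    by (subst bounded_linear.linear[OF bounded_linear_cinner_right, THEN linear_sum])
      (simp add: cinner_ell2_unit)
  then show ?thesis unfolding omega_def cinner_scaleC_right by simp
qed

text \<open>The pairing of a coefficient-symmetric vector with \<open>omega k\<close> is an average
  of one repeated value, so such a vector vanishes if it is orthogonal to all
  \<open>omega k\<close>. Membership in a closed span thereby becomes a condition on
  coefficients.\<close>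

lemma symm_space_iff:
  "x \<in> symm_space \<longleftrightarrow> (\<forall>\<alpha> \<beta>. count_list \<alpha> = count_list \<beta> \<longrightarrow> ell2_nth x \<alpha> = ell2_nth x \<beta>)"
proof
  assume x: "x \<in> symm_space"
  show "\<forall>\<alpha> \<beta>. count_list \<alpha> = count_list \<beta> \<longrightarrow> ell2_nth x \<alpha> = ell2_nth x \<beta>"
  proof (intro allI impI)
    fix \<alpha> \<beta> :: "'a list" assume ab: "count_list \<alpha> = count_list \<beta>"
    have "symm_space \<subseteq> {x. cinner x (ell2_unit \<alpha>) = cinner x (ell2_unit \<beta>)}"
      unfolding symm_space_def
    proof (rule closed_cspan(4))
      show "closed {x. cinner x (ell2_unit \<alpha>) = cinner x (ell2_unit \<beta>)}"
        by (intro closed_Collect_eq linear_continuous_on bounded_linear_cinner_left)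
      show "csubspace {x. cinner x (ell2_unit \<alpha>) = cinner x (ell2_unit \<beta>)}"
        unfolding csubspace_def by (simp add: cinner_add_left cinner_scaleC_left)
    qed (auto simp: cinner_ell2_unit ell2_nth_omega ab)
    from subsetD[OF this x] show "ell2_nth x \<alpha> = ell2_nth x \<beta>" by (simp add: cinner_ell2_unit)
  qed
next
  assume x: "\<forall>\<alpha> \<beta>. count_list \<alpha> = count_list \<beta> \<longrightarrow> ell2_nth x \<alpha> = ell2_nth x \<beta>"
  let ?C = "{x. \<forall>\<alpha> \<beta>. count_list \<alpha> = count_list \<beta> \<longrightarrow> ell2_nth x \<alpha> = ell2_nth x \<beta>} :: 'a list ell2 set"
  have "?C \<subseteq> symm_space"
  proof (rule total_subset_closed_csubspace[where G = "range omega"])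
    show "csubspace ?C"
      unfolding csubspace_def
    proof (intro conjI ballI allI)
      show "x + y \<in> ?C" if "x \<in> ?C" "y \<in> ?C" for x y
      proof (intro CollectI allI impI)
        fix \<alpha> \<beta> :: "'a list" assume "count_list \<alpha> = count_list \<beta>"
        then have "ell2_nth x \<alpha> = ell2_nth x \<beta>" "ell2_nth y \<alpha> = ell2_nth y \<beta>" using that by blast+
        then show "ell2_nth (x + y) \<alpha> = ell2_nth (x + y) \<beta>" by (simp add: plus_ell2.rep_eq)
      qed
      show "c *\<^sub>C x \<in> ?C" if "x \<in> ?C" for c x
      proof (intro CollectI allI impI)
        fix \<alpha> \<beta> :: "'a list" assume "count_list \<alpha> = count_list \<beta>"
        then have "ell2_nth x \<alpha> = ell2_nth x \<beta>" using that by blast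
        then show "ell2_nth (c *\<^sub>C x) \<alpha> = ell2_nth (c *\<^sub>C x) \<beta>" by (simp add: scaleC_ell2.rep_eq)
      qed
    qed (simp add: zero_ell2.rep_eq)
    show "symm_space \<subseteq> ?C"
      unfolding symm_space_def
    proof (rule closed_cspan(4))
      show "csubspace ?C" by fact
      have "?C = (\<Inter>\<alpha>. \<Inter>\<beta>\<in>{\<beta>. count_list \<alpha> = count_list \<beta>}.
          {x. cinner x (ell2_unit \<alpha>) = cinner x (ell2_unit \<beta>)})"
        by (auto simp: cinner_ell2_unit)
      also have "closed \<dots>"
        by (intro closed_INT ballI closed_Collect_eq linear_continuous_on bounded_linear_cinner_left)
      finally show "closed ?C" .
    qed (auto simp: ell2_nth_omega)
    fix w assume w: "w \<in> ?C" "\<And>g. g \<in> range omega \<Longrightarrow> cinner w g = 0"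
    show "w = 0"
    proof (rule ell2_eqI)
      fix \<alpha> :: "'a list"
      let ?L = "comm_words (count_list \<alpha>)"
      have "\<alpha> \<in> ?L" by (simp add: comm_words_eq)
      then have card: "card ?L \<noteq> 0" using finite_comm_words[of "count_list \<alpha>"] by auto
      have "(\<Sum>\<beta>\<in>?L. ell2_nth w \<beta>) = (\<Sum>\<beta>\<in>?L. ell2_nth w \<alpha>)"
      proof (rule sum.cong[OF refl])
        fix \<beta> assume "\<beta> \<in> ?L"
        then have "count_list \<beta> = count_list \<alpha>" by (simp add: comm_words_eq)
        with w(1) show "ell2_nth w \<beta> = ell2_nth w \<alpha>" by blast
      qed
      moreover have "cinner w (omega (count_list \<alpha>)) = 0" by (rule w(2)[OF rangeI])
      ultimately have "ell2_nth w \<alpha> = 0" using card by (simp add: cinner_omega)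
      then show "ell2_nth w \<alpha> = ell2_nth 0 \<alpha>" by (simp add: zero_ell2.rep_eq)
    qed
  qed (auto simp: omega_in_symm_space closed_symm_space csubspace_symm_space)
  moreover have "x \<in> ?C" by (rule CollectI) (rule x)
  ultimately show "x \<in> symm_space" by (rule subsetD)
qed

lemmas symm_spaceD = symm_space_iff[THEN iffD1, rule_format]

lemma symm_spaceI:
  "(\<And>\<alpha> \<beta>. count_list \<alpha> = count_list \<beta> \<Longrightarrow> ell2_nth x \<alpha> = ell2_nth x \<beta>) \<Longrightarrow> x \<in> symm_space"
  by (rule symm_space_iff[THEN iffD2]) (intro allI impI)

lemma deg_part_in_symm_space:
  assumes "x \<in> symm_space"
  shows "deg_part S x \<in> symm_space"
proof (rule symm_spaceI)
  fix \<alpha> \<beta> :: "'a list" assume eq: "count_list \<alpha> = count_list \<beta>"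
  then have "length \<alpha> = length \<beta>" by (simp add: length_eq_sum_count)
  then show "ell2_nth (deg_part S x) \<alpha> = ell2_nth (deg_part S x) \<beta>"
    using symm_spaceD[OF assms eq] by (simp add: deg_part.rep_eq)
qed

lemma unit_in_symm_space: "ell2_unit [] \<in> symm_space"
proof -
  have "count_list \<alpha> = count_list [] \<Longrightarrow> \<alpha> = []" for \<alpha> :: "'a list"
    using length_eq_sum_count[of \<alpha>] by simp
  note nil = this
  show ?thesis
  proof (rule symm_spaceI)
    fix \<alpha> \<beta> :: "'a list" assume eq: "count_list \<alpha> = count_list \<beta>"
    then have "\<alpha> = [] \<longleftrightarrow> \<beta> = []" using nil[of \<alpha>] nil[of \<beta>] by metis
    then show "ell2_nth (ell2_unit []) \<alpha> = ell2_nth (ell2_unit []) \<beta>" by (simp add: ell2_nth_unit)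
  qed
qed

section \<open>Kernel vectors and homogeneous parts over the unit ball\<close>

definition cunit_ball :: "('n::finite \<Rightarrow> complex) set"
  where "cunit_ball = {z. (\<Sum>i\<in>UNIV. (cmod (z i))\<^sup>2) < 1}"

text \<open>This is \<open>Omega f l\<close> with f(l) replaced by an arbitrary point of the ball
  (see \<open>Omega_eq\<close>), which keeps \<open>f\<close> out of the analysis on the symmetric
  space. The value is unspecified where the family is not square-summable.\<close>

definition kernel_vec :: "('n::finite \<Rightarrow> complex) \<Rightarrow> 'n list ell2"
  where "kernel_vec z = Abs_ell2 (\<lambda>\<alpha>. prod_list (map (\<lambda>i. cnj (z i)) \<alpha>))"

lemma scale_cunit_ball:
  assumes "z \<in> cunit_ball" "cmod \<zeta> \<le> 1"
  shows "(\<lambda>i. \<zeta> * z i) \<in> cunit_ball"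
proof -
  have "(\<Sum>i\<in>UNIV. (cmod (\<zeta> * z i))\<^sup>2) \<le> (\<Sum>i\<in>UNIV. (cmod (z i))\<^sup>2)"
  proof (intro sum_mono power_mono)
    show "cmod (\<zeta> * z i) \<le> cmod (z i)" for i
      using mult_right_mono[OF assms(2), of "cmod (z i)"] by (simp add: norm_mult)
  qed simp
  then show ?thesis using assms(1) by (simp add: cunit_ball_def)
qed

lemma ell2_nth_kernel_vec:
  "z \<in> cunit_ball \<Longrightarrow> ell2_nth (kernel_vec z) \<alpha> = prod_list (map (\<lambda>i. cnj (z i)) \<alpha>)"
  unfolding kernel_vec_def by (simp add: Abs_ell2_inverse words_product_summable cunit_ball_def)

lemma kernel_vec_in_symm_space: "z \<in> cunit_ball \<Longrightarrow> kernel_vec z \<in> symm_space"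
  by (rule symm_spaceI) (simp add: ell2_nth_kernel_vec prod_list_map_count)

lemma cinner_kernel_vec:
  "z \<in> cunit_ball \<Longrightarrow> cinner x (kernel_vec z) = (\<Sum>\<^sub>\<infinity>\<alpha>. ell2_nth x \<alpha> * prod_list (map z \<alpha>))"
  by (simp add: cinner_ell2_def ell2_nth_kernel_vec cnj_prod_list_map)

lemma kernel_vec_summable:
  "z \<in> cunit_ball \<Longrightarrow> (\<lambda>\<alpha>. ell2_nth x \<alpha> * prod_list (map z \<alpha>)) summable_on UNIV"
  using ell2_prod_summable[of x "kernel_vec z"] by (simp add: ell2_nth_kernel_vec cnj_prod_list_map)

lemma cinner_unit_kernel_vec: "z \<in> cunit_ball \<Longrightarrow> cinner (ell2_unit \<alpha>) (kernel_vec z) = prod_list (map z \<alpha>)"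
  by (subst cinner_commute)
    (simp add: cinner_ell2_unit ell2_nth_kernel_vec cnj_prod_list_map)

text \<open>If \<open>x\<close> is read as the function z -> <x, \<open>kernel_vec z\<close>>, this
  is its homogeneous part of degree \<open>n\<close>, or the n-th Taylor coefficient of the slice
  \<zeta> -> x(\<zeta> z). Being a finite sum, it makes sense for every \<open>z\<close>, also
  outside the ball.\<close>

definition hcoef :: "nat \<Rightarrow> ('n::finite \<Rightarrow> complex) \<Rightarrow> 'n list ell2 \<Rightarrow> complex"
  where "hcoef n z x = (\<Sum>\<alpha> | length \<alpha> = n. ell2_nth x \<alpha> * prod_list (map z \<alpha>))"

lemma hcoef_scaleC: "hcoef n z (c *\<^sub>C x) = c * hcoef n z x"
  by (simp add: hcoef_def scaleC_ell2.rep_eq sum_distrib_left mult_ac)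

lemma hcoef_sum: "hcoef n z (sum g A) = (\<Sum>a\<in>A. hcoef n z (g a))"
  unfolding hcoef_def ell2_nth_sum sum_distrib_right by (rule sum.swap)

lemma hcoef_diff: "hcoef n z (x - y) = hcoef n z x - hcoef n z y"
  by (simp add: hcoef_def minus_ell2.rep_eq sum_subtractf left_diff_distrib)

lemma hcoef_deg_part: "hcoef n z (deg_part S x) = (if n \<in> S then hcoef n z x else 0)"
  by (simp add: hcoef_def deg_part.rep_eq)

lemma hcoef_mult: "hcoef n (\<lambda>i. c * z i) x = c ^ n * hcoef n z x"
proof -
  have "prod_list (map (\<lambda>i. c * z i) \<alpha>) = c ^ length \<alpha> * prod_list (map z \<alpha>)" for \<alpha>
    by (induction \<alpha>) auto
  then show ?thesis by (simp add: hcoef_def sum_distrib_left mult_ac)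
qed

lemma hcoef_sums:
  assumes "z \<in> cunit_ball" "cmod \<zeta> \<le> 1"
  shows "(\<lambda>n. hcoef n z x * \<zeta> ^ n) sums cinner x (kernel_vec (\<lambda>i. \<zeta> * z i))"
proof -
  note b = scale_cunit_ball[OF assms]
  have "(\<lambda>N. \<Sum>\<alpha> | length \<alpha> < N. ell2_nth x \<alpha> * prod_list (map (\<lambda>i. \<zeta> * z i) \<alpha>))
      \<longlonglongrightarrow> cinner x (kernel_vec (\<lambda>i. \<zeta> * z i))"
    unfolding cinner_kernel_vec[OF b] by (rule infsum_words_limit[OF kernel_vec_summable[OF b]])
  then show ?thesis
    unfolding sums_def sum_words_length_less hcoef_def[symmetric] hcoef_mult
    by (simp add: mult.commute)
qed

lemma fps_conv_radius_hcoef: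
  assumes "z \<in> cunit_ball"
  shows "fps_conv_radius (Abs_fps (\<lambda>n. hcoef n z x)) \<ge> 1"
  using conv_radius_geI[of "\<lambda>n. hcoef n z x" 1] hcoef_sums[OF assms, of 1 x]
  by (simp add: fps_conv_radius_def sums_iff one_ereal_def)

lemma eval_fps_hcoef:
  assumes "z \<in> cunit_ball" "cmod \<zeta> \<le> 1"
  shows "eval_fps (Abs_fps (\<lambda>n. hcoef n z x)) \<zeta> = cinner x (kernel_vec (\<lambda>i. \<zeta> * z i))"
  using hcoef_sums[OF assms] by (simp add: eval_fps_def sums_iff)

lemma cinner_deg_part_kernel_vec:
  assumes "z \<in> cunit_ball"
  shows "cinner x (deg_part {n} (kernel_vec z)) = hcoef n z x"
proof -
  have "(\<lambda>m. if m = n then hcoef m z x else 0) sums cinner (deg_part {n} x) (kernel_vec z)"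
    using hcoef_sums[OF assms, of 1 "deg_part {n} x"] by (simp add: hcoef_deg_part)
  from sums_unique2[OF this sums_single[of n "\<lambda>m. hcoef m z x"]] show ?thesis
    by (simp add: cinner_deg_part)
qed

lemma eventually_small_cmod: "\<forall>\<^sub>F \<zeta> in nhds 0. cmod \<zeta> < 1"
  using eventually_nhds_metric[of "\<lambda>\<zeta>. cmod \<zeta> < 1" 0] by (auto intro!: exI[of _ 1])

text \<open>On the slice through \<open>z\<close> all three functions are power series in one
  variable that converge in the unit disc; the identity theorem turns the product of values into the
  Cauchy product of coefficients.\<close>

lemma hcoef_Cauchy_product:
  assumes prod: "\<And>z. z \<in> cunit_ball \<Longrightarrow>
      cinner w (kernel_vec z) = cinner p (kernel_vec z) * cinner x (kernel_vec z)"
    and z: "z \<in> cunit_ball"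
  shows "hcoef n z w = (\<Sum>j\<le>n. hcoef j z p * hcoef (n - j) z x)"
proof -
  let ?F = "\<lambda>x. Abs_fps (\<lambda>n. hcoef n z x)"
  have pos: "0 < fps_conv_radius (?F x)" for x
    using fps_conv_radius_hcoef[OF z, of x] by (rule less_le_trans[rotated]) simp
  have "?F w = ?F p * ?F x"
  proof (rule eval_fps_eqD)
    show "fps_conv_radius (?F w) > 0" by (rule pos)
    show "fps_conv_radius (?F p * ?F x) > 0"
      by (rule less_le_trans[OF _ fps_conv_radius_mult]) (simp add: pos)
    show "\<forall>\<^sub>F \<zeta> in nhds 0. eval_fps (?F w) \<zeta> = eval_fps (?F p * ?F x) \<zeta>"
      using eventually_small_cmod
    proof eventually_elim
      case (elim \<zeta>)
      have "norm \<zeta> < fps_conv_radius (?F y)" for y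
        using elim by (intro less_le_trans[OF _ fps_conv_radius_hcoef[OF z]]) (simp add: one_ereal_def)
      then show ?case
        using elim scale_cunit_ball[OF z, of \<zeta>] by (simp add: eval_fps_mult eval_fps_hcoef[OF z] prod)
    qed
  qed
  then have "fps_nth (?F w) n = fps_nth (?F p * ?F x) n" by simp
  then show ?thesis by (simp add: fps_mult_nth atLeast0AtMost)
qed

text \<open>Doubling the i-th variable and subtracting \<open>2 ^ k0 i\<close> times the original
  relation removes the monomial \<open>k0\<close>, while \<open>k1\<close> survives with a nonzero
  factor if the two differ in the i-th exponent. Hence induction on the number of monomials.\<close>

lemma monomials_independent:
  fixes c :: "('n::finite \<Rightarrow> nat) \<Rightarrow> complex"
  assumes "finite F" "\<And>z. (\<Sum>k\<in>F. c k * (\<Prod>i\<in>UNIV. z i ^ k i)) = 0"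
  shows "\<forall>k\<in>F. c k = 0"
  using assms
proof (induction F arbitrary: c rule: finite_induct)
  case (insert k0 F)
  have F: "c k1 = 0" if k1: "k1 \<in> F" for k1
  proof -
    obtain i where i: "k1 i \<noteq> k0 i" using k1 insert.hyps by (metis ext)
    have "\<forall>k\<in>F. c k * (2 ^ k i - 2 ^ k0 i) = 0"
    proof (rule insert.IH)
      fix z :: "'n \<Rightarrow> complex"
      have pr: "(\<Prod>j\<in>UNIV. (z(i := 2 * z i)) j ^ k j) = 2 ^ k i * (\<Prod>j\<in>UNIV. z j ^ k j)" for k :: "'n \<Rightarrow> nat"
      proof -
        have "(\<Prod>j\<in>UNIV. (z(i := 2 * z i)) j ^ k j)
            = (\<Prod>j\<in>UNIV. (if j = i then 2 ^ k j else 1) * z j ^ k j)"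
          by (intro prod.cong) (auto simp: power_mult_distrib)
        then show ?thesis by (simp add: prod.distrib)
      qed
      have "(\<Sum>k\<in>insert k0 F. c k * (\<Prod>j\<in>UNIV. (z(i := 2 * z i)) j ^ k j))
          - 2 ^ k0 i * (\<Sum>k\<in>insert k0 F. c k * (\<Prod>j\<in>UNIV. z j ^ k j)) = 0"
        unfolding insert.prems by simp
      then show "(\<Sum>k\<in>F. c k * (2 ^ k i - 2 ^ k0 i) * (\<Prod>j\<in>UNIV. z j ^ k j)) = 0"
        unfolding pr using insert.hyps
        by (simp add: algebra_simps sum_subtractf sum_distrib_left)
    qed
    with k1 have "c k1 * (2 ^ k1 i - 2 ^ k0 i) = 0" by blast
    moreover have "(2::complex) ^ k1 i \<noteq> 2 ^ k0 i"
    proof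
      assume "(2::complex) ^ k1 i = 2 ^ k0 i"
      then have "cmod (2 ^ k1 i) = cmod (2 ^ k0 i)" by simp
      then show False using i by (simp add: norm_power)
    qed
    ultimately show ?thesis by simp
  qed
  have "(\<Sum>k\<in>F. c k) = 0" using F by simp
  then have "c k0 = 0" using insert.prems[of "\<lambda>_. 1"] insert.hyps by simp
  with F show ?case by simp
qed simp

text \<open>The homogeneous parts of the difference are polynomials that vanish on the ball, hence
  everywhere, so their coefficients grouped by letter counts are zero. Symmetry makes each group a
  positive multiple of a single coefficient.\<close>

lemma symm_space_eqI_hcoef:
  assumes x: "x \<in> symm_space" "y \<in> symm_space"
    and eq: "\<And>n z. z \<in> cunit_ball \<Longrightarrow> hcoef n z x = hcoef n z y"
  shows "x = y"
proof -
  define d where "d = x - y"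
  have d: "d \<in> symm_space" unfolding d_def by (intro csubspaceD(4)[OF csubspace_symm_space] x)
  have zero: "hcoef n z d = 0" for n z
  proof -
    define s where "s = (\<Sum>i\<in>UNIV. (cmod (z i))\<^sup>2)"
    have s: "0 \<le> s" by (simp add: s_def sum_nonneg)
    \<comment> \<open>Homogeneity allows any \<open>z\<close> to be scaled into the ball; the factor
      1 / (1 + s) achieves this because s < (1 + s)^2.\<close>
    define r where "r = 1 / (1 + s)"
    define t where "t = complex_of_real r"
    have t: "t \<noteq> 0" using s by (simp add: t_def r_def of_real_eq_0_iff del: of_real_divide)
    have "(\<Sum>i\<in>UNIV. (cmod (t * z i))\<^sup>2) = s * r\<^sup>2"
      unfolding mult.commute[of s]
      by (simp add: t_def norm_mult power_mult_distrib s_def sum_distrib_left)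
    also have "\<dots> = s / (1 + s)\<^sup>2" by (simp add: r_def power_divide)
    also have "\<dots> < 1"
    proof -
      have "s < (1 + s)\<^sup>2" using s by (simp add: power2_sum) (smt (verit) zero_le_power2)
      then show ?thesis using s by (simp add: divide_less_eq)
    qed
    finally have "hcoef n (\<lambda>i. t * z i) d = 0"
      unfolding d_def hcoef_diff by (subst eq) (auto simp: cunit_ball_def)
    then show ?thesis using t by (simp add: hcoef_mult)
  qed
  have "d = 0"
  proof (rule ell2_eqI)
    fix \<alpha> :: "'a list"
    let ?A = "{\<beta> :: 'a list. length \<beta> = length \<alpha>}"
    let ?c = "\<lambda>k. \<Sum>\<beta> | \<beta> \<in> ?A \<and> count_list \<beta> = k. ell2_nth d \<beta>"
    have "\<forall>k\<in>count_list ` ?A. ?c k = 0"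
    proof (rule monomials_independent)
      show "finite (count_list ` ?A)" by simp
      fix z :: "'a \<Rightarrow> complex"
      have "0 = (\<Sum>\<beta>\<in>?A. ell2_nth d \<beta> * prod_list (map z \<beta>))"
        using zero[of "length \<alpha>" z] by (simp add: hcoef_def)
      also have "\<dots> = (\<Sum>k\<in>count_list ` ?A. \<Sum>\<beta> | \<beta> \<in> ?A \<and> count_list \<beta> = k.
          ell2_nth d \<beta> * prod_list (map z \<beta>))"
        by (rule sum.image_gen) simp
      also have "\<dots> = (\<Sum>k\<in>count_list ` ?A. ?c k * (\<Prod>i\<in>UNIV. z i ^ k i))"
        unfolding sum_distrib_right by (intro sum.cong refl) (auto simp: prod_list_map_count)
      finally show "(\<Sum>k\<in>count_list ` ?A. ?c k * (\<Prod>i\<in>UNIV. z i ^ k i)) = 0" by simp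
    qed
    then have "?c (count_list \<alpha>) = 0" by auto
    also have "?c (count_list \<alpha>) = (\<Sum>\<beta> | \<beta> \<in> ?A \<and> count_list \<beta> = count_list \<alpha>. ell2_nth d \<alpha>)"
      by (intro sum.cong refl symm_spaceD[OF d]) simp
    finally have "of_nat (card {\<beta>. \<beta> \<in> ?A \<and> count_list \<beta> = count_list \<alpha>}) * ell2_nth d \<alpha> = 0"
      by simp
    moreover have "finite {\<beta>. \<beta> \<in> ?A \<and> count_list \<beta> = count_list \<alpha>}"
      by (rule finite_subset[of _ ?A]) auto
    then have "card {\<beta>. \<beta> \<in> ?A \<and> count_list \<beta> = count_list \<alpha>} \<noteq> 0" by auto
    ultimately show "ell2_nth d \<alpha> = ell2_nth 0 \<alpha>"
      unfolding mult_eq_0_iff of_nat_eq_0_iff zero_ell2.rep_eq by argo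
  qed
  then show ?thesis by (simp add: d_def)
qed

text \<open>Both \<open>x\<close> and \<open>y\<close> are presented as the product of the constant
  function 1 and \<open>y\<close>, so the Cauchy product gives the same expression for their
  homogeneous parts.\<close>

lemma symm_space_eqI:
  assumes x: "x \<in> symm_space" "y \<in> symm_space"
    and eq: "\<And>z. z \<in> cunit_ball \<Longrightarrow> cinner x (kernel_vec z) = cinner y (kernel_vec z)"
  shows "x = y"
proof (rule symm_space_eqI_hcoef[OF x])
  fix n and z :: "'a \<Rightarrow> complex" assume z: "z \<in> cunit_ball"
  have pr: "cinner x (kernel_vec z) = cinner (ell2_unit []) (kernel_vec z) * cinner y (kernel_vec z)"
    if "z \<in> cunit_ball" for z
    using eq[OF that] by (simp add: cinner_unit_kernel_vec[OF that])
  have pr': "cinner y (kernel_vec z) = cinner (ell2_unit []) (kernel_vec z) * cinner y (kernel_vec z)"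
    if "z \<in> cunit_ball" for z
    by (simp add: cinner_unit_kernel_vec[OF that])
  show "hcoef n z x = hcoef n z y"
    using hcoef_Cauchy_product[OF pr z, of n] hcoef_Cauchy_product[OF pr' z, of n] by simp
qed

subsection \<open>Multipliers of the symmetric Fock space\<close>

text \<open>The multiplication operators, described without a symbol: a zero of \<open>x\<close> at
  \<open>z\<close> persists. Violating this is a WOT-open condition, and satisfying it means leaving
  certain subspaces invariant. \<open>mult_ops_symbol\<close> recovers the symbol as the image of
  1.\<close>

definition mult_ops :: "('n::finite list ell2 \<Rightarrow> 'n list ell2) set"
  where "mult_ops = {T \<in> bops symm_space. \<forall>x\<in>symm_space. \<forall>z\<in>cunit_ball.
    cinner x (kernel_vec z) = 0 \<longrightarrow> cinner (T x) (kernel_vec z) = 0}"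

text \<open>Subtracting the constant x(z) from \<open>x\<close> gives a vector that vanishes at
  \<open>z\<close>, and so does its image.\<close>

lemma mult_ops_symbol:
  assumes T: "T \<in> mult_ops" and x: "x \<in> symm_space" and z: "z \<in> cunit_ball"
  shows "cinner (T x) (kernel_vec z) = cinner (T (ell2_unit [])) (kernel_vec z) * cinner x (kernel_vec z)"
proof -
  have Tb: "T \<in> bops symm_space" using T by (simp add: mult_ops_def)
  define c where "c = cinner x (kernel_vec z)"
  have u: "ell2_unit [] \<in> symm_space" by (rule unit_in_symm_space)
  have cu: "c *\<^sub>C ell2_unit [] \<in> symm_space" by (rule csubspaceD(3)[OF csubspace_symm_space u])
  have "x - c *\<^sub>C ell2_unit [] \<in> symm_space"
    by (rule csubspaceD(4)[OF csubspace_symm_space x cu])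
  moreover have "cinner (x - c *\<^sub>C ell2_unit []) (kernel_vec z) = 0"
    by (simp add: cinner_diff_left cinner_scaleC_left cinner_unit_kernel_vec[OF z] c_def)
  ultimately have "cinner (T (x - c *\<^sub>C ell2_unit [])) (kernel_vec z) = 0"
    using T z by (simp add: mult_ops_def)
  then have "cinner (T x) (kernel_vec z) - c * cinner (T (ell2_unit [])) (kernel_vec z) = 0"
    unfolding bops_diff[OF Tb csubspace_symm_space x cu] bopsD(3)[OF Tb u]
      cinner_diff_left cinner_scaleC_left .
  then show ?thesis by (simp add: c_def mult.commute)
qed

lemma mult_opsI:
  assumes "T \<in> bops symm_space"
    and "\<And>x z. x \<in> symm_space \<Longrightarrow> z \<in> cunit_ball \<Longrightarrow>
      cinner (T x) (kernel_vec z) = \<phi> z * cinner x (kernel_vec z)"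
  shows "T \<in> mult_ops"
  using assms by (simp add: mult_ops_def)

lemma bops_symm_spaceI:
  assumes "\<And>x. x \<in> symm_space \<Longrightarrow> T x \<in> symm_space"
    and "\<And>x y. x \<in> symm_space \<Longrightarrow> y \<in> symm_space \<Longrightarrow> T (x + y) = T x + T y"
    and "\<And>c x. x \<in> symm_space \<Longrightarrow> T (c *\<^sub>C x) = c *\<^sub>C T x"
    and "\<And>x. x \<in> symm_space \<Longrightarrow> norm (T x) \<le> B * norm x"
  shows "(\<lambda>x\<in>symm_space. T x) \<in> bops symm_space"
  using bops_restrictI[OF csubspace_symm_space] assms by blast

lemma mult_ops_unital_subalgebra:
  "unital_subalgebra symm_space (mult_ops :: ('n::finite list ell2 \<Rightarrow> 'n list ell2) set)"
proof -
  note K = csubspaceD[OF csubspace_symm_space]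
  have sub: "(mult_ops :: ('n list ell2 \<Rightarrow> 'n list ell2) set) \<subseteq> bops symm_space" by (auto simp: mult_ops_def)
  have sym: "\<exists>\<phi>. \<forall>x\<in>symm_space. \<forall>z\<in>cunit_ball.
      cinner (T x) (kernel_vec z) = \<phi> z * cinner x (kernel_vec z)" if "T \<in> mult_ops"
    for T :: "'n list ell2 \<Rightarrow> 'n list ell2"
    using mult_ops_symbol[OF that] by (intro exI[of _ "\<lambda>z. cinner (T (ell2_unit [])) (kernel_vec z)"]) simp
  show ?thesis
    unfolding unital_subalgebra_def
  proof (intro conjI ballI allI)
    show "(\<lambda>x\<in>symm_space. x) \<in> (mult_ops :: ('n list ell2 \<Rightarrow> 'n list ell2) set)"
    proof (rule mult_opsI)
      show "(\<lambda>x\<in>symm_space. x) \<in> bops (symm_space :: 'n list ell2 set)" by (rule bops_symm_spaceI[where B = 1]) auto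
      show "cinner ((\<lambda>x\<in>symm_space. x) x) (kernel_vec z) = 1 * cinner x (kernel_vec z)"
        if "x \<in> symm_space" for x :: "'n list ell2" and z using that by simp
    qed
  next
    fix S T :: "'n list ell2 \<Rightarrow> 'n list ell2" assume ST: "S \<in> mult_ops" "T \<in> mult_ops"
    then have b: "S \<in> bops symm_space" "T \<in> bops symm_space" using sub by auto
    obtain B where B: "B \<ge> 0" "\<And>x. x \<in> symm_space \<Longrightarrow> norm (S x) \<le> B * norm x"
      using bops_bound[OF b(1)] by metis
    obtain C where C: "C \<ge> 0" "\<And>x. x \<in> symm_space \<Longrightarrow> norm (T x) \<le> C * norm x"
      using bops_bound[OF b(2)] by metis
    obtain \<phi> where \<phi>: "\<And>x z. x \<in> symm_space \<Longrightarrow> z \<in> cunit_ball \<Longrightarrow>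
        cinner (S x) (kernel_vec z) = \<phi> z * cinner x (kernel_vec z)" using sym[OF ST(1)] by metis
    obtain \<psi> where \<psi>: "\<And>x z. x \<in> symm_space \<Longrightarrow> z \<in> cunit_ball \<Longrightarrow>
        cinner (T x) (kernel_vec z) = \<psi> z * cinner x (kernel_vec z)" using sym[OF ST(2)] by metis
    show "(\<lambda>x\<in>symm_space. S x + T x) \<in> mult_ops"
    proof (rule mult_opsI)
      show "(\<lambda>x\<in>symm_space. S x + T x) \<in> bops symm_space"
      proof (rule bops_symm_spaceI[where B = "B + C"])
        show "norm (S x + T x) \<le> (B + C) * norm x" if "x \<in> symm_space" for x
          using norm_triangle_mono[OF B(2)[OF that] C(2)[OF that]] by (simp add: algebra_simps)
      qed (simp_all add: bopsD[OF b(1)] bopsD[OF b(2)] K(2) scaleC_add_right)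
      show "cinner ((\<lambda>x\<in>symm_space. S x + T x) x) (kernel_vec z) = (\<phi> z + \<psi> z) * cinner x (kernel_vec z)"
        if "x \<in> symm_space" "z \<in> cunit_ball" for x z
        using that by (simp add: cinner_add_left \<phi> \<psi> algebra_simps)
    qed
    show "compose symm_space S T \<in> mult_ops"
    proof (rule mult_opsI)
      show "compose symm_space S T \<in> bops symm_space"
        unfolding compose_def
      proof (rule bops_symm_spaceI[where B = "B * C"])
        show "norm (S (T x)) \<le> B * C * norm x" if "x \<in> symm_space" for x
          using order_trans[OF B(2)[OF bopsD(1)[OF b(2) that]] mult_left_mono[OF C(2)[OF that] B(1)]]
          by (simp add: mult.assoc)
      qed (simp_all add: bopsD[OF b(1)] bopsD[OF b(2)])
      show "cinner (compose symm_space S T x) (kernel_vec z) = (\<phi> z * \<psi> z) * cinner x (kernel_vec z)"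
        if "x \<in> symm_space" "z \<in> cunit_ball" for x z
        using that by (simp add: compose_def \<phi>[OF bopsD(1)[OF b(2)]] \<psi>)
    qed
  next
    fix c and T :: "'n list ell2 \<Rightarrow> 'n list ell2" assume T: "T \<in> mult_ops"
    then have b: "T \<in> bops symm_space" using sub by auto
    obtain C where C: "C \<ge> 0" "\<And>x. x \<in> symm_space \<Longrightarrow> norm (T x) \<le> C * norm x"
      using bops_bound[OF b] by metis
    obtain \<psi> where \<psi>: "\<And>x z. x \<in> symm_space \<Longrightarrow> z \<in> cunit_ball \<Longrightarrow>
        cinner (T x) (kernel_vec z) = \<psi> z * cinner x (kernel_vec z)" using sym[OF T] by metis
    show "(\<lambda>x\<in>symm_space. c *\<^sub>C T x) \<in> mult_ops"
    proof (rule mult_opsI)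
      show "(\<lambda>x\<in>symm_space. c *\<^sub>C T x) \<in> bops symm_space"
      proof (rule bops_symm_spaceI[where B = "cmod c * C"])
        show "norm (c *\<^sub>C T x) \<le> cmod c * C * norm x" if "x \<in> symm_space" for x
          using mult_left_mono[OF C(2)[OF that], of "cmod c"] by (simp add: mult.assoc)
      qed (simp_all add: bopsD[OF b] K(3) scaleC_add_right scaleC_scaleC mult.commute)
      show "cinner ((\<lambda>x\<in>symm_space. c *\<^sub>C T x) x) (kernel_vec z) = (c * \<psi> z) * cinner x (kernel_vec z)"
        if "x \<in> symm_space" "z \<in> cunit_ball" for x z
        using that by (simp add: cinner_scaleC_left \<psi>)
    qed
  qed (rule sub)
qed

text \<open>An operator that fails the condition fails it at one \<open>x\<close> and one
  \<open>z\<close>, where a single matrix coefficient avoids 0.\<close>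

lemma mult_ops_wot_closed: "closedin (wot symm_space) mult_ops"
proof -
  let ?K = "symm_space :: 'a list ell2 set"
  have "bops ?K - mult_ops = (\<Union>x\<in>?K. \<Union>z\<in>{z\<in>cunit_ball. cinner x (kernel_vec z) = 0}.
      {T \<in> bops ?K. cinner (T x) (kernel_vec z) \<in> - {0}})"
    by (auto simp: mult_ops_def)
  also have "openin (wot ?K) \<dots>"
    by (auto intro!: openin_Union openin_wot_basic[where U = "- {0}", simplified] kernel_vec_in_symm_space)
  finally show ?thesis
    by (auto simp: closedin_def topspace_wot csubspace_symm_space mult_ops_def)
qed

lemma mult_ops_hcoef:
  assumes "T \<in> mult_ops" "x \<in> symm_space" "z \<in> cunit_ball"
  shows "hcoef n z (T x) = (\<Sum>j\<le>n. hcoef j z (T (ell2_unit [])) * hcoef (n - j) z x)"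
  by (rule hcoef_Cauchy_product[OF mult_ops_symbol[OF assms(1,2)] assms(3)])

text \<open>
  The Fejer weight \<open>(N - j) / N\<close> is the fraction of the windows \<open>{n. n < s \<le> n + N}\<close> that contain
  both the degree \<open>n\<close> and the degree \<open>n - j\<close>.  Hence the Fejer means of \<open>T\<close> are averages of the
  compressions of \<open>T\<close> to these windows, and their norms do not exceed that of \<open>T\<close>.
\<close>

lemma Fejer_mean_norm_le:
  fixes T R :: "'n::finite list ell2 \<Rightarrow> 'n list ell2"
  assumes T: "T \<in> mult_ops" and R: "R \<in> mult_ops" and N: "N > 0"
    and B: "\<And>x. x \<in> symm_space \<Longrightarrow> norm (T x) \<le> B * norm x" "B \<ge> 0"
    and weight: "\<And>z j. z \<in> cunit_ball \<Longrightarrow>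
      hcoef j z (R (ell2_unit [])) = of_nat (N - j) / of_nat N * hcoef j z (T (ell2_unit []))"
    and x: "x \<in> symm_space"
  shows "norm (R x) \<le> B * norm x"
proof (rule norm_le_deg_partI)
  fix D
  \<comment> \<open>The window of the \<open>N\<close> degrees s - N, ..., s - 1, cut off at
    0.\<close>
  define I where "I s = {n. n < s \<and> s \<le> n + N}" for s :: nat
  let ?P = "\<lambda>s. deg_part (I s) :: 'n list ell2 \<Rightarrow> _"
  let ?Q = "deg_part {..<D} :: 'n list ell2 \<Rightarrow> _"
  define u where "u = ?Q (R x)"
  have Tb: "T \<in> bops symm_space" and Rb: "R \<in> bops symm_space"
    using T R by (simp_all add: mult_ops_def)
  have Px: "?P s x \<in> symm_space" for s by (rule deg_part_in_symm_space[OF x])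
  \<comment> \<open>Only degrees below \<open>D\<close> matter, and a window that contains such a
    degree has s < D + N; the average over all windows is therefore a finite sum.\<close>
  have u_eq: "u = (1 / of_nat N) *\<^sub>C (\<Sum>s<D + N. ?Q (?P s (T (?P s x))))"
  proof (rule symm_space_eqI_hcoef)
    show "u \<in> symm_space" unfolding u_def
      by (intro deg_part_in_symm_space bopsD(1)[OF Rb] x)
    show "(1 / of_nat N) *\<^sub>C (\<Sum>s<D + N. ?Q (?P s (T (?P s x)))) \<in> symm_space"
      by (intro csubspaceD(3)[OF csubspace_symm_space] csubspace_sum[OF csubspace_symm_space]
          deg_part_in_symm_space bopsD(1)[OF Tb] Px)
    fix n and z :: "'n \<Rightarrow> complex" assume z: "z \<in> cunit_ball"
    let ?\<phi> = "\<lambda>j. hcoef j z (T (ell2_unit []))" and ?x = "\<lambda>j. hcoef j z x"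
    show "hcoef n z u = hcoef n z ((1 / of_nat N) *\<^sub>C (\<Sum>s<D + N. ?Q (?P s (T (?P s x)))))"
    proof (cases "n < D")
      case True
      have "(\<Sum>s<D + N. hcoef n z (?P s (T (?P s x))))
          = (\<Sum>s<D + N. \<Sum>j\<le>n. if n \<in> I s \<and> n - j \<in> I s then ?\<phi> j * ?x (n - j) else 0)"
      proof (rule sum.cong[OF refl])
        fix s
        have "hcoef n z (?P s (T (?P s x)))
            = (if n \<in> I s then \<Sum>j\<le>n. ?\<phi> j * hcoef (n - j) z (?P s x) else 0)"
          by (simp add: hcoef_deg_part mult_ops_hcoef[OF T Px z])
        then show "hcoef n z (?P s (T (?P s x)))
            = (\<Sum>j\<le>n. if n \<in> I s \<and> n - j \<in> I s then ?\<phi> j * ?x (n - j) else 0)"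
          by (auto simp: hcoef_deg_part intro!: sum.cong)
      qed
      also have "\<dots> = (\<Sum>j\<le>n. \<Sum>s<D + N. if n \<in> I s \<and> n - j \<in> I s then ?\<phi> j * ?x (n - j) else 0)"
        by (rule sum.swap)
      also have "\<dots> = (\<Sum>j\<le>n. of_nat (N - j) * (?\<phi> j * ?x (n - j)))"
      proof (rule sum.cong[OF refl])
        fix j assume j: "j \<in> {..n}"
        \<comment> \<open>Both degrees lie in the window exactly when n < s <= n - j + N. With
          truncated subtraction the count \<open>N - j\<close> is 0 for j >= N, as the weight
          is.\<close>
        have "{s. s < D + N \<and> n \<in> I s \<and> n - j \<in> I s} = {n<..n - j + N}"
          using True j by (auto simp: I_def)
        then have "card {s. s < D + N \<and> n \<in> I s \<and> n - j \<in> I s} = N - j" using j by simp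
        then show "(\<Sum>s<D + N. if n \<in> I s \<and> n - j \<in> I s then ?\<phi> j * ?x (n - j) else 0)
            = of_nat (N - j) * (?\<phi> j * ?x (n - j))"
          by (simp add: sum.If_cases Int_def)
      qed
      also have "\<dots> = of_nat N * hcoef n z (R x)"
        using N by (simp add: mult_ops_hcoef[OF R x z] weight[OF z] sum_distrib_left mult.assoc)
      finally show ?thesis
        using N True by (simp add: u_def hcoef_deg_part hcoef_scaleC hcoef_sum)
    qed (simp add: u_def hcoef_deg_part hcoef_scaleC hcoef_sum)
  qed
  have Qu: "?Q u = u" by (simp add: u_def deg_part_deg_part)
  have card: "card {s \<in> {..<D + N}. n \<in> I s} \<le> N" for n
  proof -
    have "card {s \<in> {..<D + N}. n \<in> I s} \<le> card {n<..n + N}"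
      by (rule card_mono) (auto simp: I_def)
    then show ?thesis by simp
  qed
  \<comment> \<open>Each degree lies in at most \<open>N\<close> windows; the factors sqrt N
    obtained here for \<open>x\<close> and for \<open>u\<close> together cancel the 1 / N of the
    average.\<close>
  have L2: "L2_set (\<lambda>s. norm (?P s y)) {..<D + N} \<le> sqrt N * norm y" for y
    unfolding L2_set_def
    using real_sqrt_le_mono[OF sum_norm_deg_part_le[of "{..<D + N}" I N y, OF card]]
    by (simp add: real_sqrt_mult)
  have "cinner u u = (1 / of_nat N) * (\<Sum>s<D + N. cinner (T (?P s x)) (?P s u))"
    by (subst u_eq) (simp add: cinner_scaleC_left cinner_sum_left cinner_deg_part Qu)
  then have "(norm u)\<^sup>2 = cmod ((1 / of_nat N) * (\<Sum>s<D + N. cinner (T (?P s x)) (?P s u)))"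
    by (metis abs_power2 cinner_self norm_of_real)
  also have "\<dots> = (1 / N) * cmod (\<Sum>s<D + N. cinner (T (?P s x)) (?P s u))"
    by (simp add: norm_mult norm_divide)
  also have "\<dots> \<le> (1 / N) * (\<Sum>s<D + N. B * (norm (?P s x) * norm (?P s u)))"
  proof (intro mult_left_mono order_trans[OF norm_sum] sum_mono)
    fix s
    have "cmod (cinner (T (?P s x)) (?P s u)) \<le> norm (T (?P s x)) * norm (?P s u)"
      by (rule cinner_Cauchy_Schwarz)
    also have "\<dots> \<le> (B * norm (?P s x)) * norm (?P s u)" by (intro mult_right_mono B(1) Px) simp
    finally show "cmod (cinner (T (?P s x)) (?P s u)) \<le> B * (norm (?P s x) * norm (?P s u))"
      by (simp add: mult.assoc)
  qed simp
  also have "(\<Sum>s<D + N. B * (norm (?P s x) * norm (?P s u)))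
      = B * (\<Sum>s<D + N. \<bar>norm (?P s x)\<bar> * \<bar>norm (?P s u)\<bar>)"
    by (simp add: sum_distrib_left)
  also have "(1 / real N) * \<dots> \<le> (1 / N) * (B * ((sqrt N * norm x) * (sqrt N * norm u)))"
    by (intro mult_left_mono B(2) order_trans[OF L2_set_mult_ineq] mult_mono L2) auto
  also have "\<dots> = B * norm x * norm u" using N by (simp add: field_simps flip: power2_eq_square)
  finally have "norm u * norm u \<le> B * norm x * norm u" by (simp add: power2_eq_square)
  moreover have "0 \<le> B * norm x" using B(2) by simp
  ultimately show "norm u \<le> B * norm x"
    by (cases "norm u = 0") (auto simp: mult_le_cancel_right)
qed

text \<open>The product over the empty word has to be the identity of the extensional operators.\<close>

primrec symm_word :: "('n::finite \<Rightarrow> 'n list ell2 \<Rightarrow> 'n list ell2) \<Rightarrow> 'n list \<Rightarrow> 'n list ell2 \<Rightarrow> 'n list ell2"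
  where
    "symm_word W [] = (\<lambda>x\<in>symm_space. x)"
  | "symm_word W (i # \<alpha>) = compose symm_space (W i) (symm_word W \<alpha>)"

lemma subalgebra_sum:
  assumes A: "unital_subalgebra K A" and K: "csubspace K"
    and "finite F" "\<And>a. a \<in> F \<Longrightarrow> S a \<in> A"
  shows "(\<lambda>x\<in>K. \<Sum>a\<in>F. c a *\<^sub>C S a x) \<in> A"
  using assms(3,4)
proof (induction F rule: finite_induct)
  case empty
  have "(\<lambda>x\<in>K. 0 *\<^sub>C (\<lambda>x\<in>K. x) x) \<in> A" by (intro subalgebraD(2,4)[OF A])
  also have "(\<lambda>x\<in>K. 0 *\<^sub>C (\<lambda>x\<in>K. x) x) = (\<lambda>x\<in>K. \<Sum>a\<in>{}. c a *\<^sub>C S a x)" by auto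
  finally show ?case .
next
  case (insert b F)
  have "(\<lambda>x\<in>K. (\<lambda>x\<in>K. c b *\<^sub>C S b x) x + (\<lambda>x\<in>K. \<Sum>a\<in>F. c a *\<^sub>C S a x) x) \<in> A"
    by (intro subalgebraD(3,4)[OF A] insert.IH insert.prems) auto
  also have "(\<lambda>x\<in>K. (\<lambda>x\<in>K. c b *\<^sub>C S b x) x + (\<lambda>x\<in>K. \<Sum>a\<in>F. c a *\<^sub>C S a x) x)
      = (\<lambda>x\<in>K. \<Sum>a\<in>insert b F. c a *\<^sub>C S a x)"
    using insert.hyps by (intro restrict_ext) simp
  finally show ?case .
qed

lemma mult_ops_subset_algebra:
  fixes W :: "'n::finite \<Rightarrow> 'n list ell2 \<Rightarrow> 'n list ell2"
  assumes A: "unital_subalgebra symm_space A" "closedin (wot symm_space) A"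
    and W: "\<And>j. W j \<in> A"
    and Wz: "\<And>j x z. x \<in> symm_space \<Longrightarrow> z \<in> cunit_ball \<Longrightarrow>
      cinner (W j x) (kernel_vec z) = z j * cinner x (kernel_vec z)"
  shows "mult_ops \<subseteq> A"
proof
  fix T :: "'n list ell2 \<Rightarrow> 'n list ell2" assume T: "T \<in> mult_ops"
  have Tb: "T \<in> bops symm_space" using T by (simp add: mult_ops_def)
  note K = csubspace_symm_space
  define p where "p = T (ell2_unit [])"
  have p: "p \<in> symm_space" unfolding p_def by (rule bopsD(1)[OF Tb unit_in_symm_space])
  have WA: "symm_word W \<alpha> \<in> A" for \<alpha>
  proof (induction \<alpha>)
    case Nil show ?case unfolding symm_word.simps by (rule subalgebraD(2)[OF A(1)])
  next
    case (Cons i \<alpha>) show ?case unfolding symm_word.simps by (rule subalgebraD(5)[OF A(1) W Cons])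
  qed
  have Wb: "symm_word W \<alpha> \<in> bops symm_space" for \<alpha> using WA subalgebraD(1)[OF A(1)] by auto
  have Ww: "cinner (symm_word W \<alpha> x) (kernel_vec z) = prod_list (map z \<alpha>) * cinner x (kernel_vec z)"
    if "x \<in> symm_space" "z \<in> cunit_ball" for \<alpha> x z
    by (induction \<alpha>) (simp_all add: that compose_def Wz[OF bopsD(1)[OF Wb that(1)] that(2)])
  \<comment> \<open>The Fejer mean of order \<open>Suc N\<close>, so that the division is meaningful
    for every \<open>N\<close>; the coefficients are those of the symbol T 1, taken word by
    word.\<close>
  define R where "R N = (\<lambda>x\<in>symm_space. \<Sum>\<alpha> | length \<alpha> < Suc N.
      (of_nat (Suc N - length \<alpha>) / of_nat (Suc N) * ell2_nth p \<alpha>) *\<^sub>C symm_word W \<alpha> x)" for N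
  have RA: "R N \<in> A" for N unfolding R_def by (intro subalgebra_sum[OF A(1) K] WA) simp
  have Rb: "R N \<in> bops symm_space" for N using RA subalgebraD(1)[OF A(1)] by auto
  have Rz: "cinner (R N x) (kernel_vec z) = (\<Sum>\<alpha> | length \<alpha> < Suc N.
      of_nat (Suc N - length \<alpha>) / of_nat (Suc N) * ell2_nth p \<alpha> * prod_list (map z \<alpha>))
      * cinner x (kernel_vec z)"
    if "x \<in> symm_space" "z \<in> cunit_ball" for N x z
    using that by (simp add: R_def cinner_sum_left cinner_scaleC_left Ww sum_distrib_right mult.assoc)
  have Rm: "R N \<in> mult_ops" for N by (rule mult_opsI[OF Rb Rz])
  have R1: "hcoef j z (R N (ell2_unit [])) = of_nat (Suc N - j) / of_nat (Suc N) * hcoef j z p"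
    if z: "z \<in> cunit_ball" for N z j
  proof -
    define \<rho> where "\<rho> = (\<Sum>k<Suc N. (of_nat (Suc N - k) / of_nat (Suc N)) *\<^sub>C deg_part {k} p)"
    have \<rho>: "\<rho> \<in> symm_space" unfolding \<rho>_def
      by (intro csubspace_sum[OF K] csubspaceD(3)[OF K] deg_part_in_symm_space p)
    \<comment> \<open>The words in \<open>W\<close> send 1 to symmetric vectors, which in general
      are not basis vectors, so the image of 1 is identified through its pairings with kernel
      vectors.\<close>
    have "R N (ell2_unit []) = \<rho>"
    proof (rule symm_space_eqI[OF bopsD(1)[OF Rb unit_in_symm_space] \<rho>])
      fix z :: "'n \<Rightarrow> complex" assume z: "z \<in> cunit_ball"
      have "cinner \<rho> (kernel_vec z) = (\<Sum>k<Suc N. of_nat (Suc N - k) / of_nat (Suc N) * hcoef k z p)"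
        by (simp add: \<rho>_def cinner_sum_left cinner_scaleC_left cinner_deg_part
            cinner_deg_part_kernel_vec[OF z] del: sum.lessThan_Suc)
      also have "\<dots> = (\<Sum>k<Suc N. \<Sum>\<alpha> | length \<alpha> = k.
          of_nat (Suc N - length \<alpha>) / of_nat (Suc N) * ell2_nth p \<alpha> * prod_list (map z \<alpha>))"
        unfolding hcoef_def sum_distrib_left by (intro sum.cong refl) (auto simp: mult.assoc)
      finally show "cinner (R N (ell2_unit [])) (kernel_vec z) = cinner \<rho> (kernel_vec z)"
        unfolding Rz[OF unit_in_symm_space z] sum_words_length_less
        by (simp add: cinner_unit_kernel_vec[OF z] del: sum.lessThan_Suc)
    qed
    then show ?thesis
      by (simp add: \<rho>_def hcoef_sum hcoef_scaleC hcoef_deg_part if_distrib[of "(*) _"] del: sum.lessThan_Suc cong: if_cong)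
  qed
  obtain B where B: "B \<ge> 0" "\<And>x. x \<in> symm_space \<Longrightarrow> norm (T x) \<le> B * norm x"
    using bops_bound[OF Tb] by metis
  have bound: "norm (R N x) \<le> B * norm x" if "x \<in> symm_space" for N x
    by (rule Fejer_mean_norm_le[OF T Rm _ B(2,1) _ that, where N = "Suc N"])
      (auto simp: R1 p_def simp del: of_nat_Suc)
  \<comment> \<open>Against the homogeneous part of a kernel vector, \<open>R N x\<close> pairs to a
    finite Cauchy sum in which every weight tends to 1; the kernel vectors themselves would give
    infinite sums.\<close>
  let ?G = "{deg_part {n} (kernel_vec z) | n z. z \<in> cunit_ball} :: 'n list ell2 set"
  show "T \<in> A"
  proof (rule wot_closed_limit[OF K A(2) Tb, where F = sequentially and S = R])
    fix x y :: "'n list ell2" assume x: "x \<in> symm_space" and y: "y \<in> symm_space"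
    show "(\<lambda>N. cinner (R N x) y) \<longlonglongrightarrow> cinner (T x) y"
    proof (rule weakly_tendstoI[OF K closed_symm_space, where G = ?G and c = "B * norm x"])
      show "?G \<subseteq> symm_space" by (auto intro: deg_part_in_symm_space kernel_vec_in_symm_space)
      show "norm (R N x) \<le> B * norm x" for N by (rule bound[OF x])
      show "y \<in> symm_space" by (rule y)
      fix g assume "g \<in> ?G"
      then obtain n z where g: "g = deg_part {n} (kernel_vec z)" and z: "z \<in> cunit_ball" by blast
      have "(\<lambda>N. 1 - of_nat j / of_nat (Suc N)) \<longlonglongrightarrow> 1 - (0::complex)" for j
        by (intro tendsto_intros LIMSEQ_Suc[OF lim_const_over_n])
      then have lim: "(\<lambda>N. of_nat (Suc N - j) / of_nat (Suc N)) \<longlonglongrightarrow> (1::complex)" for j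
      proof (rule Lim_transform_eventually[where f = "\<lambda>N. 1 - of_nat j / of_nat (Suc N)", OF _ eventually_sequentiallyI[of j], THEN tendsto_eq_rhs])
        show "1 - of_nat j / of_nat (Suc N) = (of_nat (Suc N - j) / of_nat (Suc N) :: complex)"
          if "j \<le> N" for N
          using that by (simp add: of_nat_diff diff_divide_distrib del: of_nat_Suc)
      qed simp
      have "(\<lambda>N. \<Sum>j\<le>n. of_nat (Suc N - j) / of_nat (Suc N) * hcoef j z p * hcoef (n - j) z x)
          \<longlonglongrightarrow> (\<Sum>j\<le>n. 1 * hcoef j z p * hcoef (n - j) z x)"
        by (intro tendsto_intros lim)
      then show "(\<lambda>N. cinner (R N x) g) \<longlonglongrightarrow> cinner (T x) g"
        unfolding g cinner_deg_part_kernel_vec[OF z] mult_ops_hcoef[OF Rm x z] mult_ops_hcoef[OF T x z]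
          R1[OF z] p_def[symmetric] by simp
    next
      fix w :: "'n list ell2" assume w: "w \<in> symm_space" "\<And>g. g \<in> ?G \<Longrightarrow> cinner w g = 0"
      show "w = 0"
      proof (rule symm_space_eqI_hcoef[OF w(1) csubspaceD(1)[OF K]])
        show "hcoef n z w = hcoef n z 0" if "z \<in> cunit_ball" for n z
          using w(2)[of "deg_part {n} (kernel_vec z)"] that
          by (auto simp: cinner_deg_part_kernel_vec hcoef_def zero_ell2.rep_eq)
      qed
    qed
  qed (auto simp: RA)
qed

text \<open>
  Pairings of \<open>T x\<close> with kernel vectors depend continuously on \<open>x\<close>, so the sublevel sets of
  \<open>norm (T x)\<close> are closed, and Baire's theorem gives boundedness.
\<close>

lemma mult_op_bounded:
  fixes T :: "'n::finite list ell2 \<Rightarrow> 'n list ell2"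
  assumes T: "\<And>x. x \<in> symm_space \<Longrightarrow> T x \<in> symm_space"
    and Tz: "\<And>x z. x \<in> symm_space \<Longrightarrow> z \<in> cunit_ball \<Longrightarrow>
      cinner (T x) (kernel_vec z) = \<phi> z * cinner x (kernel_vec z)"
  shows "(\<lambda>x\<in>symm_space. T x) \<in> mult_ops"
proof (rule mult_opsI)
  note K = csubspace_symm_space
  let ?K = "symm_space :: 'n list ell2 set"
  \<comment> \<open>Linearity is not among the assumptions on \<open>T\<close>; it holds after
    pairing with kernel vectors, and these separate \<open>symm_space\<close>.\<close>
  have add: "T (x + y) = T x + T y" if "x \<in> ?K" "y \<in> ?K" for x y
    by (rule symm_space_eqI)
      (use that in \<open>simp_all add: csubspaceD(2)[OF K] T cinner_add_left Tz algebra_simps\<close>)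
  have scale: "T (c *\<^sub>C x) = c *\<^sub>C T x" if "x \<in> ?K" for c x
    by (rule symm_space_eqI)
      (use that in \<open>simp_all add: csubspaceD(3)[OF K] T cinner_scaleC_left Tz\<close>)
  define C where "C n = {x \<in> ?K. norm (T x) \<le> real n}" for n
  have C_closed: "closed (C n)" for n
    unfolding closed_sequential_limits
  proof safe
    fix x l assume xC: "\<forall>i. x i \<in> C n" and l: "x \<longlonglongrightarrow> l"
    have x: "x i \<in> ?K" "norm (T (x i)) \<le> n" for i using xC by (auto simp: C_def)
    have lK: "l \<in> ?K" using closed_sequentially[OF closed_symm_space _ l] x by blast
    have "norm (T l) \<le> n"
    proof (rule norm_weak_limit_le[where w = "\<lambda>i. T (x i)" and F = sequentially])
      show "(\<lambda>i. cinner (T (x i)) (T l)) \<longlonglongrightarrow> cinner (T l) (T l)"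
      proof (rule weakly_tendstoI[OF K closed_symm_space, where G = "kernel_vec ` cunit_ball"])
        show "norm (T (x i)) \<le> n" for i by (rule x)
        show "T l \<in> ?K" by (rule T[OF lK])
        show "kernel_vec ` cunit_ball \<subseteq> ?K" by (auto intro: kernel_vec_in_symm_space)
        fix g :: "'n list ell2" assume "g \<in> kernel_vec ` cunit_ball"
        then obtain z where g: "g = kernel_vec z" and z: "z \<in> cunit_ball" by blast
        show "(\<lambda>i. cinner (T (x i)) g) \<longlonglongrightarrow> cinner (T l) g"
          unfolding g Tz[OF x(1) z] Tz[OF lK z] by (intro tendsto_intros l)
      next
        fix w assume w: "w \<in> ?K" "\<And>g. g \<in> kernel_vec ` cunit_ball \<Longrightarrow> cinner w g = 0"
        show "w = 0" by (rule symm_space_eqI[OF w(1) csubspaceD(1)[OF K]]) (simp add: w(2))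
      qed
    qed (use x in auto)
    then show "l \<in> C n" using lK by (simp add: C_def)
  qed
  have "\<exists>n. top_of_set ?K interior_of (C n) \<noteq> {}"
  proof (rule ccontr)
    assume "\<not> ?thesis"
    moreover have "closedin (top_of_set ?K) (C n)" for n
      by (rule closed_subset[OF _ C_closed]) (auto simp: C_def)
    moreover have "completely_metrizable_space (top_of_set ?K)"
      by (rule completely_metrizable_space_closedin[OF completely_metrizable_space_euclidean])
        (simp add: closed_symm_space)
    ultimately have "top_of_set ?K interior_of \<Union>(range C) = {}"
      by (intro Baire_category_alt) auto
    moreover have "\<Union>(range C) = ?K" unfolding C_def using real_arch_simple by blast
    ultimately have "?K = {}" using interior_of_topspace[of "top_of_set ?K"] by simp
    then show False using csubspaceD(1)[OF K] by blast
  qed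
  then obtain n x0 where "x0 \<in> top_of_set ?K interior_of (C n)" by blast
  then obtain U where U: "openin (top_of_set ?K) U" "x0 \<in> U" "U \<subseteq> C n"
    by (auto simp: interior_of_def)
  then obtain e where e: "e > 0" "ball x0 e \<inter> ?K \<subseteq> U" and x0: "x0 \<in> ?K"
    by (meson openin_contains_ball openin_imp_subset subsetD)
  \<comment> \<open>Both \<open>x0\<close> and \<open>x0 + h\<close> lie in the sublevel set, and
    \<open>h\<close> is their difference.\<close>
  have small: "norm (T h) \<le> 2 * n" if h: "h \<in> ?K" "norm h < e" for h
  proof -
    have "x0 + h \<in> ball x0 e \<inter> ?K"
      using h x0 csubspaceD(2)[OF K] by (simp add: dist_norm)
    then have "norm (T (x0 + h)) \<le> n" using e U(3) unfolding C_def by blast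
    moreover have "norm (T x0) \<le> n" using U unfolding C_def by blast
    moreover have "T h = T (x0 + h) - T x0" using add[OF x0 h(1)] by simp
    ultimately show ?thesis using norm_triangle_ineq4[of "T (x0 + h)" "T x0"] by simp
  qed
  show "(\<lambda>x\<in>?K. T x) \<in> bops ?K"
  proof (rule bops_symm_spaceI[OF T add scale, where B = "4 * n / e"])
    fix y assume y: "y \<in> ?K"
    show "norm (T y) \<le> 4 * n / e * norm y"
    proof (cases "y = 0")
      case True
      then show ?thesis using scale[OF y, of 0] by simp
    next
      case False
      \<comment> \<open>Rescales \<open>y\<close> to norm e / 2, inside the ball where |T h| <= 2 n;
        this is the origin of the bound 4 n / e.\<close>
      let ?c = "complex_of_real (e / (2 * norm y))"
      have c: "cmod ?c = e / (2 * norm y)" using e(1) by (simp del: of_real_divide)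
      have "norm (?c *\<^sub>C y) < e" unfolding norm_scaleC c using e(1) False by simp
      from small[OF csubspaceD(3)[OF K y] this] have "e / (2 * norm y) * norm (T y) \<le> 2 * n"
        unfolding scale[OF y] norm_scaleC c .
      then show ?thesis using e(1) False by (simp add: field_simps)
    qed
  qed
  show "cinner ((\<lambda>x\<in>?K. T x) x) (kernel_vec z) = \<phi> z * cinner x (kernel_vec z)"
    if "x \<in> ?K" "z \<in> cunit_ball" for x z using that by (simp add: Tz)
qed

subsection \<open>Evaluation of power series\<close>

lemma bops_UNIV_id: "id \<in> bops (UNIV :: 'h::chilbert_space set)"
  by (rule bops_UNIV_I) (simp_all add: id_def)

lemma bops_UNIV_comp:
  assumes "S \<in> bops (UNIV :: 'h::chilbert_space set)" "T \<in> bops UNIV"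
  shows "S \<circ> T \<in> bops UNIV"
  using bounded_linear_compose[OF assms[THEN bops_UNIV_bounded_linear]]
  by (intro bops_UNIV_I) (simp_all add: comp_def bopsD(3)[OF assms(1)] bopsD(3)[OF assms(2)])

lemma bops_UNIV_add:
  assumes "S \<in> bops (UNIV :: 'h::chilbert_space set)" "T \<in> bops UNIV"
  shows "(\<lambda>x. S x + T x) \<in> bops UNIV"
  using bounded_linear_add[OF assms[THEN bops_UNIV_bounded_linear]]
  by (intro bops_UNIV_I)
    (simp_all add: bopsD(3)[OF assms(1)] bopsD(3)[OF assms(2)] scaleC_add_right)

lemma bops_UNIV_scaleC:
  assumes "T \<in> bops (UNIV :: 'h::chilbert_space set)"
  shows "(\<lambda>x. c *\<^sub>C T x) \<in> bops UNIV"
  using bounded_linear_compose[OF bounded_linear_scaleC bops_UNIV_bounded_linear[OF assms]]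
  by (intro bops_UNIV_I) (simp_all add: bopsD(3)[OF assms] scaleC_scaleC mult.commute)

lemma bops_UNIV_scaleR:
  assumes "T \<in> bops (UNIV :: 'h::chilbert_space set)"
  shows "(\<lambda>x. r *\<^sub>R T x) \<in> bops UNIV"
  using bops_UNIV_scaleC[OF assms, of "complex_of_real r"] by (simp add: scaleC_of_real)

lemma bops_UNIV_zero: "(\<lambda>x. 0) \<in> bops (UNIV :: 'h::chilbert_space set)"
  by (rule bops_UNIV_I) simp_all

lemma word_op_bops: "X \<in> optuples \<Longrightarrow> word_op X \<alpha> \<in> bops UNIV"
  by (induction \<alpha>) (auto simp: bops_UNIV_id optuples_def intro: bops_UNIV_comp)

lemma partial_sum_eq:
  "partial_sum p X N h = (\<Sum>\<alpha> | length \<alpha> < N. p \<alpha> *\<^sub>C word_op X \<alpha> h)"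
  unfolding partial_sum_def by (rule sum_words_length_less[symmetric])

lemma partial_sum_bops:
  assumes "X \<in> optuples"
  shows "partial_sum p X N \<in> bops UNIV"
proof -
  have "(\<lambda>h. \<Sum>\<alpha>\<in>A. p \<alpha> *\<^sub>C word_op X \<alpha> h) \<in> bops UNIV" if "finite A" for A
    using that by (induction A rule: finite_induct)
      (simp_all add: bops_UNIV_zero bops_UNIV_add bops_UNIV_scaleC word_op_bops assms)
  then show ?thesis unfolding partial_sum_eq[abs_def] by simp
qed

lemma norm_sums_tendsto:
  assumes "norm_sums p X Y" "X \<in> optuples"
  shows "(\<lambda>N. partial_sum p X N h) \<longlonglongrightarrow> Y h"
proof -
  have Y: "Y \<in> bops UNIV" and lim: "(\<lambda>N. onorm (\<lambda>h. partial_sum p X N h - Y h)) \<longlonglongrightarrow> 0"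
    using assms(1) by (auto simp: norm_sums_def)
  have "(\<lambda>N. partial_sum p X N h - Y h) \<longlonglongrightarrow> 0"
  proof (rule Lim_null_comparison)
    show "(\<lambda>N. onorm (\<lambda>h. partial_sum p X N h - Y h) * norm h) \<longlonglongrightarrow> 0"
      using tendsto_mult_right[OF lim, of "norm h"] by simp
    show "\<forall>\<^sub>F N in sequentially. norm (partial_sum p X N h - Y h)
        \<le> onorm (\<lambda>h. partial_sum p X N h - Y h) * norm h"
      using onorm[OF bounded_linear_sub[OF bops_UNIV_bounded_linear[OF partial_sum_bops[OF assms(2)]]
          bops_UNIV_bounded_linear[OF Y]]] by (intro always_eventually allI)
  qed
  then show ?thesis by (simp add: LIM_zero_iff)
qed

lemma nc_eval_eq:
  assumes "norm_sums p X Y" "X \<in> optuples"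
  shows "nc_eval p X = Y"
  unfolding nc_eval_def
proof (rule the_equality[where P = "norm_sums p X", OF assms(1)])
  fix Y' assume "norm_sums p X Y'"
  then show "Y' = Y"
    by (intro ext LIMSEQ_unique[OF norm_sums_tendsto[OF _ assms(2)] norm_sums_tendsto[OF assms]])
qed

text \<open>The hypothesis says that \<open>k\<close> is a joint eigenvector of the adjoints.\<close>

lemma cinner_word_op:
  assumes "\<And>i x. cinner (X i x) k = l i * cinner x k"
  shows "cinner (word_op X \<alpha> x) k = prod_list (map l \<alpha>) * cinner x k"
  by (induction \<alpha>) (simp_all add: assms)

lemma cinner_partial_sum:
  assumes "\<And>i x. cinner (X i x) k = l i * cinner x k"
  shows "cinner (partial_sum p X N x) k
    = (\<Sum>\<alpha> | length \<alpha> < N. p \<alpha> * prod_list (map l \<alpha>)) * cinner x k"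
  by (simp add: partial_sum_eq cinner_sum_left cinner_scaleC_left cinner_word_op[OF assms]
      sum_distrib_right mult.assoc)

section \<open>Scalar tuples as operators on the one-dimensional space\<close>

lemma bops_times: "(\<lambda>z. c * z) \<in> bops (UNIV :: complex set)"
  by (rule bops_UNIV_I) (simp_all add: scaleC_complex_def bounded_linear_mult_right)

lemma scalar_ops_optuples: "scalar_ops l \<in> optuples"
  by (simp add: optuples_def scalar_ops_def bops_times)

lemma scaleR_scalar_ops: "(\<lambda>i h. r *\<^sub>R scalar_ops l i h) = scalar_ops (\<lambda>i. complex_of_real r * l i)"
  by (simp add: scalar_ops_def scaleR_conv_of_real mult.assoc fun_eq_iff)

lemma partial_sum_scalar_ops:
  "partial_sum p (scalar_ops l) N h = (\<Sum>\<alpha> | length \<alpha> < N. p \<alpha> * prod_list (map l \<alpha>)) * h"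
proof -
  have "word_op (scalar_ops l) \<alpha> h = prod_list (map l \<alpha>) * h" for \<alpha>
    by (induction \<alpha>) (simp_all add: scalar_ops_def)
  then show ?thesis by (simp add: partial_sum_eq scaleC_complex_def sum_distrib_right mult.assoc)
qed

lemma sot_sums_scalar_opsI:
  assumes "(\<lambda>N. \<Sum>\<alpha> | length \<alpha> < N. p \<alpha> * prod_list (map l \<alpha>)) \<longlonglongrightarrow> c"
  shows "sot_sums p (scalar_ops l) (\<lambda>h. c * h)"
  unfolding sot_sums_def partial_sum_scalar_ops by (intro conjI allI bops_times tendsto_intros assms)

lemma norm_sums_scalar_opsI:
  assumes "(\<lambda>N. \<Sum>\<alpha> | length \<alpha> < N. p \<alpha> * prod_list (map l \<alpha>)) \<longlonglongrightarrow> c"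
  shows "norm_sums p (scalar_ops l) (\<lambda>h. c * h)"
  unfolding norm_sums_def
proof (intro conjI bops_times)
  let ?s = "\<lambda>N. \<Sum>\<alpha> | length \<alpha> < N. p \<alpha> * prod_list (map l \<alpha>)"
  have le: "onorm (\<lambda>h. partial_sum p (scalar_ops l) N h - c * h) \<le> cmod (?s N - c)" for N
    by (rule onorm_bound) (simp_all add: partial_sum_scalar_ops norm_mult flip: left_diff_distrib)
  have ge: "0 \<le> onorm (\<lambda>h. partial_sum p (scalar_ops l) N h - c * h)" for N
    by (intro onorm_pos_le bounded_linear_sub bops_UNIV_bounded_linear partial_sum_bops
        scalar_ops_optuples bops_times)
  have "(\<lambda>N. cmod (?s N - c)) \<longlonglongrightarrow> 0"
    using assms by (simp add: LIM_zero_iff tendsto_norm_zero_iff)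
  then show "(\<lambda>N. onorm (\<lambda>h. partial_sum p (scalar_ops l) N h - c * h)) \<longlonglongrightarrow> 0"
    by (rule Lim_null_comparison[rotated]) (simp add: le ge)
qed

lemma row_norm_scalar_ops:
  fixes z :: "'n::finite \<Rightarrow> complex"
  assumes "z \<in> cunit_ball"
  shows "row_norm (scalar_ops z) < 1"
proof -
  have "row_norm (scalar_ops z) \<le> L2_set (\<lambda>i. cmod (z i)) UNIV"
    unfolding row_norm_def
  proof (rule onorm_bound)
    fix h :: "complex ^ 'n"
    have "norm (\<Sum>i\<in>UNIV. scalar_ops z i (h $ i)) \<le> (\<Sum>i\<in>UNIV. \<bar>cmod (z i)\<bar> * \<bar>cmod (h $ i)\<bar>)"
      by (rule order_trans[OF norm_sum]) (simp add: scalar_ops_def norm_mult)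
    also have "\<dots> \<le> L2_set (\<lambda>i. cmod (z i)) UNIV * norm h"
      unfolding norm_vec_def by (rule L2_set_mult_ineq)
    finally show "norm (\<Sum>i\<in>UNIV. scalar_ops z i (h $ i)) \<le> L2_set (\<lambda>i. cmod (z i)) UNIV * norm h" .
  qed simp
  also have "\<dots> < 1" using assms by (simp add: L2_set_def cunit_ball_def)
  finally show ?thesis .
qed

text \<open>The value \<open>t r\<close> is required to be the sum for \<open>r\<close> close to 1
  only, which is what the radial convergence set provides.\<close>

lemma Abel_limit:
  fixes c :: "nat \<Rightarrow> complex"
  assumes c: "c sums s"
    and t: "\<forall>\<^sub>F r in at_left (1::real). (\<lambda>k. c k * complex_of_real r ^ k) sums t r"
  shows "(t \<longlongrightarrow> s) (at_left 1)"
proof (rule tendstoI)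
  fix e :: real assume e: "e > 0"
  define S where "S n = (\<Sum>k<Suc n. c k) - s" for n
  have "S \<longlonglongrightarrow> 0" unfolding S_def
    using LIMSEQ_Suc[OF c[unfolded sums_def]] by (simp add: LIM_zero_iff del: sum.lessThan_Suc)
  then obtain m where m: "\<And>n. n \<ge> m \<Longrightarrow> cmod (S n) < e / 2"
    using e by (metis LIMSEQ_D half_gt_zero diff_zero)
  \<comment> \<open>The errors before \<open>m\<close> contribute at most (1 - r) A, which vanishes
    as r -> 1; those from \<open>m\<close> on contribute at most e / 2, because 1 - r times the
    geometric series is 1.\<close>
  define A where "A = (\<Sum>n<m. cmod (S n))"
  have A: "0 \<le> A" by (simp add: A_def sum_nonneg)
  have "((\<lambda>r. (1 - r) * A) \<longlongrightarrow> (1 - 1) * A) (at_left (1::real))" by (intro tendsto_intros)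
  then have evA: "\<forall>\<^sub>F r in at_left (1::real). (1 - r) * A < e / 2"
    using e by (intro order_tendstoD(2)[where y = "(1 - 1) * A"]) auto
  have ev1: "\<forall>\<^sub>F r in at_left (1::real). 0 < r \<and> r < 1"
    by (rule eventually_at_leftI[of 0]) auto
  show "\<forall>\<^sub>F r in at_left 1. dist (t r) s < e"
    using t evA ev1
  proof eventually_elim
    case (elim r)
    let ?r = "complex_of_real r"
    have r: "0 < r" "r < 1" "cmod ?r < 1" using elim by auto
    text \<open>Summation by parts: \<open>t r - s = (1 - r) (\<Sum>n. S n r\<^sup>n)\<close>.\<close>
    have fin: "(\<Sum>k<N. c k * ?r ^ k) - s = (1 - ?r) * (\<Sum>n<N. S n * ?r ^ n)
        + ((\<Sum>k<N. c k) - s) * ?r ^ N" for N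
      by (induction N) (simp_all add: S_def algebra_simps)
    have "(\<lambda>N. (\<Sum>k<N. c k * ?r ^ k) - s) \<longlonglongrightarrow> t r - s"
      using elim(1) by (intro tendsto_intros) (simp add: sums_def)
    moreover have "(\<lambda>N. ((\<Sum>k<N. c k) - s) * ?r ^ N) \<longlonglongrightarrow> (s - s) * 0"
      by (intro tendsto_mult LIMSEQ_power_zero r(3) tendsto_diff tendsto_const c[unfolded sums_def])
    ultimately have lim: "(\<lambda>N. ((\<Sum>k<N. c k * ?r ^ k) - s) - ((\<Sum>k<N. c k) - s) * ?r ^ N)
        \<longlonglongrightarrow> (t r - s) - (s - s) * 0" by (rule tendsto_diff)
    have "cmod ((t r - s) - (s - s) * 0) \<le> (1 - r) * A + e / 2"
    proof (rule LIMSEQ_le_const2[OF tendsto_norm[OF lim]], intro exI allI impI)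
      fix N
      have "cmod (((\<Sum>k<N. c k * ?r ^ k) - s) - ((\<Sum>k<N. c k) - s) * ?r ^ N)
          = cmod ((1 - ?r) * (\<Sum>n<N. S n * ?r ^ n))"
        unfolding fin by simp
      also have "\<dots> \<le> (1 - r) * (\<Sum>n<N. cmod (S n) * r ^ n)"
      proof -
        have "1 - ?r = complex_of_real (1 - r)" by simp
        then have "cmod (1 - ?r) = 1 - r" using r by (simp only: norm_of_real)
        moreover have "cmod (\<Sum>n<N. S n * ?r ^ n) \<le> (\<Sum>n<N. cmod (S n) * r ^ n)"
          using r by (intro order_trans[OF norm_sum] sum_mono) (simp add: norm_mult norm_power)
        ultimately show ?thesis using r by (simp add: norm_mult mult_left_mono)
      qed
      also have "(\<Sum>n<N. cmod (S n) * r ^ n) \<le> (\<Sum>n<N. (if n < m then cmod (S n) else 0) + e / 2 * r ^ n)"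
      proof (rule sum_mono)
        fix n
        show "cmod (S n) * r ^ n \<le> (if n < m then cmod (S n) else 0) + e / 2 * r ^ n"
        proof (cases "n < m")
          case True
          have "cmod (S n) * r ^ n \<le> cmod (S n) * 1"
            using r by (intro mult_left_mono power_le_one) auto
          moreover have "0 \<le> e / 2 * r ^ n" using e r by simp
          ultimately show ?thesis using True by simp
        next
          case False
          then show ?thesis using m[of n] r by (simp add: mult_right_mono)
        qed
      qed
      also have "\<dots> \<le> A + e / 2 * (1 / (1 - r))"
      proof -
        have "(\<Sum>n<N. if n < m then cmod (S n) else 0) = (\<Sum>n\<in>{..<N} \<inter> {..<m}. cmod (S n))"
          by (simp add: sum.inter_restrict)
        also have "\<dots> \<le> A" unfolding A_def by (rule sum_mono2) auto
        finally have 1: "(\<Sum>n<N. if n < m then cmod (S n) else 0) \<le> A" .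
        have "(\<Sum>n<N. r ^ n) \<le> (\<Sum>n. r ^ n)"
          by (rule sum_le_suminf) (use r in \<open>auto intro: summable_geometric\<close>)
        then have "(\<Sum>n<N. r ^ n) \<le> 1 / (1 - r)" using r by (simp add: suminf_geometric)
        then have "e / 2 * (\<Sum>n<N. r ^ n) \<le> e / 2 * (1 / (1 - r))" using e by (intro mult_left_mono) auto
        with 1 show ?thesis by (simp add: sum.distrib sum_distrib_left)
      qed
      also have "(1 - r) * (A + e / 2 * (1 / (1 - r))) = (1 - r) * A + e / 2"
        using r by (simp add: field_simps)
      finally show "cmod (((\<Sum>k<N. c k * ?r ^ k) - s) - ((\<Sum>k<N. c k) - s) * ?r ^ N)
          \<le> (1 - r) * A + e / 2" using r by (simp add: mult_left_mono)
    qed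
    then show ?case using elim(2) by (simp add: dist_norm)
  qed
qed

lemma scaled_word_sum:
  fixes l :: "'n::finite \<Rightarrow> complex"
  shows "(\<Sum>\<alpha> | length \<alpha> < N. p \<alpha> * prod_list (map (\<lambda>i. c * l i) \<alpha>))
    = (\<Sum>k<N. (\<Sum>\<alpha> | length \<alpha> = k. p \<alpha> * prod_list (map l \<alpha>)) * c ^ k)"
proof -
  have "prod_list (map (\<lambda>i. c * l i) \<alpha>) = prod_list (map l \<alpha>) * c ^ length \<alpha>" for \<alpha>
    by (induction \<alpha>) auto
  then show ?thesis unfolding sum_words_length_less
    by (intro sum.cong refl) (simp add: sum_distrib_right mult.assoc)
qed

subsection \<open>The universal model\<close>

text \<open>Right multiplication by f_\<beta>, which carries f_\<gamma> to
  \<open>f_{\<gamma>\<beta>}\<close>. For a word shorter than \<beta> the truncated subtraction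
  drops nothing, so the whole word is compared with \<beta> and the coefficient is 0.\<close>

lift_definition right_shift :: "'n list \<Rightarrow> 'n list ell2 \<Rightarrow> 'n list ell2"
  is "\<lambda>\<beta> x \<alpha>. if drop (length \<alpha> - length \<beta>) \<alpha> = \<beta> then x (take (length \<alpha> - length \<beta>) \<alpha>) else 0"
proof -
  fix \<beta> :: "'n list" and x :: "'n list \<Rightarrow> complex"
  assume x: "(\<lambda>i. (cmod (x i))\<^sup>2) summable_on UNIV"
  let ?y = "\<lambda>\<alpha>. if drop (length \<alpha> - length \<beta>) \<alpha> = \<beta> then x (take (length \<alpha> - length \<beta>) \<alpha>) else 0"
  have "(\<lambda>\<alpha>. (cmod (?y \<alpha>))\<^sup>2) summable_on (range (\<lambda>\<gamma>. \<gamma> @ \<beta>))"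
    by (subst summable_on_reindex) (auto simp: inj_on_def comp_def x)
  moreover have "?y \<alpha> = 0" if "\<alpha> \<notin> range (\<lambda>\<gamma>. \<gamma> @ \<beta>)" for \<alpha>
    using that by (auto simp: image_iff) (metis append_take_drop_id)
  ultimately show "(\<lambda>\<alpha>. (cmod (?y \<alpha>))\<^sup>2) summable_on UNIV"
    by (subst summable_on_cong_neutral[where T = "range (\<lambda>\<gamma>. \<gamma> @ \<beta>)"]) auto
qed

lemma ell2_nth_right_shift_append [simp]: "ell2_nth (right_shift \<beta> x) (\<gamma> @ \<beta>) = ell2_nth x \<gamma>"
  by (simp add: right_shift.rep_eq)

lemma ell2_nth_right_shift_notin:
  "\<alpha> \<notin> range (\<lambda>\<gamma>. \<gamma> @ \<beta>) \<Longrightarrow> ell2_nth (right_shift \<beta> x) \<alpha> = 0"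
  by (auto simp: right_shift.rep_eq image_iff) (metis append_take_drop_id)

text \<open>Evaluation of words at scalars turns concatenation into a product; this is why kernel
  vectors become eigenvectors of the adjoints.\<close>

lemma cinner_right_shift_kernel_vec:
  assumes z: "z \<in> cunit_ball"
  shows "cinner (right_shift \<beta> x) (kernel_vec z) = cinner x (kernel_vec z) * prod_list (map z \<beta>)"
proof -
  have "cinner (right_shift \<beta> x) (kernel_vec z)
      = infsum (\<lambda>\<alpha>. ell2_nth (right_shift \<beta> x) \<alpha> * prod_list (map z \<alpha>)) (range (\<lambda>\<gamma>. \<gamma> @ \<beta>))"
    unfolding cinner_kernel_vec[OF z]
    by (rule infsum_cong_neutral) (auto simp: ell2_nth_right_shift_notin)
  also have "\<dots> = (\<Sum>\<^sub>\<infinity>\<gamma>. ell2_nth x \<gamma> * prod_list (map z \<gamma>) * prod_list (map z \<beta>))"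
    by (subst infsum_reindex) (auto simp: inj_on_def comp_def mult.assoc)
  also have "\<dots> = cinner x (kernel_vec z) * prod_list (map z \<beta>)"
    unfolding cinner_kernel_vec[OF z] by (rule infsum_cmult_left')
  finally show ?thesis .
qed

text \<open>
  The only consequences of the model property that are needed; \<open>Y\<close> is \<open>f(M)\<close>.
\<close>

locale universal_model =
  fixes f :: "'n::finite \<Rightarrow> 'n ncfps"
    and Z :: "'n \<Rightarrow> 'n list ell2"
    and M Y :: "('n, 'n list ell2) optuple"
  assumes M_bops: "M i \<in> bops UNIV"
    and M_unit: "M i (ell2_unit \<beta>) = right_shift \<beta> (Z i)"
    and conv: "conv_value f M Y"
    and Y_unit: "Y j (ell2_unit []) = ell2_unit [j]"
begin

text \<open>The inverse series g_i evaluated at the point \<open>z\<close>; the pairing with the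
  kernel vector performs the summation.\<close>

definition g :: "('n \<Rightarrow> complex) \<Rightarrow> 'n \<Rightarrow> complex"
  where "g z i = cinner (Z i) (kernel_vec z)"

lemma Y_bops: "Y j \<in> bops UNIV"
  using conv by (auto simp: conv_value_def sot_value_def sot_sums_def rad_value_def optuples_def)

text \<open>Both sides are bounded and linear in \<open>x\<close>, and on a basis vector
  \<open>M i\<close> is a right shift of \<open>Z i\<close>, on which evaluation at \<open>z\<close>
  is multiplicative.\<close>

lemma cinner_M:
  assumes z: "z \<in> cunit_ball"
  shows "cinner (M i x) (kernel_vec z) = g z i * cinner x (kernel_vec z)"
proof (rule ell2_bounded_linear_eqI[where S = "\<lambda>x. cinner (M i x) (kernel_vec z)"
      and T = "\<lambda>x. g z i * cinner x (kernel_vec z)"])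
  show "bounded_linear (\<lambda>x. cinner (M i x) (kernel_vec z))"
    by (rule bounded_linear_compose[OF bounded_linear_cinner_left bops_UNIV_bounded_linear[OF M_bops]])
  show "bounded_linear (\<lambda>x. g z i * cinner x (kernel_vec z))"
    by (rule bounded_linear_compose[OF bounded_linear_mult_right bounded_linear_cinner_left])
qed (simp_all add: bopsD(3)[OF M_bops] cinner_scaleC_left scaleC_complex_def M_unit
    cinner_right_shift_kernel_vec[OF z] cinner_unit_kernel_vec[OF z] g_def)

lemma cinner_scaleR_M:
  assumes z: "z \<in> cunit_ball"
  shows "cinner (r *\<^sub>R M i x) (kernel_vec z) = (r * g z i) * cinner x (kernel_vec z)"
  by (simp add: cinner_scaleR_left cinner_M[OF z])

lemma scaleR_M_optuples: "(\<lambda>i h. r *\<^sub>R M i h) \<in> optuples"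
  by (simp add: optuples_def bops_UNIV_scaleR M_bops)

lemma cinner_Y_unit: "z \<in> cunit_ball \<Longrightarrow> cinner (Y j (ell2_unit [])) (kernel_vec z) = z j"
  by (simp add: Y_unit cinner_unit_kernel_vec)

text \<open>Applied to the vector 1 and paired with a kernel vector, an operator series at r M
  becomes the scalar series at r g(z). The factor \<open>r\<close> covers SOT convergence (r = 1)
  and radial convergence together.\<close>

lemma tendsto_word_sum:
  assumes z: "z \<in> cunit_ball"
    and lim: "(\<lambda>N. partial_sum p (\<lambda>i h. r *\<^sub>R M i h) N (ell2_unit [])) \<longlonglongrightarrow> w"
  shows "(\<lambda>N. \<Sum>\<alpha> | length \<alpha> < N. p \<alpha> * prod_list (map (\<lambda>i. r * g z i) \<alpha>))
    \<longlonglongrightarrow> cinner w (kernel_vec z)"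
  using tendsto_cinner_left[OF lim, of "kernel_vec z"]
  unfolding cinner_partial_sum[where X = "\<lambda>i h. r *\<^sub>R M i h", OF cinner_scaleR_M[OF z]]
    cinner_unit_kernel_vec[OF z] by simp

lemma sot_value_g:
  assumes z: "z \<in> cunit_ball" and sot: "sot_value f M Y"
  shows "sot_value f (scalar_ops (g z)) (scalar_ops z)"
  unfolding sot_value_def
proof (intro conjI allI scalar_ops_optuples)
  fix j
  \<comment> \<open>The factor 1 brings the sum into the form with \<open>r\<close> that
    \<open>tendsto_word_sum\<close> expects.\<close>
  have "(\<lambda>N. partial_sum (f j) (\<lambda>i h. 1 *\<^sub>R M i h) N (ell2_unit [])) \<longlonglongrightarrow> Y j (ell2_unit [])"
    using sot by (simp add: sot_value_def sot_sums_def)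
  from tendsto_word_sum[OF z this] show "sot_sums (f j) (scalar_ops (g z)) (scalar_ops z j)"
    unfolding scalar_ops_def[of z] cinner_Y_unit[OF z] by (intro sot_sums_scalar_opsI) simp
qed

text \<open>The second claim is needed because \<open>f_at\<close> prefers the SOT value: if the
  scalar series happen to converge at g(z) as well, Abel's theorem identifies their sums with the
  radial limits z_j.\<close>

lemma rad_value_g:
  assumes z: "z \<in> cunit_ball" and rad: "rad_value f M Y"
  shows "rad_value f (scalar_ops (g z)) (scalar_ops z)"
    and "sot_value f (scalar_ops (g z)) Y' \<Longrightarrow> Y' = scalar_ops z"
proof -
  obtain \<delta> where \<delta>: "\<delta> \<in> {0<..<1}"
    and W: "\<And>r j. r \<in> {\<delta><..<1} \<Longrightarrow> \<exists>W. norm_sums (f j) (\<lambda>i h. r *\<^sub>R M i h) W"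
    and lim: "\<And>j h. ((\<lambda>r. nc_eval (f j) (\<lambda>i h. r *\<^sub>R M i h) h) \<longlongrightarrow> Y j h) (at_left 1)"
    using rad unfolding rad_value_def by blast
  define w where "w j r = cinner (nc_eval (f j) (\<lambda>i h. r *\<^sub>R M i h) (ell2_unit [])) (kernel_vec z)" for j r
  have w_sum: "(\<lambda>N. \<Sum>\<alpha> | length \<alpha> < N. f j \<alpha> * prod_list (map (\<lambda>i. r * g z i) \<alpha>)) \<longlonglongrightarrow> w j r"
    if r: "r \<in> {\<delta><..<1}" for j r
  proof -
    obtain W where "norm_sums (f j) (\<lambda>i h. r *\<^sub>R M i h) W" using W[OF r] by blast
    from norm_sums_tendsto[OF this scaleR_M_optuples] nc_eval_eq[OF this scaleR_M_optuples]
    have "(\<lambda>N. partial_sum (f j) (\<lambda>i h. r *\<^sub>R M i h) N (ell2_unit []))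
        \<longlonglongrightarrow> nc_eval (f j) (\<lambda>i h. r *\<^sub>R M i h) (ell2_unit [])" by simp
    from tendsto_word_sum[OF z this] show ?thesis by (simp only: w_def)
  qed
  have w_lim: "(w j \<longlongrightarrow> z j) (at_left 1)" for j
    using tendsto_cinner_left[OF lim[of j "ell2_unit []"], of "kernel_vec z"]
    by (simp add: w_def[abs_def] cinner_Y_unit[OF z])
  have ns: "norm_sums (f j) (\<lambda>i h. r *\<^sub>R scalar_ops (g z) i h) (\<lambda>h. w j r * h)"
    if "r \<in> {\<delta><..<1}" for r j
    unfolding scaleR_scalar_ops by (rule norm_sums_scalar_opsI[OF w_sum[OF that]])
  have ev: "\<forall>\<^sub>F r in at_left 1. r \<in> {\<delta><..<1}"
    using \<delta> by (intro eventually_at_leftI[of \<delta>]) auto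
  show "rad_value f (scalar_ops (g z)) (scalar_ops z)"
    unfolding rad_value_def
  proof (intro conjI allI scalar_ops_optuples bexI[OF _ \<delta>] ballI)
    show "\<exists>W. norm_sums (f j) (\<lambda>i h. r *\<^sub>R scalar_ops (g z) i h) W" if "r \<in> {\<delta><..<1}" for r j
      using ns[OF that] by blast
    fix j h
    have "((\<lambda>r. w j r * h) \<longlongrightarrow> z j * h) (at_left 1)" by (intro tendsto_intros w_lim)
    then show "((\<lambda>r. nc_eval (f j) (\<lambda>i h. r *\<^sub>R scalar_ops (g z) i h) h) \<longlongrightarrow> scalar_ops z j h) (at_left 1)"
      unfolding scalar_ops_def[of z]
    proof (rule Lim_transform_eventually[OF _ eventually_mono[OF ev]])
      fix r assume "r \<in> {\<delta><..<1}"
      from nc_eval_eq[OF ns[OF this]] show "w j r * h = nc_eval (f j) (\<lambda>i h. r *\<^sub>R scalar_ops (g z) i h) h"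
        by (simp add: scaleR_scalar_ops scalar_ops_optuples)
    qed
  qed
  show "Y' = scalar_ops z" if sot: "sot_value f (scalar_ops (g z)) Y'"
  proof (intro ext)
    fix j h
    have Y'b: "Y' j \<in> bops UNIV" and Y': "\<And>h. (\<lambda>N. partial_sum (f j) (scalar_ops (g z)) N h) \<longlonglongrightarrow> Y' j h"
      using sot by (auto simp: sot_value_def sot_sums_def)
    have "(w j \<longlongrightarrow> Y' j 1) (at_left 1)"
    proof (rule Abel_limit)
      show "(\<lambda>k. \<Sum>\<alpha> | length \<alpha> = k. f j \<alpha> * prod_list (map (g z) \<alpha>)) sums Y' j 1"
        using Y'[of 1] unfolding sums_def partial_sum_scalar_ops sum_words_length_less by simp
      show "\<forall>\<^sub>F r in at_left 1. (\<lambda>k. (\<Sum>\<alpha> | length \<alpha> = k. f j \<alpha> * prod_list (map (g z) \<alpha>))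
          * complex_of_real r ^ k) sums w j r"
        using ev w_sum unfolding sums_def scaled_word_sum by (rule eventually_mono)
    qed
    then have "Y' j 1 = z j" using w_lim by (rule tendsto_unique[OF trivial_limit_at_left_real])
    then show "Y' j h = scalar_ops z j h"
      using bopsD(3)[OF Y'b UNIV_I, of h 1] by (simp add: scaleC_complex_def scalar_ops_def mult.commute)
  qed
qed

lemma f_at_g:
  assumes z: "z \<in> cunit_ball"
  shows "scalar_ops (g z) \<in> conv_sot f \<union> conv_rad f" "f_at f (scalar_ops (g z)) = scalar_ops z"
proof -
  consider "sot_value f M Y" | "rad_value f M Y" using conv unfolding conv_value_def by (rule disjE)
  then have both: "scalar_ops (g z) \<in> conv_sot f \<union> conv_rad f \<and> f_at f (scalar_ops (g z)) = scalar_ops z"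
  proof cases
    case 1
    note sot = sot_value_g[OF z this]
    have "(THE Y. sot_value f (scalar_ops (g z)) Y) = scalar_ops z"
      by (rule the_equality[where P = "sot_value f (scalar_ops (g z))", OF sot])
        (rule sot_value_unique[OF _ sot])
    moreover have "scalar_ops (g z) \<in> conv_sot f" unfolding conv_sot_def using sot by blast
    ultimately show ?thesis by (simp add: f_at_def)
  next
    case 2
    note rad = rad_value_g[OF z this]
    show ?thesis
    proof (cases "scalar_ops (g z) \<in> conv_sot f")
      case True
      then obtain Y' where Y': "sot_value f (scalar_ops (g z)) Y'" unfolding conv_sot_def by blast
      have "(THE Y. sot_value f (scalar_ops (g z)) Y) = Y'"
        by (rule the_equality[where P = "sot_value f (scalar_ops (g z))", OF Y'])
          (rule sot_value_unique[OF _ Y'])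
      with True rad(2)[OF Y'] show ?thesis by (simp add: f_at_def)
    next
      case False
      have "(THE Y. rad_value f (scalar_ops (g z)) Y) = scalar_ops z"
        by (rule the_equality[where P = "rad_value f (scalar_ops (g z))", OF rad(1)])
          (rule rad_value_unique[OF _ rad(1)])
      moreover have "scalar_ops (g z) \<in> conv_rad f" unfolding conv_rad_def using rad(1) by blast
      ultimately show ?thesis using False by (simp add: f_at_def)
    qed
  qed
  show "scalar_ops (g z) \<in> conv_sot f \<union> conv_rad f" by (rule conjunct1[OF both])
  show "f_at f (scalar_ops (g z)) = scalar_ops z" by (rule conjunct2[OF both])
qed

text \<open>Since f(g(z)) = z, the condition g(f(X)) = X at X = g(z) says only that the series g_i
  sum to g_i(z) at \<open>z\<close>, which square-summability of their coefficients
  provides.\<close>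

lemma g_scalar_domain:
  assumes z: "z \<in> cunit_ball"
  shows "g z \<in> scalar_domain f Z" "f_scalar f (g z) = z"
proof -
  have "sot_value (\<lambda>i. ell2_nth (Z i)) (scalar_ops z) (scalar_ops (g z))"
    unfolding sot_value_def scalar_ops_def[of "g z"]
  proof (intro conjI allI scalar_ops_optuples sot_sums_scalar_opsI)
    show "(\<lambda>N. \<Sum>\<alpha> | length \<alpha> < N. ell2_nth (Z i) \<alpha> * prod_list (map z \<alpha>)) \<longlonglongrightarrow> g z i" for i
      unfolding g_def cinner_kernel_vec[OF z] by (rule infsum_words_limit[OF kernel_vec_summable[OF z]])
  qed
  then show "g z \<in> scalar_domain f Z"
    using f_at_g[OF z] row_norm_scalar_ops[OF z]
    by (simp add: scalar_domain_def nc_domain_def conv_value_def)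
  show "f_scalar f (g z) = z"
    by (rule ext) (simp only: f_scalar_def f_at_g(2)[OF z], simp add: scalar_ops_def)
qed

lemma Omega_eq: "Omega f l = kernel_vec (f_scalar f l)"
  by (simp add: Omega_def kernel_vec_def)

lemma f_scalar_in_ball: "l \<in> scalar_domain f Z \<Longrightarrow> f_scalar f l \<in> cunit_ball"
  using f_scalar_norm by (simp add: cunit_ball_def)

text \<open>
  The vectors of \<open>symm_space\<close> are determined by their pairings with kernel vectors; therefore
  compression is multiplicative on \<open>lifts A\<close>, and evaluating power series at \<open>M\<close> stays inside it.
\<close>

definition lifts :: "('n list ell2 \<Rightarrow> 'n list ell2) set \<Rightarrow> ('n list ell2 \<Rightarrow> 'n list ell2) set"
  where "lifts A = {X \<in> bops UNIV. compression symm_space X \<in> A \<and>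
    (\<forall>x. \<forall>z\<in>cunit_ball. cinner (X x) (kernel_vec z)
      = cinner (X (ell2_unit [])) (kernel_vec z) * cinner x (kernel_vec z))}"

lemma liftsI:
  assumes "X \<in> bops UNIV" "compression symm_space X \<in> A"
    and "\<And>x z. z \<in> cunit_ball \<Longrightarrow>
      cinner (X x) (kernel_vec z) = cinner (X (ell2_unit [])) (kernel_vec z) * cinner x (kernel_vec z)"
  shows "X \<in> lifts A"
  unfolding lifts_def by (intro CollectI conjI allI ballI assms)

lemma liftsD:
  assumes "X \<in> lifts A"
  shows "X \<in> bops UNIV" "compression symm_space X \<in> A"
    and "z \<in> cunit_ball \<Longrightarrow>
      cinner (X x) (kernel_vec z) = cinner (X (ell2_unit [])) (kernel_vec z) * cinner x (kernel_vec z)"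
  using assms unfolding lifts_def by blast+

lemma symm_proj_in: "orth_proj symm_space x \<in> symm_space"
  by (rule orth_proj(1)[OF csubspace_symm_space closed_symm_space])

lemma cinner_symm_proj:
  "y \<in> symm_space \<Longrightarrow> cinner (orth_proj symm_space x) y = cinner x y"
  by (rule orth_proj(2)[OF csubspace_symm_space closed_symm_space])

lemma compression_in_symm_space: "x \<in> symm_space \<Longrightarrow> compression symm_space X x \<in> symm_space"
  by (simp add: compression_def symm_proj_in)

lemma cinner_compression:
  "x \<in> symm_space \<Longrightarrow> y \<in> symm_space \<Longrightarrow> cinner (compression symm_space X x) y = cinner (X x) y"
  by (simp add: compression_def cinner_symm_proj)

lemma compression_bops:
  assumes "X \<in> bops UNIV"
  shows "compression symm_space X \<in> bops symm_space"
proof -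
  obtain B where B: "\<And>x. norm (X x) \<le> B * norm x" using bops_bound[OF assms] by auto
  note P = csubspace_symm_space closed_symm_space
  show ?thesis
    unfolding compression_def
    by (rule bops_symm_spaceI[where B = B])
      (auto simp: symm_proj_in bopsD(2,3)[OF assms] orth_proj_linear[OF P]
        intro: order_trans[OF norm_orth_proj_le[OF P] B])
qed

lemma lifts_id:
  assumes "unital_subalgebra symm_space A"
  shows "id \<in> lifts A"
proof (rule liftsI[OF bops_UNIV_id])
  have "compression symm_space (id :: 'n list ell2 \<Rightarrow> _) = (\<lambda>x\<in>symm_space. x)"
    unfolding compression_def by (intro restrict_ext)
      (simp add: orth_proj_eqI[OF csubspace_symm_space closed_symm_space])
  then show "compression symm_space id \<in> A" using subalgebraD(2)[OF assms] by simp
qed (simp add: cinner_unit_kernel_vec)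

lemma lifts_add:
  assumes A: "unital_subalgebra symm_space A" and X: "X \<in> lifts A" "X' \<in> lifts A"
  shows "(\<lambda>x. X x + X' x) \<in> lifts A"
proof (rule liftsI)
  have "compression symm_space (\<lambda>x. X x + X' x)
      = (\<lambda>x\<in>symm_space. compression symm_space X x + compression symm_space X' x)"
    unfolding compression_def
    by (intro restrict_ext) (simp add: orth_proj_linear[OF csubspace_symm_space closed_symm_space])
  then show "compression symm_space (\<lambda>x. X x + X' x) \<in> A"
    using subalgebraD(3)[OF A liftsD(2)[OF X(1)] liftsD(2)[OF X(2)]] by simp
  show "cinner (X x + X' x) (kernel_vec z)
      = cinner (X (ell2_unit []) + X' (ell2_unit [])) (kernel_vec z) * cinner x (kernel_vec z)"
    if "z \<in> cunit_ball" for x z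
    using liftsD(3)[OF X(1) that, of x] liftsD(3)[OF X(2) that, of x]
    unfolding cinner_add_left distrib_right by (rule arg_cong2)
qed (intro bops_UNIV_add liftsD[OF X(1)] liftsD[OF X(2)])

lemma lifts_scaleC:
  assumes A: "unital_subalgebra symm_space A" and X: "X \<in> lifts A"
  shows "(\<lambda>x. c *\<^sub>C X x) \<in> lifts A"
proof (rule liftsI)
  have "compression symm_space (\<lambda>x. c *\<^sub>C X x) = (\<lambda>x\<in>symm_space. c *\<^sub>C compression symm_space X x)"
    unfolding compression_def
    by (intro restrict_ext) (simp add: orth_proj_linear[OF csubspace_symm_space closed_symm_space])
  then show "compression symm_space (\<lambda>x. c *\<^sub>C X x) \<in> A"
    using subalgebraD(4)[OF A liftsD(2)[OF X]] by simp
  show "cinner (c *\<^sub>C X x) (kernel_vec z)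
      = cinner (c *\<^sub>C X (ell2_unit [])) (kernel_vec z) * cinner x (kernel_vec z)"
    if "z \<in> cunit_ball" for x z
    using liftsD(3)[OF X that, of x] unfolding cinner_scaleC_left mult.assoc by (rule arg_cong)
qed (intro bops_UNIV_scaleC liftsD(1)[OF X])

text \<open>\<open>X' x\<close> and its compression may differ, but they have the same pairings with
  kernel vectors, and by the last clause of \<open>lifts\<close> the pairings of \<open>X y\<close>
  depend only on those of \<open>y\<close>.\<close>

lemma lifts_comp:
  assumes A: "unital_subalgebra symm_space A" and X: "X \<in> lifts A" "X' \<in> lifts A"
  shows "X \<circ> X' \<in> lifts A"
proof (rule liftsI)
  have "compression symm_space (X \<circ> X')
      = compose symm_space (compression symm_space X) (compression symm_space X')"
    unfolding compose_def compression_def[of _ "X \<circ> X'"]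
  proof (rule restrict_ext)
    fix x :: "'n list ell2" assume x: "x \<in> symm_space"
    show "orth_proj symm_space ((X \<circ> X') x)
        = compression symm_space X (compression symm_space X' x)"
    proof (rule symm_space_eqI)
      fix z :: "'n \<Rightarrow> complex" assume z: "z \<in> cunit_ball"
      show "cinner (orth_proj symm_space ((X \<circ> X') x)) (kernel_vec z)
          = cinner (compression symm_space X (compression symm_space X' x)) (kernel_vec z)"
        by (simp add: cinner_symm_proj cinner_compression compression_in_symm_space x
            kernel_vec_in_symm_space z liftsD(3)[OF X(1) z, of "X' x"]
            liftsD(3)[OF X(1) z, of "compression symm_space X' x"])
    qed (simp_all add: symm_proj_in compression_in_symm_space x)
  qed
  then show "compression symm_space (X \<circ> X') \<in> A"
    using subalgebraD(5)[OF A liftsD(2)[OF X(1)] liftsD(2)[OF X(2)]] by simp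
  show "cinner ((X \<circ> X') x) (kernel_vec z)
      = cinner ((X \<circ> X') (ell2_unit [])) (kernel_vec z) * cinner x (kernel_vec z)"
    if "z \<in> cunit_ball" for x z
    unfolding comp_apply liftsD(3)[OF X(1) that, of "X' x"] liftsD(3)[OF X(2) that, of x]
      liftsD(3)[OF X(1) that, of "X' (ell2_unit [])"] by (rule mult.assoc[symmetric])
qed (intro bops_UNIV_comp liftsD[OF X(1)] liftsD[OF X(2)])

text \<open>Strong convergence serves both clauses of \<open>lifts\<close>: matrix coefficients of
  the compressions converge, and the pairing identity passes to the limit.\<close>

lemma lifts_limit:
  assumes A: "closedin (wot symm_space) A" and X: "X \<in> bops UNIV"
    and F: "F \<noteq> bot" and ev: "\<forall>\<^sub>F i in F. S i \<in> lifts A"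
    and lim: "\<And>x. ((\<lambda>i. S i x) \<longlongrightarrow> X x) F"
  shows "X \<in> lifts A"
proof (rule liftsI[OF X])
  show "compression symm_space X \<in> A"
  proof (rule wot_closed_limit[OF csubspace_symm_space A compression_bops[OF X] F])
    show "\<forall>\<^sub>F i in F. compression symm_space (S i) \<in> A"
      using ev by (rule eventually_mono) (rule liftsD(2))
    show "((\<lambda>i. cinner (compression symm_space (S i) x) y) \<longlongrightarrow> cinner (compression symm_space X x) y) F"
      if "x \<in> symm_space" "y \<in> symm_space" for x y
      using tendsto_cinner_left[OF lim] by (simp add: cinner_compression that)
  qed
  show "cinner (X x) (kernel_vec z)
      = cinner (X (ell2_unit [])) (kernel_vec z) * cinner x (kernel_vec z)"
    if z: "z \<in> cunit_ball" for x z
  proof (rule tendsto_unique[OF F])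
    show "((\<lambda>i. cinner (S i x) (kernel_vec z)) \<longlongrightarrow> cinner (X x) (kernel_vec z)) F"
      by (rule tendsto_cinner_left[OF lim])
    have "((\<lambda>i. cinner (S i (ell2_unit [])) (kernel_vec z) * cinner x (kernel_vec z))
        \<longlongrightarrow> cinner (X (ell2_unit [])) (kernel_vec z) * cinner x (kernel_vec z)) F"
      by (intro tendsto_intros lim)
    then show "((\<lambda>i. cinner (S i x) (kernel_vec z))
        \<longlongrightarrow> cinner (X (ell2_unit [])) (kernel_vec z) * cinner x (kernel_vec z)) F"
    proof (rule Lim_transform_eventually[OF _ eventually_mono[OF ev]])
      fix i assume "S i \<in> lifts A"
      from liftsD(3)[OF this z]
      show "cinner (S i (ell2_unit [])) (kernel_vec z) * cinner x (kernel_vec z)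
          = cinner (S i x) (kernel_vec z)" by (rule sym)
    qed
  qed
qed

lemma lifts_partial_sum:
  assumes A: "unital_subalgebra symm_space A" and X: "\<And>i. X i \<in> lifts A"
  shows "partial_sum p X N \<in> lifts A"
proof -
  have w: "word_op X \<alpha> \<in> lifts A" for \<alpha>
  proof (induction \<alpha>)
    case Nil show ?case unfolding word_op.simps by (rule lifts_id[OF A])
  next
    case (Cons i \<alpha>) show ?case unfolding word_op.simps by (rule lifts_comp[OF A X Cons])
  qed
  have "(\<lambda>h. \<Sum>\<alpha>\<in>S. p \<alpha> *\<^sub>C word_op X \<alpha> h) \<in> lifts A" if "finite S" for S
    using that
  proof (induction S rule: finite_induct)
    case empty
    show ?case using lifts_scaleC[OF A lifts_id[OF A], of 0] by simp
  next
    case (insert a S)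
    show ?case using lifts_add[OF A lifts_scaleC[OF A w] insert.IH] insert.hyps by simp
  qed
  then show ?thesis unfolding partial_sum_eq[abs_def] by simp
qed

text \<open>The partial sums are polynomials in lifted operators. In the radial case two limits are
  taken in turn, the norm limit for fixed \<open>r\<close> and then r -> 1.\<close>

lemma Y_lifts:
  assumes A: "unital_subalgebra symm_space A" "closedin (wot symm_space) A"
    and M: "\<And>i. compression symm_space (M i) \<in> A"
  shows "Y j \<in> lifts A"
proof -
  have M_lift: "M i \<in> lifts A" for i
    by (rule liftsI[OF M_bops M]) (simp add: cinner_M cinner_unit_kernel_vec)
  have rM_lift: "(\<lambda>h. r *\<^sub>R M i h) \<in> lifts A" for r i
    using lifts_scaleC[OF A(1) M_lift, of "complex_of_real r"] by (simp add: scaleC_of_real)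
  consider "sot_value f M Y" | "rad_value f M Y" using conv unfolding conv_value_def by (rule disjE)
  then show ?thesis
  proof cases
    case 1
    show ?thesis
      by (rule lifts_limit[OF A(2) Y_bops trivial_limit_sequentially, where S = "partial_sum (f j) M"])
        (use 1 in \<open>auto simp: sot_value_def sot_sums_def lifts_partial_sum[OF A(1) M_lift]\<close>)
  next
    case 2
    then obtain \<delta> where \<delta>: "\<delta> \<in> {0<..<1}"
      and W: "\<And>r j. r \<in> {\<delta><..<1} \<Longrightarrow> \<exists>W. norm_sums (f j) (\<lambda>i h. r *\<^sub>R M i h) W"
      and lim: "\<And>j h. ((\<lambda>r. nc_eval (f j) (\<lambda>i h. r *\<^sub>R M i h) h) \<longlongrightarrow> Y j h) (at_left 1)"
      unfolding rad_value_def by blast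
    have "nc_eval (f j) (\<lambda>i h. r *\<^sub>R M i h) \<in> lifts A" if r: "r \<in> {\<delta><..<1}" for r
    proof -
      obtain W where W: "norm_sums (f j) (\<lambda>i h. r *\<^sub>R M i h) W" using W[OF r] by blast
      have "W \<in> lifts A"
      proof (rule lifts_limit[OF A(2) _ trivial_limit_sequentially])
        show "W \<in> bops UNIV" using W by (simp add: norm_sums_def)
        show "\<forall>\<^sub>F N in sequentially. partial_sum (f j) (\<lambda>i h. r *\<^sub>R M i h) N \<in> lifts A"
          by (intro always_eventually allI lifts_partial_sum[OF A(1) rM_lift])
        show "(\<lambda>N. partial_sum (f j) (\<lambda>i h. r *\<^sub>R M i h) N x) \<longlonglongrightarrow> W x" for x
          by (rule norm_sums_tendsto[OF W scaleR_M_optuples])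
      qed
      then show ?thesis by (simp add: nc_eval_eq[OF W scaleR_M_optuples])
    qed
    then have "\<forall>\<^sub>F r in at_left 1. nc_eval (f j) (\<lambda>i h. r *\<^sub>R M i h) \<in> lifts A"
      using \<delta> by (intro eventually_at_leftI[of \<delta>]) auto
    then show ?thesis by (rule lifts_limit[OF A(2) Y_bops trivial_limit_at_left_real _ lim])
  qed
qed

theorem Hinf_symm_eq: "Hinf_symm M = mult_ops"
proof
  let ?gen = "range (\<lambda>i. compression symm_space (M i))"
  show "Hinf_symm M \<subseteq> mult_ops"
    unfolding Hinf_symm_def wot_algebra_def
  proof (rule hull_minimal)
    have "compression symm_space (M i) \<in> mult_ops" for i
      by (rule mult_opsI[OF compression_bops[OF M_bops], where \<phi> = "\<lambda>z. g z i"])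
        (simp add: cinner_compression kernel_vec_in_symm_space cinner_M)
    then show "?gen \<subseteq> mult_ops" by blast
    show "unital_subalgebra symm_space mult_ops \<and> closedin (wot symm_space) mult_ops"
      by (intro conjI mult_ops_unital_subalgebra mult_ops_wot_closed)
  qed
  \<comment> \<open>The generated algebra is the intersection of all admissible \<open>A\<close>, so
    multiplication by each z_j has to be produced inside an arbitrary one.\<close>
  show "mult_ops \<subseteq> Hinf_symm M"
    unfolding Hinf_symm_def wot_algebra_def hull_def
  proof (rule Inter_greatest)
    fix A assume "A \<in> {A. (unital_subalgebra symm_space A \<and> closedin (wot symm_space) A) \<and> ?gen \<subseteq> A}"
    then have A: "unital_subalgebra symm_space A" "closedin (wot symm_space) A"
      and M: "\<And>i. compression symm_space (M i) \<in> A" by auto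
    note Y = Y_lifts[OF A M]
    show "mult_ops \<subseteq> A"
    proof (rule mult_ops_subset_algebra[OF A, where W = "\<lambda>j. compression symm_space (Y j)"])
      show "compression symm_space (Y j) \<in> A" for j by (rule liftsD(2)[OF Y])
      fix j and x :: "'n list ell2" and z :: "'n \<Rightarrow> complex" assume x: "x \<in> symm_space" and z: "z \<in> cunit_ball"
      have "cinner (Y j x) (kernel_vec z) = cinner (Y j (ell2_unit [])) (kernel_vec z) * cinner x (kernel_vec z)"
        by (rule liftsD(3)[OF Y z])
      then show "cinner (compression symm_space (Y j) x) (kernel_vec z) = z j * cinner x (kernel_vec z)"
        by (simp only: cinner_compression[OF x kernel_vec_in_symm_space[OF z]] cinner_Y_unit[OF z])
    qed
  qed
qed

section \<open>Multipliers of the function space on the scalar domain\<close>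

lemma to_fun_eq: "l \<in> scalar_domain f Z \<Longrightarrow> to_fun f Z x l = cinner x (kernel_vec (f_scalar f l))"
  by (simp add: to_fun_def Omega_eq)

lemma to_fun_extensional: "to_fun f Z x \<in> extensional (scalar_domain f Z)"
  by (simp add: to_fun_def)

text \<open>Every point \<open>z\<close> of the ball is the value of \<open>f\<close> at the domain
  point g(z), so the function on the domain determines all pairings with kernel vectors.\<close>

lemma inj_on_to_fun: "inj_on (to_fun f Z) symm_space"
proof (rule inj_onI)
  fix x y :: "'n list ell2" assume xy: "x \<in> symm_space" "y \<in> symm_space" "to_fun f Z x = to_fun f Z y"
  show "x = y"
  proof (rule symm_space_eqI[OF xy(1,2)])
    fix z :: "'n \<Rightarrow> complex" assume z: "z \<in> cunit_ball"
    show "cinner x (kernel_vec z) = cinner y (kernel_vec z)"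
      using fun_cong[OF xy(3), of "g z"] by (simp add: to_fun_eq g_scalar_domain[OF z])
  qed
qed

text \<open>The description has a witness only if \<open>\<phi>\<close> is a multiplier.\<close>

definition mult_op :: "(('n \<Rightarrow> complex) \<Rightarrow> complex) \<Rightarrow> 'n list ell2 \<Rightarrow> 'n list ell2"
  where "mult_op \<phi> = (\<lambda>x\<in>symm_space. THE y. y \<in> symm_space \<and>
    to_fun f Z y = (\<lambda>l\<in>scalar_domain f Z. \<phi> l * to_fun f Z x l))"

lemma mult_op:
  assumes "\<phi> \<in> multipliers f Z" "x \<in> symm_space"
  shows "mult_op \<phi> x \<in> symm_space"
    "to_fun f Z (mult_op \<phi> x) = (\<lambda>l\<in>scalar_domain f Z. \<phi> l * to_fun f Z x l)"
proof -
  have "(\<lambda>l\<in>scalar_domain f Z. \<phi> l * to_fun f Z x l) \<in> hardy f Z"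
    using assms by (simp add: multipliers_def hardy_def)
  then obtain y where y: "y \<in> symm_space"
    "to_fun f Z y = (\<lambda>l\<in>scalar_domain f Z. \<phi> l * to_fun f Z x l)"
    unfolding hardy_def by (metis (no_types, lifting) imageE)
  have "mult_op \<phi> x = y"
    unfolding mult_op_def restrict_apply'[OF assms(2)]
  proof (rule the_equality)
    show "y' = y" if "y' \<in> symm_space \<and> to_fun f Z y' = (\<lambda>l\<in>scalar_domain f Z. \<phi> l * to_fun f Z x l)"
      for y' by (rule inj_onD[OF inj_on_to_fun]) (use that y in simp_all)
  qed (use y in simp)
  then show "mult_op \<phi> x \<in> symm_space"
    "to_fun f Z (mult_op \<phi> x) = (\<lambda>l\<in>scalar_domain f Z. \<phi> l * to_fun f Z x l)"
    using y by simp_all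
qed

lemma mult_op_eqI:
  assumes "\<phi> \<in> multipliers f Z" "x \<in> symm_space" "y \<in> symm_space"
    and "\<And>l. l \<in> scalar_domain f Z \<Longrightarrow> to_fun f Z y l = \<phi> l * to_fun f Z x l"
  shows "mult_op \<phi> x = y"
proof (rule inj_onD[OF inj_on_to_fun _ mult_op(1)[OF assms(1,2)] assms(3)])
  show "to_fun f Z (mult_op \<phi> x) = to_fun f Z y"
    unfolding mult_op(2)[OF assms(1,2)]
    by (rule extensionalityI[OF _ to_fun_extensional]) (simp_all add: assms(4))
qed

text \<open>On the ball the symbol is \<phi> o g, because g(z) is a domain point over
  \<open>z\<close>; boundedness is then automatic by \<open>mult_op_bounded\<close>.\<close>

lemma mult_op_in_mult_ops:
  assumes "\<phi> \<in> multipliers f Z"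
  shows "mult_op \<phi> \<in> mult_ops"
proof -
  have "(\<lambda>x\<in>symm_space. mult_op \<phi> x) \<in> mult_ops"
  proof (rule mult_op_bounded[where \<phi> = "\<lambda>z. \<phi> (g z)"])
    fix x :: "'n list ell2" and z :: "'n \<Rightarrow> complex" assume x: "x \<in> symm_space" and z: "z \<in> cunit_ball"
    show "cinner (mult_op \<phi> x) (kernel_vec z) = \<phi> (g z) * cinner x (kernel_vec z)"
      using fun_cong[OF mult_op(2)[OF assms x], of "g z"] by (simp add: to_fun_eq g_scalar_domain[OF z])
  qed (rule mult_op(1)[OF assms])
  moreover have "(\<lambda>x\<in>symm_space. mult_op \<phi> x) = mult_op \<phi>"
    by (simp add: mult_op_def restrict_def fun_eq_iff)
  ultimately show ?thesis by simp
qed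

lemma unit_symbol: "l \<in> scalar_domain f Z \<Longrightarrow> to_fun f Z (ell2_unit []) l = 1"
  by (simp add: to_fun_eq cinner_unit_kernel_vec f_scalar_in_ball)

text \<open>The symbol is the image of the constant function 1, read off at the ball point f(l) for
  each domain point \<open>l\<close>.\<close>

lemma symbol_of_mult_ops:
  assumes T: "T \<in> mult_ops"
  shows "to_fun f Z (T (ell2_unit [])) \<in> multipliers f Z" "mult_op (to_fun f Z (T (ell2_unit []))) = T"
proof -
  have Tb: "T \<in> bops symm_space" using T by (simp add: mult_ops_def)
  have s: "to_fun f Z (T x) l = to_fun f Z (T (ell2_unit [])) l * to_fun f Z x l"
    if "x \<in> symm_space" "l \<in> scalar_domain f Z" for x l
    unfolding to_fun_eq[OF that(2)] by (rule mult_ops_symbol[OF T that(1) f_scalar_in_ball[OF that(2)]])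
  show m: "to_fun f Z (T (ell2_unit [])) \<in> multipliers f Z"
    unfolding multipliers_def
  proof (intro CollectI conjI ballI)
    show "to_fun f Z (T (ell2_unit [])) \<in> extensional (scalar_domain f Z)" by (simp add: to_fun_def)
    fix h assume "h \<in> hardy f Z"
    then obtain x where x: "x \<in> symm_space" "h = to_fun f Z x" by (auto simp: hardy_def)
    have "(\<lambda>l\<in>scalar_domain f Z. to_fun f Z (T (ell2_unit [])) l * h l) = to_fun f Z (T x)"
      unfolding x(2) by (rule extensionalityI[OF _ to_fun_extensional]) (simp_all add: s[OF x(1)])
    then show "(\<lambda>l\<in>scalar_domain f Z. to_fun f Z (T (ell2_unit [])) l * h l) \<in> hardy f Z"
      unfolding hardy_def using bopsD(1)[OF Tb x(1)] by simp
  qed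
  show "mult_op (to_fun f Z (T (ell2_unit []))) = T"
  proof (rule extensionalityI[where A = symm_space])
    show "T \<in> extensional symm_space" by (rule bopsD(4)[OF Tb])
    show "mult_op (to_fun f Z (T (ell2_unit []))) x = T x" if "x \<in> symm_space" for x
      by (rule mult_op_eqI[OF m that bopsD(1)[OF Tb that] s[OF that]])
  qed (simp add: mult_op_def)
qed

lemma symbol_mult_op:
  assumes "\<phi> \<in> multipliers f Z"
  shows "to_fun f Z (mult_op \<phi> (ell2_unit [])) = \<phi>"
proof -
  have "\<phi> \<in> extensional (scalar_domain f Z)" using assms by (simp add: multipliers_def)
  then show ?thesis
    unfolding mult_op(2)[OF assms unit_in_symm_space]
    by (intro extensionalityI[where A = "scalar_domain f Z"]) (simp_all add: unit_symbol)
qed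

text \<open>An element of \<open>mult_ops\<close> is determined by its value at 1, so each algebraic
  identity for \<open>mult_op\<close> reduces to one computation at 1.\<close>

lemma multipliersI:
  assumes "T \<in> mult_ops" "\<And>l. l \<in> scalar_domain f Z \<Longrightarrow> to_fun f Z (T (ell2_unit [])) l = \<phi> l"
  shows "(\<lambda>l\<in>scalar_domain f Z. \<phi> l) \<in> multipliers f Z" "mult_op (\<lambda>l\<in>scalar_domain f Z. \<phi> l) = T"
proof -
  have "(\<lambda>l\<in>scalar_domain f Z. \<phi> l) = to_fun f Z (T (ell2_unit []))"
    by (rule extensionalityI[where A = "scalar_domain f Z"]) (simp_all add: assms(2), simp add: to_fun_def)
  then show "(\<lambda>l\<in>scalar_domain f Z. \<phi> l) \<in> multipliers f Z" "mult_op (\<lambda>l\<in>scalar_domain f Z. \<phi> l) = T"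
    using symbol_of_mult_ops[OF assms(1)] by simp_all
qed

lemma mult_op_algebra:
  assumes \<phi>: "\<phi> \<in> multipliers f Z"
  shows "\<psi> \<in> multipliers f Z \<Longrightarrow> mult_op (\<lambda>l\<in>scalar_domain f Z. \<phi> l + \<psi> l)
      = (\<lambda>x\<in>symm_space. mult_op \<phi> x + mult_op \<psi> x)"
    and "\<psi> \<in> multipliers f Z \<Longrightarrow> mult_op (\<lambda>l\<in>scalar_domain f Z. \<phi> l * \<psi> l)
      = compose symm_space (mult_op \<phi>) (mult_op \<psi>)"
    and "mult_op (\<lambda>l\<in>scalar_domain f Z. c * \<phi> l) = (\<lambda>x\<in>symm_space. c *\<^sub>C mult_op \<phi> x)"
proof -
  note D = subalgebraD[OF mult_ops_unital_subalgebra]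
  note m = mult_op_in_mult_ops
  have s: "to_fun f Z (mult_op \<phi> x) l = \<phi> l * to_fun f Z x l"
    if "\<phi> \<in> multipliers f Z" "x \<in> symm_space" "l \<in> scalar_domain f Z" for \<phi> x l
    using mult_op(2)[OF that(1,2)] that(3) by simp
  have add: "to_fun f Z (x + y) l = to_fun f Z x l + to_fun f Z y l"
    and scale: "to_fun f Z (c *\<^sub>C x) l = c * to_fun f Z x l"
    if "l \<in> scalar_domain f Z" for x y c l
    using that by (simp_all add: to_fun_eq cinner_add_left cinner_scaleC_left)
  show "mult_op (\<lambda>l\<in>scalar_domain f Z. \<phi> l + \<psi> l) = (\<lambda>x\<in>symm_space. mult_op \<phi> x + mult_op \<psi> x)"
    if \<psi>: "\<psi> \<in> multipliers f Z"
    by (rule multipliersI(2)[OF D(3)[OF m[OF \<phi>] m[OF \<psi>]]])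
      (simp add: unit_in_symm_space add s \<phi> \<psi> unit_symbol)
  show "mult_op (\<lambda>l\<in>scalar_domain f Z. \<phi> l * \<psi> l) = compose symm_space (mult_op \<phi>) (mult_op \<psi>)"
    if \<psi>: "\<psi> \<in> multipliers f Z"
    by (rule multipliersI(2)[OF D(5)[OF m[OF \<phi>] m[OF \<psi>]]])
      (simp add: compose_def unit_in_symm_space mult_op(1) s \<phi> \<psi> unit_symbol)
  show "mult_op (\<lambda>l\<in>scalar_domain f Z. c * \<phi> l) = (\<lambda>x\<in>symm_space. c *\<^sub>C mult_op \<phi> x)"
    by (rule multipliersI(2)[OF D(4)[OF m[OF \<phi>]]])
      (simp add: unit_in_symm_space scale s \<phi> unit_symbol)
qed

lemma mult_op_one: "mult_op (\<lambda>l\<in>scalar_domain f Z. 1) = (\<lambda>x\<in>symm_space. x)"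
  by (rule multipliersI(2)[OF subalgebraD(2)[OF mult_ops_unital_subalgebra]])
    (simp add: unit_in_symm_space unit_symbol)

lemma bij_betw_mult_op: "bij_betw mult_op (multipliers f Z) (Hinf_symm M)"
  unfolding Hinf_symm_eq
  by (rule bij_betw_byWitness[where f' = "\<lambda>T. to_fun f Z (T (ell2_unit []))"])
    (auto simp: symbol_mult_op symbol_of_mult_ops mult_op_in_mult_ops)

text \<open>The orthogonal complement of a kernel vector is an invariant subspace of every multiplier.\<close>

theorem reflexive_Hinf_symm: "reflexive_algebra symm_space (Hinf_symm M)"
  unfolding reflexive_algebra_def Hinf_symm_eq
proof
  let ?A = "mult_ops :: ('n list ell2 \<Rightarrow> 'n list ell2) set"
  show "?A \<subseteq> Alg symm_space (Lat symm_space ?A)"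
  proof
    fix S :: "'n list ell2 \<Rightarrow> 'n list ell2" assume S: "S \<in> mult_ops"
    then have "S \<in> bops symm_space" by (simp add: mult_ops_def)
    moreover have "\<forall>N\<in>Lat symm_space mult_ops. S ` N \<subseteq> N" using S unfolding Lat_def by blast
    ultimately show "S \<in> Alg symm_space (Lat symm_space mult_ops)" unfolding Alg_def by blast
  qed
  show "Alg symm_space (Lat symm_space ?A) \<subseteq> ?A"
  proof
    fix T :: "'n list ell2 \<Rightarrow> 'n list ell2"
    assume T: "T \<in> Alg symm_space (Lat symm_space mult_ops)"
    show "T \<in> mult_ops"
      unfolding mult_ops_def
    proof (intro CollectI conjI ballI impI)
      show "T \<in> bops symm_space" using T by (simp add: Alg_def)
      fix x :: "'n list ell2" and z :: "'n \<Rightarrow> complex"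
      assume x: "x \<in> symm_space" and z: "z \<in> cunit_ball" and 0: "cinner x (kernel_vec z) = 0"
      let ?N = "symm_space \<inter> {x. cinner x (kernel_vec z) = 0}"
      have "?N \<in> Lat symm_space mult_ops"
        unfolding Lat_def
      proof (intro CollectI conjI ballI)
        show "csubspace ?N" using csubspace_symm_space
          by (auto simp: csubspace_def cinner_add_left cinner_scaleC_left)
        show "closed ?N"
          by (intro closed_Int closed_symm_space closed_Collect_eq linear_continuous_on
              bounded_linear_cinner_left continuous_on_const)
        show "S ` ?N \<subseteq> ?N" if "S \<in> mult_ops" for S
          using that z by (auto simp: mult_ops_def bopsD(1))
      qed auto
      with conjunct2[OF CollectD[OF T[unfolded Alg_def]]] have "T ` ?N \<subseteq> ?N" by (rule bspec)
      then show "cinner (T x) (kernel_vec z) = 0" using x 0 by blast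
    qed
  qed
qed

end

subsection \<open>Formal power series and composition\<close>

lemma nc_mult_one_left: "nc_mult nc_one p = p"
proof
  fix w
  have "nc_mult nc_one p w = (\<Sum>k\<le>length w. if k = 0 then p (drop k w) else 0)"
    unfolding nc_mult_def by (intro sum.cong refl) (auto simp: nc_one_def)
  then show "nc_mult nc_one p w = p w" by simp
qed

lemma nc_mult_one_right: "nc_mult p nc_one = p"
proof
  fix w
  have "nc_mult p nc_one w = (\<Sum>k\<le>length w. if k = length w then p (take k w) else 0)"
    unfolding nc_mult_def by (intro sum.cong refl) (auto simp: nc_one_def)
  then show "nc_mult p nc_one w = p w" by simp
qed

text \<open>Both sides sum over the ways to cut \<open>w\<close> into three consecutive pieces,
  described once by the two cut positions and once by the first cut and the length of the middle
  piece.\<close>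

lemma nc_mult_assoc: "nc_mult (nc_mult p q) r = nc_mult p (nc_mult q r)"
proof
  fix w :: "'a list"
  let ?n = "length w"
  have "nc_mult (nc_mult p q) r w = (\<Sum>k\<le>?n. \<Sum>j\<le>k.
      p (take j w) * q (take (k - j) (drop j w)) * r (drop k w))"
    unfolding nc_mult_def sum_distrib_right
    by (intro sum.cong refl) (simp_all add: min_absorb1 min_absorb2 drop_take)
  also have "\<dots> = (\<Sum>(k, j)\<in>Sigma {..?n} (\<lambda>k. {..k}).
      p (take j w) * q (take (k - j) (drop j w)) * r (drop k w))"
    by (rule sum.Sigma) auto
  also have "\<dots> = (\<Sum>(j, m)\<in>Sigma {..?n} (\<lambda>j. {..?n - j}).
      p (take j w) * (q (take m (drop j w)) * r (drop m (drop j w))))"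
    by (rule sum.reindex_bij_witness[where i = "\<lambda>(j, m). (j + m, j)" and j = "\<lambda>(k, j). (j, k - j)"])
      (auto simp: mult.assoc)
  also have "\<dots> = (\<Sum>j\<le>?n. \<Sum>m\<le>?n - j. p (take j w) * (q (take m (drop j w)) * r (drop m (drop j w))))"
    by (rule sum.Sigma[symmetric]) auto
  also have "\<dots> = nc_mult p (nc_mult q r) w"
    unfolding nc_mult_def by (simp add: sum_distrib_left)
  finally show "nc_mult (nc_mult p q) r w = nc_mult p (nc_mult q r) w" .
qed

lemma nc_word_append: "nc_word f (\<alpha> @ \<beta>) = nc_mult (nc_word f \<alpha>) (nc_word f \<beta>)"
  by (induction \<alpha>) (simp_all add: nc_mult_one_left nc_mult_assoc)

lemma nc_word_var: "nc_word nc_var \<alpha> = (\<lambda>w. if w = \<alpha> then 1 else 0)"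
proof (induction \<alpha>)
  case (Cons i \<alpha>)
  show ?case
  proof
    fix w
    have "nc_word nc_var (i # \<alpha>) w
        = (\<Sum>k\<le>length w. if k = 1 then (if w = i # \<alpha> then 1 else 0) else 0)"
      unfolding nc_word.simps Cons.IH nc_mult_def
    proof (intro sum.cong refl)
      fix k assume "k \<in> {..length w}"
      then show "nc_var i (take k w) * (if drop k w = \<alpha> then 1 else 0)
          = (if k = 1 then (if w = i # \<alpha> then 1 else 0) else 0)"
        by (cases w; cases k) (auto simp: nc_var_def)
    qed
    also have "\<dots> = (if 1 \<in> {..length w} then (if w = i # \<alpha> then 1 else 0) else 0)"
      by (rule sum.delta) simp
    finally show "nc_word nc_var (i # \<alpha>) w = (if w = i # \<alpha> then 1 else 0)" by (cases w) auto
  qed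
qed (simp add: nc_one_def fun_eq_iff)

text \<open>The sum in \<open>nc_comp\<close> would default to 0 over an infinite support; this
  condition makes every coefficient a genuine finite sum.\<close>

definition nc_summable :: "'n ncfps \<Rightarrow> ('n \<Rightarrow> 'n ncfps) \<Rightarrow> bool"
  where "nc_summable c f \<longleftrightarrow> (\<forall>w. finite {\<alpha>. c \<alpha> * nc_word f \<alpha> w \<noteq> 0})"

lemma nc_comp_eq_sum:
  assumes "finite F" "\<And>\<alpha>. \<alpha> \<notin> F \<Longrightarrow> c \<alpha> * nc_word f \<alpha> w = 0"
  shows "nc_comp c f w = (\<Sum>\<alpha>\<in>F. c \<alpha> * nc_word f \<alpha> w)"
  unfolding nc_comp_def by (rule sum.mono_neutral_left) (use assms in auto)

lemma nc_comp_diff: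
  assumes "nc_summable a f" "nc_summable b f"
  shows "nc_comp (\<lambda>\<alpha>. a \<alpha> - b \<alpha>) f w = nc_comp a f w - nc_comp b f w"
proof -
  let ?F = "{\<alpha>. a \<alpha> * nc_word f \<alpha> w \<noteq> 0} \<union> {\<alpha>. b \<alpha> * nc_word f \<alpha> w \<noteq> 0}"
  have "finite ?F" using assms by (simp add: nc_summable_def)
  then have "nc_comp a f w = (\<Sum>\<alpha>\<in>?F. a \<alpha> * nc_word f \<alpha> w)"
    "nc_comp b f w = (\<Sum>\<alpha>\<in>?F. b \<alpha> * nc_word f \<alpha> w)"
    "nc_comp (\<lambda>\<alpha>. a \<alpha> - b \<alpha>) f w = (\<Sum>\<alpha>\<in>?F. (a \<alpha> - b \<alpha>) * nc_word f \<alpha> w)"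
    by (auto intro!: nc_comp_eq_sum)
  then show ?thesis by (simp add: left_diff_distrib sum_subtractf)
qed

lemma nc_comp_unit: "nc_comp (ell2_nth (ell2_unit \<beta>)) f = nc_word f \<beta>"
  by (rule ext) (subst nc_comp_eq_sum[where F = "{\<beta>}"]; simp add: ell2_nth_unit)

text \<open>Only words ending in \<beta> contribute, and \<open>nc_word\<close> turns concatenation
  into multiplication. The lemma interprets the right-hand side of \<open>M_unit\<close> in cases
  (A) and (S).\<close>

lemma nc_comp_right_shift:
  assumes "nc_summable (ell2_nth a) f"
  shows "nc_comp (ell2_nth (right_shift \<beta> a)) f = nc_mult (nc_comp (ell2_nth a) f) (nc_word f \<beta>)"
proof
  fix w
  \<comment> \<open>Collects the words that contribute at some prefix of \<open>w\<close>, so that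
    one finite index set serves every cut position.\<close>
  define F where "F = (\<Union>k\<le>length w. {\<alpha>. ell2_nth a \<alpha> * nc_word f \<alpha> (take k w) \<noteq> 0})"
  have F: "finite F" using assms by (simp add: F_def nc_summable_def)
  have out: "ell2_nth a \<gamma> * nc_word f \<gamma> (take k w) = 0" if "\<gamma> \<notin> F" "k \<le> length w" for \<gamma> k
    using that by (auto simp: F_def)
  have "nc_comp (ell2_nth (right_shift \<beta> a)) f w
      = (\<Sum>\<alpha>\<in>(\<lambda>\<gamma>. \<gamma> @ \<beta>) ` F. ell2_nth (right_shift \<beta> a) \<alpha> * nc_word f \<alpha> w)"
  proof (rule nc_comp_eq_sum)
    fix \<alpha> assume \<alpha>: "\<alpha> \<notin> (\<lambda>\<gamma>. \<gamma> @ \<beta>) ` F"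
    show "ell2_nth (right_shift \<beta> a) \<alpha> * nc_word f \<alpha> w = 0"
    proof (cases "\<alpha> \<in> range (\<lambda>\<gamma>. \<gamma> @ \<beta>)")
      case True
      then obtain \<gamma> where \<gamma>: "\<alpha> = \<gamma> @ \<beta>" "\<gamma> \<notin> F" using \<alpha> by blast
      then show ?thesis
        by (auto simp: nc_word_append nc_mult_def sum_distrib_left out[OF \<gamma>(2)] simp flip: mult.assoc)
    qed (simp add: ell2_nth_right_shift_notin)
  qed (simp add: F)
  also have "\<dots> = (\<Sum>\<gamma>\<in>F. ell2_nth a \<gamma> * nc_word f (\<gamma> @ \<beta>) w)"
    by (subst sum.reindex) (auto simp: inj_on_def)
  also have "\<dots> = (\<Sum>k\<le>length w. \<Sum>\<gamma>\<in>F. ell2_nth a \<gamma> * nc_word f \<gamma> (take k w) * nc_word f \<beta> (drop k w))"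
    by (subst sum.swap) (simp add: nc_word_append nc_mult_def sum_distrib_left mult.assoc)
  also have "\<dots> = (\<Sum>k\<le>length w. nc_comp (ell2_nth a) f (take k w) * nc_word f \<beta> (drop k w))"
    by (intro sum.cong refl) (subst nc_comp_eq_sum[OF F out]; simp add: sum_distrib_right)
  finally show "nc_comp (ell2_nth (right_shift \<beta> a)) f w
      = nc_mult (nc_comp (ell2_nth a) f) (nc_word f \<beta>) w" by (simp add: nc_mult_def)
qed

lemma nc_word_single: "nc_word f [j] = f j"
  by (simp add: nc_mult_one_right)

subsection \<open>The polynomial case\<close>

lemma nc_polynomial_summable: "nc_polynomial c \<Longrightarrow> nc_summable c f"
  unfolding nc_summable_def nc_polynomial_def
  by (intro allI) (erule rev_finite_subset, auto)

lemma nc_polynomial_mult: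
  assumes "nc_polynomial p" "nc_polynomial q"
  shows "nc_polynomial (nc_mult p q)"
  unfolding nc_polynomial_def
proof (rule finite_subset)
  show "{w. nc_mult p q w \<noteq> 0} \<subseteq> (\<lambda>(u, v). u @ v) ` ({w. p w \<noteq> 0} \<times> {w. q w \<noteq> 0})"
  proof
    fix w assume "w \<in> {w. nc_mult p q w \<noteq> 0}"
    then obtain k where "p (take k w) * q (drop k w) \<noteq> 0"
      unfolding nc_mult_def by (auto elim: sum.not_neutral_contains_not_neutral)
    then show "w \<in> (\<lambda>(u, v). u @ v) ` ({w. p w \<noteq> 0} \<times> {w. q w \<noteq> 0})"
      by (intro image_eqI[of _ _ "(take k w, drop k w)"]) auto
  qed
qed (use assms in \<open>simp add: nc_polynomial_def\<close>)

lemma nc_polynomial_word: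
  assumes "\<And>i. nc_polynomial (f i)"
  shows "nc_polynomial (nc_word f \<alpha>)"
proof (induction \<alpha>)
  case (Cons i \<alpha>)
  show ?case unfolding nc_word.simps by (rule nc_polynomial_mult[OF assms Cons.IH])
qed (simp add: nc_polynomial_def nc_one_def)

text \<open>After \<open>nc_word_append\<close> both sides are sums over pairs \<open>u\<close>,
  \<open>v\<close> of support words and a cut position of \<open>w\<close>; grouping the pairs by
  their concatenation gives the left-hand side.\<close>

lemma nc_comp_mult:
  assumes p: "nc_polynomial p" and q: "nc_polynomial q"
  shows "nc_comp (nc_mult p q) g = nc_mult (nc_comp p g) (nc_comp q g)"
proof
  fix w
  let ?P = "{w. p w \<noteq> 0}" and ?Q = "{w. q w \<noteq> 0}"
  let ?G = "(\<lambda>(u, v). u @ v) ` (?P \<times> ?Q)"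
  have fin: "finite ?P" "finite ?Q" using p q by (simp_all add: nc_polynomial_def)
  have coef: "nc_mult p q \<gamma> = (\<Sum>(u, v) | (u, v) \<in> ?P \<times> ?Q \<and> u @ v = \<gamma>. p u * q v)" for \<gamma>
  proof -
    have "nc_mult p q \<gamma> = (\<Sum>k | k \<le> length \<gamma> \<and> p (take k \<gamma>) \<noteq> 0 \<and> q (drop k \<gamma>) \<noteq> 0.
        p (take k \<gamma>) * q (drop k \<gamma>))"
      unfolding nc_mult_def by (rule sum.mono_neutral_right) auto
    also have "\<dots> = (\<Sum>(u, v) | (u, v) \<in> ?P \<times> ?Q \<and> u @ v = \<gamma>. p u * q v)"
      by (rule sum.reindex_bij_witness[where i = "\<lambda>(u, v). length u" and j = "\<lambda>k. (take k \<gamma>, drop k \<gamma>)"])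
        auto
    finally show ?thesis .
  qed
  have 0: "nc_mult p q \<gamma> = 0" if "\<gamma> \<notin> ?G" for \<gamma>
    unfolding coef by (rule sum.neutral) (use that in auto)
  have "nc_comp (nc_mult p q) g w = (\<Sum>\<gamma>\<in>?G. nc_mult p q \<gamma> * nc_word g \<gamma> w)"
    by (rule nc_comp_eq_sum) (use fin 0 in auto)
  also have "\<dots> = (\<Sum>\<gamma>\<in>?G. \<Sum>x | x \<in> ?P \<times> ?Q \<and> (\<lambda>(u, v). u @ v) x = \<gamma>.
      (\<lambda>(u, v). p u * q v * nc_word g (u @ v) w) x)"
    unfolding coef sum_distrib_right by (intro sum.cong refl) (auto simp: case_prod_unfold)
  also have "\<dots> = (\<Sum>(u, v)\<in>?P \<times> ?Q. p u * q v * nc_word g (u @ v) w)"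
    by (rule sum.image_gen[symmetric]) (use fin in auto)
  also have "\<dots> = (\<Sum>x\<in>?P \<times> ?Q. \<Sum>k\<le>length w.
      (p (fst x) * nc_word g (fst x) (take k w)) * (q (snd x) * nc_word g (snd x) (drop k w)))"
    by (simp add: nc_word_append nc_mult_def sum_distrib_left case_prod_unfold mult_ac)
  also have "\<dots> = (\<Sum>k\<le>length w. \<Sum>(u, v)\<in>?P \<times> ?Q.
      (p u * nc_word g u (take k w)) * (q v * nc_word g v (drop k w)))"
    by (subst sum.swap) (simp add: case_prod_unfold)
  also have "\<dots> = (\<Sum>k\<le>length w. nc_comp p g (take k w) * nc_comp q g (drop k w))"
  proof (intro sum.cong refl)
    fix k
    have "nc_comp p g (take k w) = (\<Sum>u\<in>?P. p u * nc_word g u (take k w))"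
      "nc_comp q g (drop k w) = (\<Sum>v\<in>?Q. q v * nc_word g v (drop k w))"
      using fin by (auto intro!: nc_comp_eq_sum)
    then show "(\<Sum>(u, v)\<in>?P \<times> ?Q. (p u * nc_word g u (take k w)) * (q v * nc_word g v (drop k w)))
        = nc_comp p g (take k w) * nc_comp q g (drop k w)"
      by (simp add: sum_product sum.cartesian_product)
  qed
  finally show "nc_comp (nc_mult p q) g w = nc_mult (nc_comp p g) (nc_comp q g) w"
    by (simp add: nc_mult_def)
qed

lemma nc_comp_one: "nc_comp nc_one g = nc_one"
  by (rule ext) (subst nc_comp_eq_sum[where F = "{[]}"]; simp add: nc_one_def)

lemma nc_comp_word:
  assumes "\<And>i. nc_polynomial (f i)"
  shows "nc_comp (nc_word f \<alpha>) g = nc_word (\<lambda>i. nc_comp (f i) g) \<alpha>"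
  by (induction \<alpha>) (simp_all add: nc_comp_one nc_comp_mult nc_polynomial_word assms)

text \<open>As substitution is multiplicative, f_\<alpha> composed with \<open>g\<close> is the
  monomial Z_\<alpha>. The consequence used is that a polynomial is determined by its composition
  with \<open>f\<close>.\<close>

lemma nc_comp_inverse:
  assumes f: "\<And>i. nc_polynomial (f i)" and c: "nc_polynomial c"
    and inv: "\<And>i. nc_comp (f i) g = nc_var i"
  shows "nc_comp (nc_comp c f) g = c"
proof
  fix w
  let ?C = "{\<alpha>. c \<alpha> \<noteq> 0}"
  let ?W = "\<Union>\<alpha>\<in>?C. {u. nc_word f \<alpha> u \<noteq> 0}"
  have C: "finite ?C" using c by (simp add: nc_polynomial_def)
  have W: "finite ?W" using C nc_polynomial_word[of f, OF f] by (auto simp: nc_polynomial_def)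
  have cf: "nc_comp c f u = (\<Sum>\<alpha>\<in>?C. c \<alpha> * nc_word f \<alpha> u)" for u
    by (rule nc_comp_eq_sum[OF C]) auto
  have "nc_comp (nc_comp c f) g w = (\<Sum>u\<in>?W. nc_comp c f u * nc_word g u w)"
  proof (rule nc_comp_eq_sum[OF W])
    fix u assume "u \<notin> ?W"
    then have "nc_comp c f u = 0" unfolding cf by (intro sum.neutral) auto
    then show "nc_comp c f u * nc_word g u w = 0" by simp
  qed
  also have "\<dots> = (\<Sum>u\<in>?W. \<Sum>\<alpha>\<in>?C. c \<alpha> * (nc_word f \<alpha> u * nc_word g u w))"
    by (simp add: cf sum_distrib_right mult.assoc)
  also have "\<dots> = (\<Sum>\<alpha>\<in>?C. \<Sum>u\<in>?W. c \<alpha> * (nc_word f \<alpha> u * nc_word g u w))" by (rule sum.swap)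
  also have "\<dots> = (\<Sum>\<alpha>\<in>?C. c \<alpha> * nc_comp (nc_word f \<alpha>) g w)"
  proof (intro sum.cong refl)
    fix \<alpha> assume "\<alpha> \<in> ?C"
    then have "nc_comp (nc_word f \<alpha>) g w = (\<Sum>u\<in>?W. nc_word f \<alpha> u * nc_word g u w)"
      by (intro nc_comp_eq_sum[OF W]) auto
    then show "(\<Sum>u\<in>?W. c \<alpha> * (nc_word f \<alpha> u * nc_word g u w)) = c \<alpha> * nc_comp (nc_word f \<alpha>) g w"
      by (simp add: sum_distrib_left)
  qed
  also have "\<dots> = (\<Sum>\<alpha>\<in>?C. if w = \<alpha> then c \<alpha> else 0)"
    unfolding nc_comp_word[of f, OF f] inv nc_word_var by (intro sum.cong) auto
  also have "\<dots> = c w" using C by simp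
  finally show "nc_comp (nc_comp c f) g w = c w" .
qed

lemma nc_polynomial_unit: "nc_polynomial (ell2_nth (ell2_unit \<beta>))"
  by (simp add: nc_polynomial_def ell2_nth_unit)

lemma nc_polynomial_right_shift:
  assumes "nc_polynomial (ell2_nth a)"
  shows "nc_polynomial (ell2_nth (right_shift \<beta> a))"
  unfolding nc_polynomial_def
proof (rule finite_subset)
  show "{w. ell2_nth (right_shift \<beta> a) w \<noteq> 0} \<subseteq> (\<lambda>\<gamma>. \<gamma> @ \<beta>) ` {w. ell2_nth a w \<noteq> 0}"
  proof
    fix w assume w: "w \<in> {w. ell2_nth (right_shift \<beta> a) w \<noteq> 0}"
    then obtain \<gamma> where "w = \<gamma> @ \<beta>" using ell2_nth_right_shift_notin by blast
    with w show "w \<in> (\<lambda>\<gamma>. \<gamma> @ \<beta>) ` {w. ell2_nth a w \<noteq> 0}" by simp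
  qed
qed (use assms in \<open>simp add: nc_polynomial_def\<close>)

lemma nc_comp_sum_scaleC:
  assumes "finite A" "\<And>a. a \<in> A \<Longrightarrow> nc_polynomial (ell2_nth (x a))"
  shows "nc_polynomial (ell2_nth (\<Sum>a\<in>A. c a *\<^sub>C x a))"
    and "nc_comp (ell2_nth (\<Sum>a\<in>A. c a *\<^sub>C x a)) f w = (\<Sum>a\<in>A. c a * nc_comp (ell2_nth (x a)) f w)"
proof -
  let ?F = "\<Union>a\<in>A. {\<alpha>. ell2_nth (x a) \<alpha> \<noteq> 0}"
  have F: "finite ?F" using assms by (auto simp: nc_polynomial_def)
  have nth: "ell2_nth (\<Sum>a\<in>A. c a *\<^sub>C x a) \<alpha> = (\<Sum>a\<in>A. c a * ell2_nth (x a) \<alpha>)" for \<alpha>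
    by (simp add: ell2_nth_sum scaleC_ell2.rep_eq)
  have out: "ell2_nth (\<Sum>a\<in>A. c a *\<^sub>C x a) \<alpha> = 0" if "\<alpha> \<notin> ?F" for \<alpha>
    using that by (simp add: nth)
  then show "nc_polynomial (ell2_nth (\<Sum>a\<in>A. c a *\<^sub>C x a))"
    unfolding nc_polynomial_def by (intro finite_subset[OF _ F]) blast
  have "nc_comp (ell2_nth (\<Sum>a\<in>A. c a *\<^sub>C x a)) f w
      = (\<Sum>\<alpha>\<in>?F. ell2_nth (\<Sum>a\<in>A. c a *\<^sub>C x a) \<alpha> * nc_word f \<alpha> w)"
    by (rule nc_comp_eq_sum[OF F]) (simp add: out)
  also have "\<dots> = (\<Sum>a\<in>A. \<Sum>\<alpha>\<in>?F. c a * (ell2_nth (x a) \<alpha> * nc_word f \<alpha> w))"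
    by (subst sum.swap) (simp add: nth sum_distrib_right mult.assoc)
  also have "\<dots> = (\<Sum>a\<in>A. c a * nc_comp (ell2_nth (x a)) f w)"
  proof (intro sum.cong refl)
    fix a assume "a \<in> A"
    then have "nc_comp (ell2_nth (x a)) f w = (\<Sum>\<alpha>\<in>?F. ell2_nth (x a) \<alpha> * nc_word f \<alpha> w)"
      by (intro nc_comp_eq_sum[OF F]) auto
    then show "(\<Sum>\<alpha>\<in>?F. c a * (ell2_nth (x a) \<alpha> * nc_word f \<alpha> w)) = c a * nc_comp (ell2_nth (x a)) f w"
      by (simp add: sum_distrib_left)
  qed
  finally show "nc_comp (ell2_nth (\<Sum>a\<in>A. c a *\<^sub>C x a)) f w = (\<Sum>a\<in>A. c a * nc_comp (ell2_nth (x a)) f w)" .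
qed

lemma model_A_universal:
  fixes f :: "'n::finite \<Rightarrow> 'n ncfps"
  assumes "model_A f Z M"
  shows "\<exists>Y. universal_model f Z M Y"
proof -
  from assms obtain g where
    f: "\<And>j. nc_polynomial (f j)" and fg: "\<And>i. nc_comp (f i) g = nc_var i"
    and Z: "\<And>i. nc_polynomial (ell2_nth (Z i))" "\<And>i. nc_comp (ell2_nth (Z i)) f = nc_var i"
    and Mb: "\<And>i. M i \<in> bops UNIV"
    and M: "\<And>i c. nc_polynomial (ell2_nth c) \<Longrightarrow> nc_polynomial (ell2_nth (M i c))"
      "\<And>i c. nc_polynomial (ell2_nth c) \<Longrightarrow>
        nc_comp (ell2_nth (M i c)) f = nc_mult (nc_var i) (nc_comp (ell2_nth c) f)"
    unfolding model_A_def by metis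
  have inj: "x = y" if "nc_polynomial (ell2_nth x)" "nc_polynomial (ell2_nth y)"
    "nc_comp (ell2_nth x) f = nc_comp (ell2_nth y) f" for x y :: "'n list ell2"
    using nc_comp_inverse[of f "ell2_nth x" g, OF f that(1) fg]
      nc_comp_inverse[of f "ell2_nth y" g, OF f that(2) fg] that(3)
    by (metis ell2_nth_inject)
  have M_opt: "M \<in> optuples" by (simp add: optuples_def Mb)
  \<comment> \<open>Words in the \<open>M i\<close> applied to 1 represent the monomials, hence
    f_j(M) applied to 1 represents f_j itself.\<close>
  have word: "nc_polynomial (ell2_nth (word_op M \<alpha> (ell2_unit [])))
      \<and> nc_comp (ell2_nth (word_op M \<alpha> (ell2_unit []))) f = nc_word nc_var \<alpha>" for \<alpha>
    by (induction \<alpha>) (simp_all add: nc_polynomial_unit nc_comp_unit M)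
  have "finite (length ` (\<Union>j. {w. f j w \<noteq> 0}))"
    using f by (simp add: nc_polynomial_def)
  then obtain N where "\<forall>k\<in>length ` (\<Union>j. {w. f j w \<noteq> 0}). k \<le> N"
    using finite_nat_set_iff_bounded_le by blast
  then have N: "f j w = 0" if "length w > N" for j w using that by fastforce
  \<comment> \<open>The f_j are polynomials, so a partial sum beyond all their degrees is already
    f_j(M), and the convergence condition holds because the partial sums are eventually
    constant.\<close>
  define Y where "Y j = partial_sum (f j) M (Suc N)" for j
  have const: "partial_sum (f j) M m h = Y j h" if "m \<ge> Suc N" for m j h
    unfolding Y_def partial_sum_eq
    by (rule sum.mono_neutral_right) (use that in \<open>auto simp: N\<close>)
  show ?thesis
  proof (rule exI[of _ Y], unfold_locales)
    show "M i \<in> bops UNIV" for i by (rule Mb)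
    show "M i (ell2_unit \<beta>) = right_shift \<beta> (Z i)" for i \<beta>
      by (rule inj) (simp_all add: M nc_polynomial_unit nc_polynomial_right_shift Z nc_comp_unit
          nc_comp_right_shift nc_polynomial_summable)
    have "sot_sums (f j) M (Y j)" for j
      unfolding sot_sums_def
    proof (intro conjI allI)
      show "Y j \<in> bops UNIV" unfolding Y_def by (rule partial_sum_bops[OF M_opt])
      show "(\<lambda>m. partial_sum (f j) M m h) \<longlonglongrightarrow> Y j h" for h
        by (rule tendsto_eventually, rule eventually_sequentiallyI[of "Suc N"], rule const)
    qed
    then show "conv_value f M Y" by (simp add: conv_value_def sot_value_def M_opt)
    show "Y j (ell2_unit []) = ell2_unit [j]" for j
    proof (rule inj)
      have Y: "Y j (ell2_unit []) = (\<Sum>\<alpha> | length \<alpha> < Suc N. f j \<alpha> *\<^sub>C word_op M \<alpha> (ell2_unit []))"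
        by (simp add: Y_def partial_sum_eq)
      show "nc_polynomial (ell2_nth (Y j (ell2_unit [])))"
        unfolding Y by (rule nc_comp_sum_scaleC(1)) (simp_all add: word)
      show "nc_comp (ell2_nth (Y j (ell2_unit []))) f = nc_comp (ell2_nth (ell2_unit [j])) f"
      proof
        fix w
        have "nc_comp (ell2_nth (Y j (ell2_unit []))) f w
            = (\<Sum>\<alpha> | length \<alpha> < Suc N. f j \<alpha> * nc_word nc_var \<alpha> w)"
          unfolding Y by (subst nc_comp_sum_scaleC(2)) (simp_all add: word)
        also have "\<dots> = (\<Sum>\<alpha> | length \<alpha> < Suc N. if w = \<alpha> then f j \<alpha> else 0)"
          unfolding nc_word_var by (intro sum.cong) auto
        also have "\<dots> = f j w" by (simp add: N)
        finally show "nc_comp (ell2_nth (Y j (ell2_unit []))) f w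
            = nc_comp (ell2_nth (ell2_unit [j])) f w"
          by (simp only: nc_comp_unit nc_word_single)
      qed
    qed (rule nc_polynomial_unit)
  qed
qed

subsection \<open>The formal power series case\<close>

text \<open>For words of equal length, an entry of the tensor power of the matrix
  \<open>J\<close>.\<close>

definition word_matrix :: "('n \<Rightarrow> 'n \<Rightarrow> complex) \<Rightarrow> 'n list \<Rightarrow> 'n list \<Rightarrow> complex"
  where "word_matrix J \<alpha> w = prod_list (map2 J \<alpha> w)"

lemma sum_words_Suc:
  fixes F :: "'n::finite list \<Rightarrow> 'b::comm_monoid_add"
  shows "(\<Sum>w | length w = Suc k. F w) = (\<Sum>i\<in>UNIV. \<Sum>w | length w = k. F (i # w))"
proof -
  have eq: "{w :: 'n list. length w = Suc k} = (\<lambda>(i, w). i # w) ` (UNIV \<times> {w. length w = k})"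
    by (auto simp: length_Suc_conv image_iff)
  show ?thesis
    unfolding eq by (subst sum.reindex) (auto simp: inj_on_def sum.cartesian_product case_prod_unfold)
qed

text \<open>The sum over words factors letter by letter, so tensor powers of inverse matrices are
  again inverse.\<close>

lemma word_matrix_inverse:
  fixes J K :: "'n::finite \<Rightarrow> 'n \<Rightarrow> complex"
  assumes JK: "\<And>i k. (\<Sum>j\<in>UNIV. J i j * K j k) = (if i = k then 1 else 0)"
    and "length \<alpha> = length \<beta>"
  shows "(\<Sum>w | length w = length \<alpha>. word_matrix J \<alpha> w * word_matrix K w \<beta>) = (if \<alpha> = \<beta> then 1 else 0)"
  using assms(2)
proof (induction \<alpha> \<beta> rule: list_induct2)
  case (Cons a \<alpha> b \<beta>)
  have "(\<Sum>w | length w = length (a # \<alpha>). word_matrix J (a # \<alpha>) w * word_matrix K w (b # \<beta>))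
      = (\<Sum>i\<in>UNIV. \<Sum>w | length w = length \<alpha>.
          (J a i * K i b) * (word_matrix J \<alpha> w * word_matrix K w \<beta>))"
    by (simp add: sum_words_Suc word_matrix_def mult_ac)
  also have "\<dots> = (\<Sum>i\<in>UNIV. J a i * K i b)
      * (\<Sum>w | length w = length \<alpha>. word_matrix J \<alpha> w * word_matrix K w \<beta>)"
    by (simp add: sum_product)
  finally show ?case by (simp add: JK Cons.IH)
qed (simp add: word_matrix_def)

text \<open>Each factor f_i lacks a constant term and therefore uses up at least one letter.\<close>

lemma nc_word_lower:
  assumes f0: "\<And>i. f i [] = 0"
  shows "length w < length \<alpha> \<Longrightarrow> nc_word f \<alpha> w = 0"
proof (induction \<alpha> arbitrary: w)
  case (Cons i \<alpha>)
  have "f i (take k w) * nc_word f \<alpha> (drop k w) = 0" if "k \<in> {..length w}" for k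
  proof (cases k)
    case (Suc m)
    then have "length (drop k w) < length \<alpha>" using Cons.prems that by simp
    then show ?thesis by (simp add: Cons.IH)
  qed (simp add: f0)
  then show ?case unfolding nc_word.simps nc_mult_def by (intro sum.neutral ballI)
qed simp

text \<open>In the lowest degree each factor has to take exactly one letter, so only the linear
  parts of the f_i contribute.\<close>

lemma nc_word_diagonal:
  assumes f0: "\<And>i. f i [] = 0"
  shows "length \<alpha> = length w \<Longrightarrow> nc_word f \<alpha> w = word_matrix (\<lambda>i j. f i [j]) \<alpha> w"
proof (induction \<alpha> w rule: list_induct2)
  case (Cons i \<alpha> j w)
  have "f i (take k (j # w)) * nc_word f \<alpha> (drop k (j # w))
      = (if k = 1 then f i [j] * nc_word f \<alpha> w else 0)" if "k \<le> length (j # w)" for k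
  proof (cases k)
    case 0 then show ?thesis by (simp add: f0)
  next
    case (Suc m)
    show ?thesis
    proof (cases m)
      case (Suc l)
      then have "length (drop m w) < length \<alpha>" using that Cons.hyps \<open>k = Suc m\<close> by simp
      then show ?thesis using \<open>k = Suc m\<close> Suc by (simp add: nc_word_lower[of f, OF f0])
    qed (simp add: Suc)
  qed
  then have "nc_word f (i # \<alpha>) (j # w)
      = (\<Sum>k\<le>length (j # w). if k = 1 then f i [j] * nc_word f \<alpha> w else 0)"
    by (simp only: nc_word.simps nc_mult_def) (intro sum.cong; simp)
  also have "\<dots> = (if 1 \<in> {..length (j # w)} then f i [j] * nc_word f \<alpha> w else 0)"
    by (rule sum.delta) simp
  finally show ?case using Cons.IH by (simp add: word_matrix_def)
qed (simp add: word_matrix_def nc_one_def)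

lemma nc_summable_lower:
  fixes f :: "'n::finite \<Rightarrow> 'n ncfps"
  assumes f0: "\<And>i. f i [] = 0"
  shows "nc_summable c f"
  unfolding nc_summable_def
proof
  fix w
  have "{\<alpha>. c \<alpha> * nc_word f \<alpha> w \<noteq> 0} \<subseteq> {\<alpha>. length \<alpha> < Suc (length w)}"
    using nc_word_lower[of f, OF f0] by (metis (mono_tags, lifting) Collect_mono mult_eq_0_iff not_less_eq)
  then show "finite {\<alpha>. c \<alpha> * nc_word f \<alpha> w \<noteq> 0}" by (rule finite_subset) simp
qed

text \<open>Composition with \<open>f\<close> is block triangular with respect to word length, and
  its diagonal blocks are tensor powers of the invertible matrix J_f(0). Induction on the length
  kills the coefficients one degree at a time.\<close>

lemma nc_comp_eq_0:
  fixes f :: "'n::finite \<Rightarrow> 'n ncfps"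
  assumes f0: "\<And>i. f i [] = 0"
    and det: "det (\<chi> i j. f i [j]) \<noteq> 0"
    and 0: "\<And>w. nc_comp c f w = 0"
  shows "c \<beta> = 0"
proof (induction "length \<beta>" arbitrary: \<beta> rule: less_induct)
  case less
  let ?J = "\<lambda>i j. f i [j]"
  obtain B where B: "(\<chi> i j. f i [j]) ** B = mat 1"
    using det invertible_det_nz[of "\<chi> i j. f i [j]"] by (auto simp: invertible_def)
  define K where "K i j = B $ i $ j" for i j
  have JK: "(\<Sum>j\<in>UNIV. ?J i j * K j k) = (if i = k then 1 else 0)" for i k
  proof -
    have "((\<chi> i j. f i [j]) ** B) $ i $ k = (\<Sum>j\<in>UNIV. ?J i j * K j k)"
      by (simp add: matrix_matrix_mult_def K_def)
    then show ?thesis unfolding B by (simp add: mat_def)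
  qed
  let ?L = "{\<alpha>. length \<alpha> = length \<beta>} :: 'n list set"
  have lead: "(\<Sum>\<alpha>\<in>?L. c \<alpha> * word_matrix ?J \<alpha> w) = 0" if w: "w \<in> ?L" for w
  proof -
    have "nc_comp c f w = (\<Sum>\<alpha>\<in>?L. c \<alpha> * nc_word f \<alpha> w)"
    proof (rule nc_comp_eq_sum)
      fix \<alpha> :: "'n list" assume "\<alpha> \<notin> ?L"
      then consider "length \<alpha> < length \<beta>" | "length w < length \<alpha>" using w by fastforce
      then show "c \<alpha> * nc_word f \<alpha> w = 0"
        by cases (simp_all add: less nc_word_lower[of f, OF f0])
    qed simp
    also have "\<dots> = (\<Sum>\<alpha>\<in>?L. c \<alpha> * word_matrix ?J \<alpha> w)"
      using w by (intro sum.cong refl) (simp add: nc_word_diagonal[of f, OF f0])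
    finally show ?thesis using 0 by simp
  qed
  have "0 = (\<Sum>w\<in>?L. (\<Sum>\<alpha>\<in>?L. c \<alpha> * word_matrix ?J \<alpha> w) * word_matrix K w \<beta>)"
    using lead by simp
  also have "\<dots> = (\<Sum>w\<in>?L. \<Sum>\<alpha>\<in>?L. c \<alpha> * (word_matrix ?J \<alpha> w * word_matrix K w \<beta>))"
    by (simp add: sum_distrib_right mult.assoc)
  also have "\<dots> = (\<Sum>\<alpha>\<in>?L. c \<alpha> * (\<Sum>w\<in>?L. word_matrix ?J \<alpha> w * word_matrix K w \<beta>))"
    by (subst sum.swap) (simp add: sum_distrib_left)
  also have "\<dots> = (\<Sum>\<alpha>\<in>?L. if \<alpha> = \<beta> then c \<alpha> else 0)"
  proof (intro sum.cong refl)
    fix \<alpha> assume "\<alpha> \<in> ?L"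
    then have "length \<alpha> = length \<beta>" by simp
    from word_matrix_inverse[of ?J K, OF JK this]
    show "c \<alpha> * (\<Sum>w\<in>?L. word_matrix ?J \<alpha> w * word_matrix K w \<beta>) = (if \<alpha> = \<beta> then c \<alpha> else 0)"
      using \<open>length \<alpha> = length \<beta>\<close> by simp
  qed
  also have "\<dots> = c \<beta>" by simp
  finally show ?case by simp
qed

lemma model_S_universal:
  fixes f :: "'n::finite \<Rightarrow> 'n ncfps"
  assumes "model_S f Z M"
  shows "\<exists>Y. universal_model f Z M Y"
proof -
  from assms obtain Y where f0: "\<And>j. f j [] = 0" and det: "det (\<chi> i j. f i [j]) \<noteq> 0"
    and Z: "\<And>i. nc_comp (ell2_nth (Z i)) f = nc_var i" and Mb: "\<And>i. M i \<in> bops UNIV"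
    and M: "\<And>i c. nc_comp (ell2_nth (M i c)) f = nc_mult (nc_var i) (nc_comp (ell2_nth c) f)"
    and conv: "conv_value f M Y"
    and Y: "\<And>j c. nc_comp (ell2_nth (Y j c)) f = nc_mult (f j) (nc_comp (ell2_nth c) f)"
    unfolding model_S_def model_conditions_def by metis
  have inj: "x = y" if "nc_comp (ell2_nth x) f = nc_comp (ell2_nth y) f" for x y :: "'n list ell2"
  proof (rule ell2_eqI)
    have "nc_comp (\<lambda>\<alpha>. ell2_nth x \<alpha> - ell2_nth y \<alpha>) f w = 0" for w
      by (simp add: nc_comp_diff nc_summable_lower f0 that)
    from nc_comp_eq_0[of f, OF f0 det this] show "ell2_nth x \<alpha> = ell2_nth y \<alpha>" for \<alpha> by simp
  qed
  show ?thesis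
  proof (rule exI[of _ Y], unfold_locales)
    show "M i \<in> bops UNIV" for i by (rule Mb)
    show "conv_value f M Y" by (rule conv)
    show "M i (ell2_unit \<beta>) = right_shift \<beta> (Z i)" for i \<beta>
      by (rule inj) (simp add: M nc_comp_unit nc_comp_right_shift nc_summable_lower f0 Z)
    show "Y j (ell2_unit []) = ell2_unit [j]" for j
      by (rule inj) (simp add: Y nc_comp_unit)
  qed
qed

subsection \<open>The free holomorphic case\<close>

lemma norm_row_le:
  fixes X :: "('n::finite, 'h::chilbert_space) optuple"
  assumes X: "X \<in> optuples"
  shows "norm (\<Sum>i\<in>UNIV. X i (h i)) \<le> row_norm X * L2_set (\<lambda>i. norm (h i)) UNIV"
proof -
  have "bounded_linear (\<lambda>h :: 'h ^ 'n. \<Sum>i\<in>UNIV. X i (h $ i))"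
    using X by (intro bounded_linear_sum bounded_linear_compose[OF bops_UNIV_bounded_linear
        bounded_linear_vec_nth]) (simp add: optuples_def)
  from onorm[OF this, of "\<chi> i. h i"] show ?thesis
    by (simp add: row_norm_def norm_vec_def)
qed

lemma row_norm_nonneg:
  fixes X :: "('n::finite, 'h::chilbert_space) optuple"
  assumes X: "X \<in> optuples"
  shows "0 \<le> row_norm X"
  unfolding row_norm_def
  using X by (intro onorm_pos_le bounded_linear_sum bounded_linear_compose[OF bops_UNIV_bounded_linear
      bounded_linear_vec_nth]) (simp add: optuples_def)

lemma word_op_append: "word_op X (\<alpha> @ \<beta>) = word_op X \<alpha> \<circ> word_op X \<beta>"
  by (induction \<alpha>) (simp_all add: comp_assoc)

text \<open>Splitting off the first letter exhibits the sum as the row operator applied to sums over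
  shorter words; the nested Euclidean norms then combine into one.\<close>

lemma norm_word_sum_le:
  fixes X :: "('n::finite, 'h::chilbert_space) optuple"
  assumes X: "X \<in> optuples"
  shows "norm (\<Sum>\<alpha> | length \<alpha> = k. word_op X \<alpha> (h \<alpha>))
    \<le> row_norm X ^ k * L2_set (\<lambda>\<alpha>. norm (h \<alpha>)) {\<alpha>. length \<alpha> = k}"
proof (induction k arbitrary: h)
  case 0
  have "{\<alpha> :: 'n list. length \<alpha> = 0} = {[]}" by auto
  then show ?case by (simp add: L2_set_def)
next
  case (Suc k)
  let ?L = "{\<alpha> :: 'n list. length \<alpha> = k}"
  let ?s = "\<lambda>i. \<Sum>\<alpha>\<in>?L. word_op X \<alpha> (h (i # \<alpha>))"
  have bl: "linear (X i)" for i
    using X by (intro bounded_linear.linear bops_UNIV_bounded_linear) (simp add: optuples_def)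
  have "(\<Sum>\<alpha> | length \<alpha> = Suc k. word_op X \<alpha> (h \<alpha>)) = (\<Sum>i\<in>UNIV. X i (?s i))"
    by (simp add: sum_words_Suc linear_sum[OF bl])
  also have "norm \<dots> \<le> row_norm X * L2_set (\<lambda>i. norm (?s i)) UNIV"
    by (rule norm_row_le[OF X])
  also have "\<dots> \<le> row_norm X * L2_set (\<lambda>i. row_norm X ^ k * L2_set (\<lambda>\<alpha>. norm (h (i # \<alpha>))) ?L) UNIV"
    by (intro mult_left_mono L2_set_mono Suc.IH row_norm_nonneg[OF X]) simp
  also have "\<dots> = row_norm X ^ Suc k * L2_set (\<lambda>i. L2_set (\<lambda>\<alpha>. norm (h (i # \<alpha>))) ?L) UNIV"
    using row_norm_nonneg[OF X] by (subst L2_set_right_distrib[symmetric]) auto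
  also have "L2_set (\<lambda>i. L2_set (\<lambda>\<alpha>. norm (h (i # \<alpha>))) ?L) UNIV
      = L2_set (\<lambda>\<alpha>. norm (h \<alpha>)) {\<alpha>. length \<alpha> = Suc k}"
    unfolding L2_set_def sum_words_Suc by (simp add: sum_nonneg)
  finally show ?case .
qed

text \<open>The part of degree k is bounded by \<open>row_norm X ^ k\<close> times |c|, since the
  coefficients enter through their Euclidean norm; the series is dominated by a geometric
  one.\<close>

lemma norm_sums_ell2:
  fixes X :: "('n::finite, 'h::chilbert_space) optuple"
  assumes X: "X \<in> op_ball 1"
  shows "\<exists>Y. norm_sums (ell2_nth c) X Y"
proof -
  have Xo: "X \<in> optuples" and r1: "row_norm X < 1" using X by (auto simp: op_ball_def)
  let ?r = "row_norm X"
  note r0 = row_norm_nonneg[OF Xo]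
  define t where "t k h = (\<Sum>\<alpha> | length \<alpha> = k. ell2_nth c \<alpha> *\<^sub>C word_op X \<alpha> h)" for k h
  have wb: "word_op X \<alpha> \<in> bops UNIV" for \<alpha> by (rule word_op_bops[OF Xo])
  have t_add: "t k (x + y) = t k x + t k y" and t_scale: "t k (a *\<^sub>C x) = a *\<^sub>C t k x" for k x y a
    by (simp_all add: t_def bopsD(2,3)[OF wb] scaleC_add_right sum.distrib scaleC_sum_right
        scaleC_scaleC mult.commute)
  have t_le: "norm (t k h) \<le> ?r ^ k * (norm c * norm h)" for k h
  proof -
    have "t k h = (\<Sum>\<alpha> | length \<alpha> = k. word_op X \<alpha> (ell2_nth c \<alpha> *\<^sub>C h))"
      by (simp add: t_def bopsD(3)[OF wb])
    also have "norm \<dots> \<le> ?r ^ k * L2_set (\<lambda>\<alpha>. norm (ell2_nth c \<alpha> *\<^sub>C h)) {\<alpha>. length \<alpha> = k}"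
      by (rule norm_word_sum_le[OF Xo])
    also have "L2_set (\<lambda>\<alpha>. norm (ell2_nth c \<alpha> *\<^sub>C h)) {\<alpha>. length \<alpha> = k} \<le> norm c * norm h"
    proof -
      have "L2_set (\<lambda>\<alpha>. norm (ell2_nth c \<alpha> *\<^sub>C h)) {\<alpha>. length \<alpha> = k}
          = L2_set (\<lambda>\<alpha>. cmod (ell2_nth c \<alpha>)) {\<alpha>. length \<alpha> = k} * norm h"
        by (simp add: L2_set_left_distrib)
      also have "L2_set (\<lambda>\<alpha>. cmod (ell2_nth c \<alpha>)) {\<alpha>. length \<alpha> = k} \<le> norm c"
        unfolding L2_set_def by (rule real_le_lsqrt) (simp_all add: sum_nonneg sum_le_norm_ell2)
      finally show ?thesis by (simp add: mult_right_mono)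
    qed
    finally show ?thesis using r0 by (simp add: mult_left_mono)
  qed
  have geo: "summable (\<lambda>k. ?r ^ (k + N) * (norm c * norm h))" for N h
    using r0 r1 by (intro summable_mult2 summable_ignore_initial_segment summable_geometric) simp
  have summ: "summable (\<lambda>k. t (k + N) h)" for N h
    by (rule summable_comparison_test'[OF geo t_le])
  have norm_summ: "summable (\<lambda>k. norm (t (k + N) h))" for N h
    by (rule summable_comparison_test'[OF geo[of N h], of 0]) (simp add: t_le)
  define Y where "Y h = (\<Sum>k. t k h)" for h
  have tail: "norm (partial_sum (ell2_nth c) X N h - Y h) \<le> ?r ^ N * (norm c / (1 - ?r)) * norm h" for N h
  proof -
    have "Y h = (\<Sum>k. t (k + N) h) + (\<Sum>k<N. t k h)"
      unfolding Y_def by (rule suminf_split_initial_segment) (use summ[of 0] in simp)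
    then have "partial_sum (ell2_nth c) X N h - Y h = - (\<Sum>k. t (k + N) h)"
      by (simp add: partial_sum_def t_def)
    then have "norm (partial_sum (ell2_nth c) X N h - Y h) = norm (\<Sum>k. t (k + N) h)" by simp
    also have "\<dots> \<le> (\<Sum>k. ?r ^ (k + N) * (norm c * norm h))"
      by (rule order_trans[OF summable_norm[OF norm_summ] suminf_le[OF t_le norm_summ geo]])
    also have "\<dots> = 1 / (1 - ?r) * (?r ^ N * (norm c * norm h))"
      using sums_unique[OF sums_mult2[OF geometric_sums[of ?r], of "?r ^ N * (norm c * norm h)"]] r0 r1
      by (simp add: power_add mult.assoc)
    also have "\<dots> = ?r ^ N * (norm c / (1 - ?r)) * norm h" by simp
    finally show ?thesis .
  qed
  have Yb: "Y \<in> bops UNIV"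
  proof (rule bopsI[where B = "norm c / (1 - ?r)"])
    show "norm (Y x) \<le> norm c / (1 - ?r) * norm x" for x
      using tail[of 0 x] by (simp add: partial_sum_def)
    show "Y (x + y) = Y x + Y y" for x y
      unfolding Y_def t_add using suminf_add[OF summ[of 0 x] summ[of 0 y]] by simp
    show "Y (a *\<^sub>C x) = a *\<^sub>C Y x" for a x
      unfolding Y_def t_scale
      using bounded_linear.suminf[OF bounded_linear_scaleC[of a] summ[of 0 x]] by simp
  qed auto
  have "(\<lambda>N. onorm (\<lambda>h. partial_sum (ell2_nth c) X N h - Y h)) \<longlonglongrightarrow> 0"
  proof (rule Lim_null_comparison)
    have "(\<lambda>N. ?r ^ N * (norm c / (1 - ?r))) \<longlonglongrightarrow> 0 * (norm c / (1 - ?r))"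
      using r0 r1 by (intro tendsto_mult LIMSEQ_power_zero tendsto_const) simp
    then show "(\<lambda>N. ?r ^ N * (norm c / (1 - ?r))) \<longlonglongrightarrow> 0" by simp
    have "onorm (\<lambda>h. partial_sum (ell2_nth c) X N h - Y h) \<le> ?r ^ N * (norm c / (1 - ?r))" for N
      by (rule onorm_bound[OF _ tail]) (use r0 r1 in simp)
    moreover have "0 \<le> onorm (\<lambda>h. partial_sum (ell2_nth c) X N h - Y h)" for N
      by (intro onorm_pos_le bounded_linear_sub bops_UNIV_bounded_linear partial_sum_bops Xo Yb)
    ultimately show "\<forall>\<^sub>F N in sequentially.
        norm (onorm (\<lambda>h. partial_sum (ell2_nth c) X N h - Y h)) \<le> ?r ^ N * (norm c / (1 - ?r))"
      by simp
  qed
  then show ?thesis using Yb unfolding norm_sums_def by blast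
qed

lemma nc_eval_tendsto:
  fixes X :: "('n::finite, 'h::chilbert_space) optuple"
  assumes "X \<in> op_ball 1"
  shows "(\<lambda>N. partial_sum (ell2_nth c) X N h) \<longlonglongrightarrow> nc_eval (ell2_nth c) X h"
proof -
  have X: "X \<in> optuples" using assms by (simp add: op_ball_def)
  obtain Y where Y: "norm_sums (ell2_nth c) X Y" using norm_sums_ell2[OF assms] by blast
  show ?thesis using norm_sums_tendsto[OF Y X] nc_eval_eq[OF Y X] by simp
qed

lemma nc_eval_unit:
  fixes X :: "('n::finite, 'h::chilbert_space) optuple"
  assumes "X \<in> op_ball 1"
  shows "nc_eval (ell2_nth (ell2_unit \<beta>)) X = word_op X \<beta>"
proof
  fix h
  have "partial_sum (ell2_nth (ell2_unit \<beta>)) X N h = word_op X \<beta> h" if "N \<ge> Suc (length \<beta>)" for N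
  proof -
    have "partial_sum (ell2_nth (ell2_unit \<beta>)) X N h
        = (\<Sum>\<alpha> | length \<alpha> < N. if \<alpha> = \<beta> then word_op X \<beta> h else 0)"
      unfolding partial_sum_eq by (intro sum.cong) (auto simp: ell2_nth_unit)
    then show ?thesis using that by simp
  qed
  then have "(\<lambda>N. partial_sum (ell2_nth (ell2_unit \<beta>)) X N h) \<longlonglongrightarrow> word_op X \<beta> h"
    by (intro tendsto_eventually) (auto simp: eventually_sequentially)
  with nc_eval_tendsto[OF assms] show "nc_eval (ell2_nth (ell2_unit \<beta>)) X h = word_op X \<beta> h"
    by (rule LIMSEQ_unique)
qed

text \<open>All coefficients move up by the length of \<beta>, so the partial sums agree after a
  shift of the order by that length.\<close>

lemma nc_eval_right_shift:
  fixes X :: "('n::finite, 'h::chilbert_space) optuple"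
  assumes "X \<in> op_ball 1"
  shows "nc_eval (ell2_nth (right_shift \<beta> a)) X = nc_eval (ell2_nth a) X \<circ> word_op X \<beta>"
proof
  fix h
  have "partial_sum (ell2_nth (right_shift \<beta> a)) X (N + length \<beta>) h
      = partial_sum (ell2_nth a) X N (word_op X \<beta> h)" for N
  proof -
    have "partial_sum (ell2_nth (right_shift \<beta> a)) X (N + length \<beta>) h
        = (\<Sum>\<alpha>\<in>(\<lambda>\<gamma>. \<gamma> @ \<beta>) ` {\<gamma>. length \<gamma> < N}. ell2_nth (right_shift \<beta> a) \<alpha> *\<^sub>C word_op X \<alpha> h)"
      unfolding partial_sum_eq
    proof (rule sum.mono_neutral_right)
      show "\<forall>\<alpha>\<in>{\<alpha>. length \<alpha> < N + length \<beta>} - (\<lambda>\<gamma>. \<gamma> @ \<beta>) ` {\<gamma>. length \<gamma> < N}.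
          ell2_nth (right_shift \<beta> a) \<alpha> *\<^sub>C word_op X \<alpha> h = 0"
      proof
        fix \<alpha> assume "\<alpha> \<in> {\<alpha>. length \<alpha> < N + length \<beta>} - (\<lambda>\<gamma>. \<gamma> @ \<beta>) ` {\<gamma>. length \<gamma> < N}"
        then have "\<alpha> \<notin> range (\<lambda>\<gamma>. \<gamma> @ \<beta>)" by auto
        then show "ell2_nth (right_shift \<beta> a) \<alpha> *\<^sub>C word_op X \<alpha> h = 0"
          by (simp add: ell2_nth_right_shift_notin)
      qed
    qed auto
    also have "\<dots> = partial_sum (ell2_nth a) X N (word_op X \<beta> h)"
      unfolding partial_sum_eq
      by (subst sum.reindex) (auto simp: inj_on_def word_op_append)
    finally show ?thesis .
  qed
  then have "(\<lambda>N. partial_sum (ell2_nth a) X N (word_op X \<beta> h))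
      \<longlonglongrightarrow> nc_eval (ell2_nth (right_shift \<beta> a)) X h"
    using LIMSEQ_ignore_initial_segment[OF nc_eval_tendsto[OF assms, of "right_shift \<beta> a" h], of "length \<beta>"]
    by simp
  from LIMSEQ_unique[OF this nc_eval_tendsto[OF assms]]
  show "nc_eval (ell2_nth (right_shift \<beta> a)) X h = (nc_eval (ell2_nth a) X \<circ> word_op X \<beta>) h" by simp
qed

lemma nc_eval_diff:
  fixes X :: "('n::finite, 'h::chilbert_space) optuple"
  assumes "X \<in> op_ball 1"
  shows "nc_eval (ell2_nth (a - b)) X h = nc_eval (ell2_nth a) X h - nc_eval (ell2_nth b) X h"
proof (rule LIMSEQ_unique[OF nc_eval_tendsto[OF assms]])
  have "partial_sum (ell2_nth (a - b)) X N h
      = partial_sum (ell2_nth a) X N h - partial_sum (ell2_nth b) X N h" for N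
    unfolding partial_sum_eq sum_subtractf[symmetric] minus_ell2.rep_eq
    by (intro sum.cong refl) (metis diff_conv_add_uminus scaleC_add_left scaleC_minus_left)
  then show "(\<lambda>N. partial_sum (ell2_nth (a - b)) X N h)
      \<longlonglongrightarrow> nc_eval (ell2_nth a) X h - nc_eval (ell2_nth b) X h"
    using tendsto_diff[OF nc_eval_tendsto[OF assms] nc_eval_tendsto[OF assms]] by simp
qed

text \<open>The sums over words of length k are bounded by |c|^2, and the 2k-th root of a positive
  constant tends to 1. This makes the nondegeneracy condition of case (F) applicable to differences
  of vectors.\<close>

lemma nc_radius_ell2: "1 \<le> nc_radius (ell2_nth (c :: 'n::finite list ell2))"
proof -
  \<comment> \<open>The maximum with 1 keeps the constant under the root positive.\<close>
  define b where "b = max 1 ((norm c)\<^sup>2)"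
  let ?q = "\<lambda>k. ereal (root (2 * k) (\<Sum>w | length w = k. (cmod (ell2_nth c w))\<^sup>2))"
  have "(\<lambda>k. root (2 * k) b) \<longlonglongrightarrow> 1"
    using LIMSEQ_subseq_LIMSEQ[OF LIMSEQ_root_const[of b], of "\<lambda>k. 2 * k"]
    by (simp add: b_def strict_mono_def comp_def)
  then have "limsup (\<lambda>k. ereal (root (2 * k) b)) = 1"
    by (intro lim_imp_Limsup) (simp_all add: one_ereal_def)
  moreover have "limsup ?q \<le> limsup (\<lambda>k. ereal (root (2 * k) b))"
  proof (rule Limsup_mono, rule eventually_sequentiallyI[of 1])
    fix k :: nat assume "1 \<le> k"
    moreover have "(\<Sum>w | length w = k. (cmod (ell2_nth c w))\<^sup>2) \<le> b"
      unfolding b_def by (rule max.coboundedI2) (rule sum_le_norm_ell2, simp)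
    ultimately show "?q k \<le> ereal (root (2 * k) b)" by simp
  qed
  ultimately have le: "limsup ?q \<le> 1" by simp
  have "0 \<le> limsup ?q"
    by (rule le_Limsup) (auto simp: sum_nonneg real_root_ge_zero)
  from ereal_inverse_antimono[OF this le] show ?thesis by (simp add: nc_radius_def)
qed

lemma model_F_universal:
  fixes f :: "'n::finite \<Rightarrow> 'n ncfps"
  assumes "model_F f Z M"
  shows "\<exists>Y. universal_model f Z M Y"
proof -
  let ?ev = "\<lambda>c (X :: ('n, nat ell2) optuple). nc_eval (ell2_nth c) (\<lambda>j. nc_eval (f j) X)"
  from assms obtain \<gamma> Y where
    ball: "\<And>X. X \<in> op_ball \<gamma> \<Longrightarrow> (\<lambda>j. nc_eval (f j) X) \<in> (op_ball 1 :: ('n, nat ell2) optuple set)"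
    and nonzero: "\<And>G. 1 \<le> nc_radius G \<Longrightarrow> G \<noteq> (\<lambda>_. 0) \<Longrightarrow>
      (\<exists>X \<in> (op_ball \<gamma> :: ('n, nat ell2) optuple set). nc_eval G (\<lambda>j. nc_eval (f j) X) \<noteq> (\<lambda>_. 0))"
    and Z: "\<And>i. nc_fun \<gamma> (?ev (Z i)) = nc_fun \<gamma> (\<lambda>X. X i)" and Mb: "\<And>i. M i \<in> bops UNIV"
    and M: "\<And>i c. nc_fun \<gamma> (?ev (M i c)) = nc_fun \<gamma> (\<lambda>X. nc_fun \<gamma> (\<lambda>X. X i) X \<circ> nc_fun \<gamma> (?ev c) X)"
    and conv: "conv_value f M Y"
    and Y: "\<And>j c. nc_fun \<gamma> (?ev (Y j c))
      = nc_fun \<gamma> (\<lambda>X. nc_fun \<gamma> (\<lambda>X. nc_eval (f j) X) X \<circ> nc_fun \<gamma> (?ev c) X)"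
    unfolding model_F_def model_conditions_def by blast
  have fun_at: "F X = G X" if "nc_fun \<gamma> F = nc_fun \<gamma> G" "X \<in> op_ball \<gamma>"
    for F G :: "('n, nat ell2) optuple \<Rightarrow> nat ell2 \<Rightarrow> nat ell2" and X
    using fun_cong[OF that(1), of X] that(2) by (simp add: nc_fun_def)
  have Z': "?ev (Z i) X = X i" if "X \<in> op_ball \<gamma>" for i X by (rule fun_at[OF Z that])
  have M': "?ev (M i c) X = X i \<circ> ?ev c X" if "X \<in> op_ball \<gamma>" for i c X
    using fun_at[OF M that] that by (simp add: nc_fun_def)
  have Y': "?ev (Y j c) X = nc_eval (f j) X \<circ> ?ev c X" if "X \<in> op_ball \<gamma>" for j c X
    using fun_at[OF Y that] that by (simp add: nc_fun_def)
  \<comment> \<open>If two vectors gave the same function, their difference would be a nonzero free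
    holomorphic G on the unit ball with G o f = 0.\<close>
  have inj: "x = y" if eq: "\<And>X. X \<in> op_ball \<gamma> \<Longrightarrow> ?ev x X = ?ev y X" for x y
  proof (rule ccontr)
    assume "x \<noteq> y"
    have "ell2_nth (x - y) \<noteq> (\<lambda>_. 0)"
    proof
      assume "ell2_nth (x - y) = (\<lambda>_. 0)"
      then have "x - y = 0" by (intro ell2_eqI) (simp add: zero_ell2.rep_eq)
      then show False using \<open>x \<noteq> y\<close> by simp
    qed
    from nonzero[OF nc_radius_ell2 this]
    obtain X where X: "X \<in> op_ball \<gamma>" "?ev (x - y) X \<noteq> (\<lambda>_. 0)" by blast
    have "?ev (x - y) X h = 0" for h
      by (simp add: nc_eval_diff[OF ball[OF X(1)]] eq[OF X(1)])
    with X(2) show False by blast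
  qed
  show ?thesis
  proof (rule exI[of _ Y], unfold_locales)
    show "M i \<in> bops UNIV" for i by (rule Mb)
    show "conv_value f M Y" by (rule conv)
    show "M i (ell2_unit \<beta>) = right_shift \<beta> (Z i)" for i \<beta>
    proof (rule inj)
      fix X :: "('n, nat ell2) optuple" assume X: "X \<in> op_ball \<gamma>"
      show "?ev (M i (ell2_unit \<beta>)) X = ?ev (right_shift \<beta> (Z i)) X"
        unfolding M'[OF X] nc_eval_right_shift[OF ball[OF X]] nc_eval_unit[OF ball[OF X]] Z'[OF X] ..
    qed
    show "Y j (ell2_unit []) = ell2_unit [j]" for j
    proof (rule inj)
      fix X :: "('n, nat ell2) optuple" assume X: "X \<in> op_ball \<gamma>"
      show "?ev (Y j (ell2_unit [])) X = ?ev (ell2_unit [j]) X"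
        unfolding Y'[OF X] nc_eval_unit[OF ball[OF X]] by simp
    qed
  qed
qed

theorem theorem6p6:
  fixes f :: "'n::finite \<Rightarrow> 'n ncfps"
    and Z :: "'n \<Rightarrow> 'n list ell2"
    and M :: "('n, 'n list ell2) optuple"
  assumes "model_property f Z M"
  shows "(inj_on (to_fun f Z) symm_space \<and>
      (\<exists>\<Phi>. bij_betw \<Phi> (multipliers f Z) (Hinf_symm M) \<and>
        (\<forall>\<phi>\<in>multipliers f Z. \<forall>\<psi>\<in>symm_space.
          to_fun f Z (\<Phi> \<phi> \<psi>) = (\<lambda>l\<in>scalar_domain f Z. \<phi> l * to_fun f Z \<psi> l)) \<and>
        (\<forall>\<phi>\<in>multipliers f Z. \<forall>\<phi>'\<in>multipliers f Z.
          \<Phi> (\<lambda>l\<in>scalar_domain f Z. \<phi> l + \<phi>' l) = (\<lambda>x\<in>symm_space. \<Phi> \<phi> x + \<Phi> \<phi>' x) \<and>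
          \<Phi> (\<lambda>l\<in>scalar_domain f Z. \<phi> l * \<phi>' l) = compose symm_space (\<Phi> \<phi>) (\<Phi> \<phi>')) \<and>
        (\<forall>c. \<forall>\<phi>\<in>multipliers f Z.
          \<Phi> (\<lambda>l\<in>scalar_domain f Z. c * \<phi> l) = (\<lambda>x\<in>symm_space. c *\<^sub>C \<Phi> \<phi> x)) \<and>
        \<Phi> (\<lambda>l\<in>scalar_domain f Z. 1) = (\<lambda>x\<in>symm_space. x)))
    \<and> reflexive_algebra symm_space (Hinf_symm M)"
proof -
  have "\<exists>Y. universal_model f Z M Y"
    using assms model_A_universal model_S_universal model_F_universal
    unfolding model_property_def by blast
  then obtain Y where "universal_model f Z M Y" by blast
  then interpret universal_model f Z M Y .
  show ?thesis
    by (intro conjI exI[of _ mult_op] ballI allI inj_on_to_fun bij_betw_mult_op mult_op(2)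
        mult_op_algebra mult_op_one reflexive_Hinf_symm)
qed

end
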